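(* Bipartite Matching is not in $\tilde{\mathrm C}$PTime; that is, there is no PTime program that accepts every instance of Bipartite Matching that has a perfect matching and rejects every instance of Bipartite Matching that has no perfect matching.
   Context: Bipartite Matching. Instance: a finite bipartite undirected graph $G=(V,E)$ with its two parts (of "boys" and "girls" respectively) of the same size, the graph being presented as a relational structure on $V$ with the binary edge relation $E$ and unary relations for the two parts. Question: does $G$ have a perfect matching, i.e. a set $F\subseteq E$ of edges such that every vertex is incident to exactly one edge in $F$? ASM MODEL. "Object" means an atom (a non-set) or a set. For a finite set $X$ of atoms, $\mathrm{HF}(X)$ is the smallest set $Y$ such that $X\subseteq Y$ and every finite subset of $Y$ is a member of $Y$. $\mathrm{TC}(x)$ is the least transitive set $Y$ with $x\in Y$. Natural numbers are von Neumann ordinals; $\mathit{false}=0=\emptyset$, $\mathit{true}=1=\{\emptyset\}$. Vocabulary: finitely many function names with arities (some marked relational, called predicates), consisting of: static logic predicates ($=$, nullary $\mathit{true},\mathit{false}$, Boolean connectives); static set-theoretic names (binary predicate $\in$; nullary $\emptyset$, $\mathrm{Atoms}$; unary $\bigcup$, $\mathrm{TheUnique}$; binary $\mathrm{Pair}$); finitely many static input predicates; finitely many dynamic names, including nullary predicates $\mathrm{Halt}$ and $\mathrm{Output}$. State: a structure with base set $\mathrm{HF}(X)$, $X$ a finite set of atoms. Predicates take values in $\{0,1\}$; Boolean connectives are as usual on $\{0,1\}$ and $0$ if some argument is not Boolean; $\in,\emptyset$ are standard; $\mathrm{Atoms}=X$; $\bigcup a$ is the union of those elements of $a$ that are sets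 ($\emptyset$ if $a$ is an atom); $\mathrm{TheUnique}(a)$ is the unique element of $a$ if $a$ is a singleton and $\emptyset$ otherwise; $\mathrm{Pair}(a,b)=\{a,b\}$; input predicates hold only of tuples of atoms; for each dynamic $f$ of arity $j$ the set $\mathrm{Extent}(f)=\{(x_0,\dots,x_j): f(x_0,\dots,x_{j-1})=x_j\neq 0\}$ is finite. An input structure is a finite structure of the input vocabulary (replaced by an isomorphic copy whose elements are atoms); it determines the initial state whose atoms with the input predicates form that structure and in which all dynamic functions have empty extent. Terms: variables; $f(t_1,\dots,t_j)$ (Boolean if $f$ is a predicate); $\{t(v):v\in r:g(v)\}$ with $r$ a term without $v$ free and $g$ a Boolean term ($v$ becomes bound), whose value is the set of values of $t(v)$ for those $v\in r$ with $g(v)$ true. Rules: Skip; $f(t_1,\dots,t_j):=t_0$ with $f$ dynamic ($t_0$ Boolean if $f$ is relational); "if $g$ then $R_1$ else $R_2$ endif" with $g$ a Boolean term; "do forall $v\in r$, $R_0(v)$ enddo" with $r$ a term without $v$ free ($v$ becomes bound). An expanded state is a state with an assignment of values to finitely many variables; $A(v\mapsto a)$ is $A$ with $v$ (re)assigned $a$. $\mathrm{Den}(R,A)$ is a set of updates $(f,\bar a,b)$: $\mathrm{Den}(\text{Skip},A)=\emptyset$; for $f(\bar s):=t$ it is $\{(f,\mathrm{Val}_A(\bar s),\mathrm{Val}_A(t))\}$; for a conditional it is $\mathrm{Den}(R_1,A)$ or $\mathrm{Den}(R_2,A)$ according as $g$ is true or not in $A$; for do-forall it is $\bigcup\{\mathrm{Den}(R_0(v),A(v\mapsto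 a)):a\in\mathrm{Val}_A(r)\}$. The sequel of $A$ with respect to $R$ is obtained by simultaneously setting $f(\bar a)=b$ for all $(f,\bar a,b)\in\mathrm{Den}(R,A)$ if no two updates clash (same $(f,\bar a)$, different $b$); otherwise it is the state $A$ itself. A program is a rule without free variables. The run of a program $\Pi$ on an input structure $I$ is the finite or infinite sequence $A_0,A_1,\dots$ with $A_0$ the initial state of $I$ and each $A_{i+1}$ the sequel of $A_i$ with respect to $\Pi$, which stops at the first state in which $\mathrm{Halt}$ holds (and is infinite if there is none). The length of a finite run $\langle A_i:i\le l\rangle$ is $l$. PTIME PROGRAMS. An object is critical at a state if it is an atom, or $0$ or $1$, or a value of a dynamic function, or a component of a location (argument tuple) where some dynamic function takes a value different from $\emptyset$. It is active at a state if it belongs to $\mathrm{TC}(y)$ for some critical $y$, and active in a run if active at some state of the run. A PTime (ASM) program is $\bar\Pi=(\Pi,p(n),q(n))$ with $\Pi$ a program and $p,q$ integer polynomials; its run on an input structure $I$ of size $n$ is the longest initial segment of the run of $\Pi$ on $I$ that has length $\le p(n)$ and at most $q(n)$ active objects. $\bar\Pi$ accepts (rejects) $I$ if this run halts (i.e. $\mathrm{Halt}$ holds in its final state) and $\mathrm{Output}$ is true (false) in the final state. $\tilde{\mathrm C}$PTIME. A pair $(K_1,K_2)$ of disjoint classes of finite structures of the same vocabulary is in $\tilde{\mathrm C}$PTime if there is a PTime program that accepts all structures in $K_1$ and rejects all structures in $K_2$; a decision problem is in $\tilde{\mathrm C}$PTime if the pair (yes-instances, no-instances) is. *)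

theory Defs
  imports
    "HOL-Library.FSet"
    "HOL-Library.Infinite_Typeclass"
    "HOL-Computational_Algebra.Polynomial"
begin

section \<open>Hereditarily finite objects over atoms\<close>

datatype 'a obj = Atom 'a | HSet "'a obj fset"

text \<open>Atoms have no elements.\<close>

primrec elts :: "'a obj \<Rightarrow> 'a obj fset" where
  "elts (Atom x) = {||}"
| "elts (HSet S) = S"

text \<open>The type \<open>'a obj\<close> contains all hereditarily finite objects over all of \<open>'a\<close>;
  \<open>HF X\<close> carves out those that are built from the atoms in \<open>X\<close>.\<close>

inductive_set HF :: "'a set \<Rightarrow> 'a obj set" for X :: "'a set" where
  HF_Atom: "x \<in> X \<Longrightarrow> Atom x \<in> HF X"
| HF_HSet: "\<forall>y\<in>fset S. y \<in> HF X \<Longrightarrow> HSet S \<in> HF X"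

inductive_set TC :: "'a obj \<Rightarrow> 'a obj set" for x :: "'a obj" where
  TC_self: "x \<in> TC x"
| TC_elt: "y \<in> TC x \<Longrightarrow> z |\<in>| elts y \<Longrightarrow> z \<in> TC x"

definition empty_obj :: "'a obj" where
  "empty_obj = HSet {||}"

text \<open>The truth values are the von Neumann ordinals 0 and 1.\<close>

definition false_obj :: "'a obj" where
  "false_obj = empty_obj"

definition true_obj :: "'a obj" where
  "true_obj = HSet {|empty_obj|}"

definition of_bool_obj :: "bool \<Rightarrow> 'a obj" where
  "of_bool_obj b = (if b then true_obj else false_obj)"

definition is_boolean :: "'a obj \<Rightarrow> bool" where
  "is_boolean x \<longleftrightarrow> x = false_obj \<or> x = true_obj"


section \<open>Vocabularies and input structures\<close>

type_synonym name = string

text \<open>Input predicates with their arities.\<close>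

type_synonym input_voc = "name \<rightharpoonup> nat"

datatype dyn_name = Halt | Output | Dyn name

text \<open>Dynamic names with their arities; the flag marks the relational ones.\<close>

type_synonym dyn_voc = "dyn_name \<rightharpoonup> nat \<times> bool"

definition is_dyn_voc :: "dyn_voc \<Rightarrow> bool" where
  "is_dyn_voc D \<longleftrightarrow> finite (dom D) \<and> D Halt = Some (0, True) \<and> D Output = Some (0, True)"

record 'a rel_struct =
  universe :: "'a fset"
  rels :: "name \<Rightarrow> 'a list set"

text \<open>Names outside the vocabulary are interpreted by the empty relation, so that a structure
  is determined by its universe and the relations of its vocabulary.\<close>

definition is_struct :: "input_voc \<Rightarrow> 'a rel_struct \<Rightarrow> bool" where
  "is_struct U I \<longleftrightarrow>
     (\<forall>P xs. xs \<in> rels I P \<longrightarrow> U P = Some (length xs) \<and> set xs \<subseteq> fset (universe I))"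


section \<open>States\<close>

text \<open>Dynamic functions are total on the type. Outside the vocabulary, at argument lists of the
  wrong length, and at arguments outside \<open>HF X\<close> (\<open>X\<close> the atoms of the state), they are constantly
  the empty set; see \<open>is_state\<close>, which is shown below to be an invariant of runs.\<close>

record 'a state =
  input :: "'a rel_struct"
  dyn :: "dyn_name \<Rightarrow> 'a obj list \<Rightarrow> 'a obj"

definition base_set :: "'a state \<Rightarrow> 'a obj set" where
  "base_set A = HF (fset (universe (input A)))"

definition is_state :: "input_voc \<Rightarrow> dyn_voc \<Rightarrow> 'a state \<Rightarrow> bool" where
  "is_state U D A \<longleftrightarrow>
     is_struct U (input A) \<and>
     (\<forall>f xs. dyn A f xs \<noteq> empty_obj \<longrightarrow>
        (\<exists>b. D f = Some (length xs, b) \<and> (b \<longrightarrow> is_boolean (dyn A f xs))) \<and>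
        set xs \<subseteq> base_set A \<and> dyn A f xs \<in> base_set A) \<and>
     finite {(f, xs). dyn A f xs \<noteq> empty_obj}"

definition initial_state :: "'a rel_struct \<Rightarrow> 'a state" where
  "initial_state I = \<lparr>input = I, dyn = (\<lambda>f xs. empty_obj)\<rparr>"


section \<open>Terms\<close>

datatype fun_sym =
    EqS | TrueS | FalseS | NotS | AndS | OrS | ImpS | IffS
  | MemS | EmptyS | AtomsS | UnionS | TheUniqueS | PairS
  | InS name
  | DynS dyn_name

text \<open>Arity of a function name, and whether it is a predicate.\<close>

fun sym_type :: "input_voc \<Rightarrow> dyn_voc \<Rightarrow> fun_sym \<Rightarrow> (nat \<times> bool) option" where
  "sym_type U D EqS = Some (2, True)"
| "sym_type U D TrueS = Some (0, True)"
| "sym_type U D FalseS = Some (0, True)"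
| "sym_type U D NotS = Some (1, True)"
| "sym_type U D AndS = Some (2, True)"
| "sym_type U D OrS = Some (2, True)"
| "sym_type U D ImpS = Some (2, True)"
| "sym_type U D IffS = Some (2, True)"
| "sym_type U D MemS = Some (2, True)"
| "sym_type U D EmptyS = Some (0, False)"
| "sym_type U D AtomsS = Some (0, False)"
| "sym_type U D UnionS = Some (1, False)"
| "sym_type U D TheUniqueS = Some (1, False)"
| "sym_type U D PairS = Some (2, False)"
| "sym_type U D (InS P) = map_option (\<lambda>k. (k, True)) (U P)"
| "sym_type U D (DynS f) = D f"

text \<open>Interpretation of function names; argument lists of the wrong length, which do not occur in
  well-formed terms, yield the empty set. The union only ranges over those elements that
  are sets, because \<open>elts\<close> is empty on atoms.\<close>

fun interp :: "'a state \<Rightarrow> fun_sym \<Rightarrow> 'a obj list \<Rightarrow> 'a obj" where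
  "interp A EqS [x, y] = of_bool_obj (x = y)"
| "interp A TrueS [] = true_obj"
| "interp A FalseS [] = false_obj"
| "interp A NotS [x] = of_bool_obj (x = false_obj)"
| "interp A AndS [x, y] = of_bool_obj (x = true_obj \<and> y = true_obj)"
| "interp A OrS [x, y] =
     of_bool_obj (is_boolean x \<and> is_boolean y \<and> (x = true_obj \<or> y = true_obj))"
| "interp A ImpS [x, y] =
     of_bool_obj (is_boolean x \<and> is_boolean y \<and> (x = true_obj \<longrightarrow> y = true_obj))"
| "interp A IffS [x, y] = of_bool_obj (is_boolean x \<and> is_boolean y \<and> x = y)"
| "interp A MemS [x, y] = of_bool_obj (x |\<in>| elts y)"
| "interp A EmptyS [] = empty_obj"
| "interp A AtomsS [] = HSet (Atom |`| universe (input A))"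
| "interp A UnionS [x] = HSet (ffUnion (elts |`| elts x))"
| "interp A TheUniqueS [x] =
     (if \<exists>y. elts x = {|y|} then THE y. elts x = {|y|} else empty_obj)"
| "interp A PairS [x, y] = HSet {|x, y|}"
| "interp A (InS P) xs = of_bool_obj (\<exists>as. xs = map Atom as \<and> as \<in> rels (input A) P)"
| "interp A (DynS f) xs = dyn A f xs"
| "interp A _ _ = empty_obj"

type_synonym var = nat

text \<open>\<open>Compr t v r g\<close> stands for \<open>{t(v) : v \<in> r : g(v)}\<close>.\<close>

datatype tm =
    Var var
  | App fun_sym "tm list"
  | Compr tm var tm tm

primrec fv_tm :: "tm \<Rightarrow> var set" where
  "fv_tm (Var v) = {v}"
| "fv_tm (App f ts) = \<Union> (set (map fv_tm ts))"
| "fv_tm (Compr t v r g) = fv_tm r \<union> ((fv_tm t \<union> fv_tm g) - {v})"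

definition bool_tm :: "input_voc \<Rightarrow> dyn_voc \<Rightarrow> tm \<Rightarrow> bool" where
  "bool_tm U D t \<longleftrightarrow> (\<exists>f ts k. t = App f ts \<and> sym_type U D f = Some (k, True))"

primrec wf_tm :: "input_voc \<Rightarrow> dyn_voc \<Rightarrow> tm \<Rightarrow> bool" where
  "wf_tm U D (Var v) = True"
| "wf_tm U D (App f ts) =
     ((\<exists>b. sym_type U D f = Some (length ts, b)) \<and> list_all (wf_tm U D) ts)"
| "wf_tm U D (Compr t v r g) =
     (wf_tm U D t \<and> wf_tm U D r \<and> wf_tm U D g \<and> v \<notin> fv_tm r \<and> bool_tm U D g)"

text \<open>Assignments are total functions; only the values of the free variables matter.\<close>

type_synonym 'a env = "var \<Rightarrow> 'a obj"

primrec val :: "'a state \<Rightarrow> tm \<Rightarrow> 'a env \<Rightarrow> 'a obj" where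
  "val A (Var v) = (\<lambda>e. e v)"
| "val A (App f ts) = (\<lambda>e. interp A f (map (\<lambda>t. val A t e) ts))"
| "val A (Compr t v r g) = (\<lambda>e.
     HSet ((\<lambda>a. val A t (e(v := a))) |`|
           ffilter (\<lambda>a. val A g (e(v := a)) = true_obj) (elts (val A r e))))"


section \<open>Rules\<close>

datatype asm_rule =
    Skip
  | Update dyn_name "tm list" tm
  | IfElse tm asm_rule asm_rule
  | Forall var tm asm_rule

primrec fv_rule :: "asm_rule \<Rightarrow> var set" where
  "fv_rule Skip = {}"
| "fv_rule (Update f ss t) = \<Union> (fv_tm ` set ss) \<union> fv_tm t"
| "fv_rule (IfElse g R1 R2) = fv_tm g \<union> fv_rule R1 \<union> fv_rule R2"
| "fv_rule (Forall v r R) = fv_tm r \<union> (fv_rule R - {v})"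

primrec wf_rule :: "input_voc \<Rightarrow> dyn_voc \<Rightarrow> asm_rule \<Rightarrow> bool" where
  "wf_rule U D Skip = True"
| "wf_rule U D (Update f ss t) =
     ((\<exists>b. D f = Some (length ss, b) \<and> (b \<longrightarrow> bool_tm U D t)) \<and>
      list_all (wf_tm U D) ss \<and> wf_tm U D t)"
| "wf_rule U D (IfElse g R1 R2) =
     (wf_tm U D g \<and> bool_tm U D g \<and> wf_rule U D R1 \<and> wf_rule U D R2)"
| "wf_rule U D (Forall v r R) = (wf_tm U D r \<and> v \<notin> fv_tm r \<and> wf_rule U D R)"

type_synonym 'a update = "dyn_name \<times> 'a obj list \<times> 'a obj"

primrec Den :: "asm_rule \<Rightarrow> 'a state \<Rightarrow> 'a env \<Rightarrow> 'a update set" where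
  "Den Skip A = (\<lambda>e. {})"
| "Den (Update f ss t) A = (\<lambda>e. {(f, map (\<lambda>s. val A s e) ss, val A t e)})"
| "Den (IfElse g R1 R2) A = (\<lambda>e. if val A g e = true_obj then Den R1 A e else Den R2 A e)"
| "Den (Forall v r R) A = (\<lambda>e. \<Union>a\<in>fset (elts (val A r e)). Den R A (e(v := a)))"

definition clash :: "'a update set \<Rightarrow> bool" where
  "clash S \<longleftrightarrow> (\<exists>f xs b c. (f, xs, b) \<in> S \<and> (f, xs, c) \<in> S \<and> b \<noteq> c)"

definition apply_updates :: "'a update set \<Rightarrow> 'a state \<Rightarrow> 'a state" where
  "apply_updates S A = A\<lparr>dyn := (\<lambda>f xs.
     if \<exists>b. (f, xs, b) \<in> S then THE b. (f, xs, b) \<in> S else dyn A f xs)\<rparr>"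

text \<open>Programs have no free variables, so the assignment used here is irrelevant.\<close>

definition sequel :: "asm_rule \<Rightarrow> 'a state \<Rightarrow> 'a state" where
  "sequel R A =
     (let S = Den R A (\<lambda>_. empty_obj) in if clash S then A else apply_updates S A)"

definition is_program :: "input_voc \<Rightarrow> dyn_voc \<Rightarrow> asm_rule \<Rightarrow> bool" where
  "is_program U D R \<longleftrightarrow> is_dyn_voc D \<and> wf_rule U D R \<and> fv_rule R = {}"


section \<open>Runs\<close>

definition halted :: "'a state \<Rightarrow> bool" where
  "halted A \<longleftrightarrow> dyn A Halt [] = true_obj"

text \<open>\<open>run_state R I i\<close> belongs to the run only if \<open>in_run R I i\<close>, that is, if no earlier
  state has halted.\<close>

definition run_state :: "asm_rule \<Rightarrow> 'a rel_struct \<Rightarrow> nat \<Rightarrow> 'a state" where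
  "run_state R I i = (sequel R ^^ i) (initial_state I)"

definition in_run :: "asm_rule \<Rightarrow> 'a rel_struct \<Rightarrow> nat \<Rightarrow> bool" where
  "in_run R I l \<longleftrightarrow> (\<forall>i<l. \<not> halted (run_state R I i))"

definition critical :: "'a state \<Rightarrow> 'a obj set" where
  "critical A =
     Atom ` fset (universe (input A)) \<union> {false_obj, true_obj} \<union>
     {dyn A f xs | f xs. True} \<union>
     {x. \<exists>f xs. dyn A f xs \<noteq> empty_obj \<and> x \<in> set xs}"

definition active :: "'a state \<Rightarrow> 'a obj set" where
  "active A = (\<Union>y\<in>critical A. TC y)"


section \<open>PTime programs\<close>

record ptime_program =
  prog :: asm_rule
  step_bound :: "int poly"
  active_bound :: "int poly"

definition is_ptime_program :: "input_voc \<Rightarrow> ptime_program \<Rightarrow> bool" where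
  "is_ptime_program U P \<longleftrightarrow> (\<exists>D. is_program U D (prog P))"

definition struct_size :: "'a rel_struct \<Rightarrow> nat" where
  "struct_size I = card (fset (universe I))"

text \<open>The initial segment with states \<open>0, ..., l\<close> of the run respects both bounds.\<close>

definition admissible :: "ptime_program \<Rightarrow> 'a rel_struct \<Rightarrow> nat \<Rightarrow> bool" where
  "admissible P I l \<longleftrightarrow>
     in_run (prog P) I l \<and>
     int l \<le> poly (step_bound P) (int (struct_size I)) \<and>
     (let S = (\<Union>i\<le>l. active (run_state (prog P) I i))
      in finite S \<and> int (card S) \<le> poly (active_bound P) (int (struct_size I)))"

text \<open>\<open>l\<close> is the length of the longest admissible initial segment. There is no such \<open>l\<close> if not
  even the initial state is admissible; then the input is neither accepted nor rejected.\<close>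

definition ptime_run_length :: "ptime_program \<Rightarrow> 'a rel_struct \<Rightarrow> nat \<Rightarrow> bool" where
  "ptime_run_length P I l \<longleftrightarrow> admissible P I l \<and> (\<forall>m. admissible P I m \<longrightarrow> m \<le> l)"

definition accepts :: "ptime_program \<Rightarrow> 'a rel_struct \<Rightarrow> bool" where
  "accepts P I \<longleftrightarrow> (\<exists>l. ptime_run_length P I l \<and> halted (run_state (prog P) I l) \<and>
     dyn (run_state (prog P) I l) Output [] = true_obj)"

definition rejects :: "ptime_program \<Rightarrow> 'a rel_struct \<Rightarrow> bool" where
  "rejects P I \<longleftrightarrow> (\<exists>l. ptime_run_length P I l \<and> halted (run_state (prog P) I l) \<and>
     dyn (run_state (prog P) I l) Output [] = false_obj)"

text \<open>Meant for disjoint classes of finite structures of vocabulary \<open>U\<close>. The type \<open>'a\<close> of atoms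
  should be infinite, so that every finite structure has an isomorphic copy over \<open>'a\<close>.\<close>

definition in_CPTime :: "input_voc \<Rightarrow> 'a rel_struct set \<Rightarrow> 'a rel_struct set \<Rightarrow> bool" where
  "in_CPTime U K1 K2 \<longleftrightarrow>
     (\<exists>P. is_ptime_program U P \<and> (\<forall>I\<in>K1. accepts P I) \<and> (\<forall>I\<in>K2. rejects P I))"


section \<open>Bipartite Matching\<close>

definition bip_voc :: input_voc where
  "bip_voc = [''E'' \<mapsto> 2, ''Boy'' \<mapsto> 1, ''Girl'' \<mapsto> 1]"

definition boys :: "'a rel_struct \<Rightarrow> 'a set" where
  "boys I = {v. [v] \<in> rels I ''Boy''}"

definition girls :: "'a rel_struct \<Rightarrow> 'a set" where
  "girls I = {v. [v] \<in> rels I ''Girl''}"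

definition bip_instance :: "'a rel_struct \<Rightarrow> bool" where
  "bip_instance I \<longleftrightarrow>
     is_struct bip_voc I \<and>
     boys I \<inter> girls I = {} \<and> boys I \<union> girls I = fset (universe I) \<and>
     card (boys I) = card (girls I) \<and>
     (\<forall>u v. [u, v] \<in> rels I ''E'' \<longrightarrow> [v, u] \<in> rels I ''E'') \<and>
     (\<forall>u v. [u, v] \<in> rels I ''E'' \<longrightarrow>
        (u \<in> boys I \<and> v \<in> girls I) \<or> (u \<in> girls I \<and> v \<in> boys I))"

definition edges :: "'a rel_struct \<Rightarrow> 'a set set" where
  "edges I = {{u, v} | u v. [u, v] \<in> rels I ''E''}"

definition has_perfect_matching :: "'a rel_struct \<Rightarrow> bool" where
  "has_perfect_matching I \<longleftrightarrow>
     (\<exists>F\<subseteq>edges I. \<forall>v\<in>fset (universe I). \<exists>!e. e \<in> F \<and> v \<in> e)"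

definition bip_matching_yes :: "'a rel_struct set" where
  "bip_matching_yes = {I. bip_instance I \<and> has_perfect_matching I}"

definition bip_matching_no :: "'a rel_struct set" where
  "bip_matching_no = {I. bip_instance I \<and> \<not> has_perfect_matching I}"

lemma bip_matching_disjoint: "bip_matching_yes \<inter> bip_matching_no = {}"
  by (auto simp: bip_matching_yes_def bip_matching_no_def)

lemma bip_matching_struct: "I \<in> bip_matching_yes \<union> bip_matching_no \<Longrightarrow> is_struct bip_voc I"
  by (auto simp: bip_matching_yes_def bip_matching_no_def bip_instance_def)


section \<open>Runs consist of states\<close>

lemma empty_in_HF: "empty_obj \<in> HF X"
  by (simp add: empty_obj_def HF_HSet)

lemma true_in_HF: "true_obj \<in> HF X"
  by (simp add: true_obj_def HF_HSet empty_in_HF)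

lemma of_bool_in_HF: "of_bool_obj b \<in> HF X"
  by (simp add: of_bool_obj_def true_in_HF false_obj_def empty_in_HF)

lemma is_boolean_of_bool: "is_boolean (of_bool_obj b)"
  by (simp add: is_boolean_def of_bool_obj_def)

lemma elts_in_HF: "x \<in> HF X \<Longrightarrow> y |\<in>| elts x \<Longrightarrow> y \<in> HF X"
  by (erule HF.cases) auto

lemma interp_in_base:
  assumes "is_state U D A" and "set xs \<subseteq> base_set A"
  shows "interp A f xs \<in> base_set A"
proof -
  have d: "dyn A g ys \<in> base_set A" for g ys
    using assms(1) empty_in_HF[of "fset (universe (input A))"]
    unfolding is_state_def base_set_def by metis
  have u: "(if \<exists>y. elts x = {|y|} then THE y. elts x = {|y|} else empty_obj) \<in> base_set A"
    if "x \<in> base_set A" for x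
    using that by (auto simp: base_set_def empty_in_HF dest: elts_in_HF)
  have un: "HSet (ffUnion (elts |`| elts x)) \<in> base_set A" if "x \<in> base_set A" for x
    using that unfolding base_set_def
    by (intro HF_HSet) (auto simp: ffUnion.rep_eq dest: elts_in_HF)
  show ?thesis
    using assms(2)
    by (cases "(A, f, xs)" rule: interp.cases)
       (auto simp: d u un base_set_def[symmetric] of_bool_in_HF[folded base_set_def]
         of_bool_in_HF[of _ "fset (universe (input A))", folded base_set_def]
         true_in_HF[of "fset (universe (input A))", folded base_set_def]
         empty_in_HF[of "fset (universe (input A))", folded base_set_def] false_obj_def
         split del: if_split
         intro!: HF_HSet[of _ "fset (universe (input A))", folded base_set_def]
           HF_Atom[of _ "fset (universe (input A))", folded base_set_def])
qed

lemma val_in_base: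
  assumes "is_state U D A"
  shows "(\<And>v. e v \<in> base_set A) \<Longrightarrow> val A t e \<in> base_set A"
proof (induction t arbitrary: e)
  case (App f ts)
  then have "set (map (\<lambda>t. val A t e) ts) \<subseteq> base_set A" by auto
  then show ?case using interp_in_base[OF assms] by simp
next
  case (Compr t v r g)
  have *: "a \<in> base_set A" if "a |\<in>| elts (val A r e)" for a
    using Compr.IH(2)[of e, OF Compr.prems] that unfolding base_set_def by (rule elts_in_HF)
  have "val A t (e(v := a)) \<in> base_set A" if "a |\<in>| elts (val A r e)" for a
    by (rule Compr.IH(1)) (use * that Compr.prems in auto)
  then show ?case by (auto simp: base_set_def intro!: HF_HSet)
qed auto

lemma bool_val:
  assumes A: "is_state U D A" and "wf_tm U D t" and "bool_tm U D t"
  shows "is_boolean (val A t e)"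
proof -
  obtain f ts k where t: "t = App f ts" and k: "sym_type U D f = Some (k, True)"
    using assms(3) by (auto simp: bool_tm_def)
  have s: "sym_type U D f = Some (length ts, True)" using assms(2) k t by auto
  have "is_boolean (dyn A g xs)" if "D g = Some (n, True)" for g xs n
    using A that unfolding is_state_def is_boolean_def false_obj_def by fastforce
  moreover have "is_boolean empty_obj" "is_boolean true_obj" "is_boolean false_obj"
    by (auto simp: is_boolean_def false_obj_def)
  ultimately show ?thesis
    using s unfolding t
    by (cases "(A, f, map (\<lambda>t. val A t e) ts)" rule: interp.cases)
       (auto simp: is_boolean_of_bool)
qed

lemma Den_props:
  assumes A: "is_state U D A"
  shows "wf_rule U D R \<Longrightarrow> (\<And>v. e v \<in> base_set A) \<Longrightarrow>
    finite (Den R A e) \<and>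
    (\<forall>(f, xs, b) \<in> Den R A e. set xs \<subseteq> base_set A \<and> b \<in> base_set A \<and>
       (\<exists>c. D f = Some (length xs, c) \<and> (c \<longrightarrow> is_boolean b)))"
proof (induction R arbitrary: e)
  case (Update f ss t)
  then show ?case using val_in_base[OF A Update.prems(2)] bool_val[OF A] by auto
next
  case (Forall v r R)
  have "a \<in> base_set A" if "a |\<in>| elts (val A r e)" for a
    using val_in_base[of U D A e r, OF A Forall.prems(2)] that unfolding base_set_def
    by (rule elts_in_HF)
  then have "finite (Den R A (e(v := a))) \<and>
    (\<forall>(f, xs, b) \<in> Den R A (e(v := a)). set xs \<subseteq> base_set A \<and> b \<in> base_set A \<and>
       (\<exists>c. D f = Some (length xs, c) \<and> (c \<longrightarrow> is_boolean b)))"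
    if "a |\<in>| elts (val A r e)" for a
    using that Forall.prems by (intro Forall.IH) auto
  then show ?case by fastforce
next
  case (IfElse g R1 R2)
  have "Den (IfElse g R1 R2) A e = (if val A g e = true_obj then Den R1 A e else Den R2 A e)"
    by simp
  moreover have "wf_rule U D R1" "wf_rule U D R2" using IfElse.prems(1) by simp_all
  ultimately show ?case
    using IfElse.IH(1)[of e] IfElse.IH(2)[of e] IfElse.prems(2) by presburger
qed auto

lemma sequel_is_state:
  assumes A: "is_state U D A" and R: "wf_rule U D R"
  shows "is_state U D (sequel R A)"
proof -
  define S where "S = Den R A (\<lambda>_. empty_obj)"
  have e: "empty_obj \<in> base_set A" by (simp add: base_set_def empty_in_HF)
  have fin: "finite S" and
    S: "\<And>f xs b. (f, xs, b) \<in> S \<Longrightarrow> set xs \<subseteq> base_set A \<and> b \<in> base_set A \<and>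
       (\<exists>c. D f = Some (length xs, c) \<and> (c \<longrightarrow> is_boolean b))"
    using Den_props[OF A R, of "\<lambda>_. empty_obj"] e unfolding S_def by blast+
  show ?thesis
  proof (cases "clash S")
    case True
    then show ?thesis using A by (simp add: sequel_def S_def)
  next
    case False
    define B where "B = apply_updates S A"
    have new: "dyn B f xs = b" if "(f, xs, b) \<in> S" for f xs b
    proof -
      have "(THE c. (f, xs, c) \<in> S) = b"
        using that False unfolding clash_def by (intro the_equality) blast+
      then show ?thesis using that by (auto simp: B_def apply_updates_def)
    qed
    have old: "dyn B f xs = dyn A f xs" if "\<nexists>b. (f, xs, b) \<in> S" for f xs
      using that by (simp add: B_def apply_updates_def)
    have in_eq: "input B = input A" "base_set B = base_set A"
      by (simp_all add: B_def apply_updates_def base_set_def)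
    have "{(f, xs). dyn B f xs \<noteq> empty_obj} \<subseteq>
        {(f, xs). dyn A f xs \<noteq> empty_obj} \<union> (\<lambda>(f, xs, b). (f, xs)) ` S"
      using old by (force simp: image_iff)
    moreover have "finite ({(f, xs). dyn A f xs \<noteq> empty_obj} \<union> (\<lambda>(f, xs, b). (f, xs)) ` S)"
      using A fin by (simp add: is_state_def)
    ultimately have "finite {(f, xs). dyn B f xs \<noteq> empty_obj}"
      by (rule finite_subset)
    moreover have "(\<exists>b. D f = Some (length xs, b) \<and> (b \<longrightarrow> is_boolean (dyn B f xs))) \<and>
        set xs \<subseteq> base_set A \<and> dyn B f xs \<in> base_set A"
      if "dyn B f xs \<noteq> empty_obj" for f xs
    proof (cases "\<exists>b. (f, xs, b) \<in> S")
      case True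
      then show ?thesis using S new by fastforce
    next
      case False
      then show ?thesis using A old[OF False] that unfolding is_state_def by auto
    qed
    moreover have "is_struct U (input A)" using A by (simp add: is_state_def)
    ultimately have "is_state U D B" unfolding is_state_def in_eq by blast
    then show ?thesis using False by (simp add: sequel_def S_def B_def)
  qed
qed

lemma run_is_state:
  assumes "is_struct U I" and "is_program U D R"
  shows "is_state U D (run_state R I i)"
proof (induction i)
  case 0
  show ?case using assms(1) by (simp add: run_state_def initial_state_def is_state_def)
next
  case (Suc i)
  then show ?case using sequel_is_state assms(2) by (auto simp: run_state_def is_program_def)
qed

end

theory Submission
  imports Defs "HOL-Combinatorics.Permutations"
begin

text \<open>
  Consider a graph that consists of two complete bipartite graphs, on boys of colour 0 and girls of
  colour 2, and on boys of colour 1 and girls of colour 3. It has a perfect matching if all four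
  colour classes have size \<open>m\<close>, and none if the sizes are \<open>m + 1\<close>, \<open>m - 1\<close>, \<open>m\<close>, \<open>m\<close>.
  All colour-preserving permutations are automorphisms, so the orbit of an active object
  consists of active objects and has polynomial size. This forces every object that occurs in the
  first run, transient values of subterms included, to be fixed by all automorphisms that fix
  a suitable set of at most \<open>K\<close> atoms, where \<open>K\<close> depends on the program only. Objects which are
  hereditarily of this kind can be transported to the second graph along partial injections of
  bounded size. Transport is injective and commutes with the evaluation of terms and rules,
  so both runs halt at the same step, with the same output. The polynomial bounds are
  needed only for the first run.
\<close>

section \<open>Colour-preserving permutations and supports\<close>

text \<open>No colour-preserving bijection between the two vertex sets exists, so atoms can be
  matched only a few at a time. Each colour class has at least \<open>m - 1\<close> atoms on either
  side, so a matching of boundedly many atoms can always be extended. Supports are not canonical.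
  Transport therefore uses all small supports and all compatible injections at once, and
  independence of the choice is proved afterwards from the symmetry of the source object. The number
  of steps grows with the input while the injections must stay bounded. Hence two states count as
  similar if they agree along every injection of size up to a fixed \<open>L\<close>, and each step
  re-establishes this with the same \<open>L\<close>: the arguments and the value of an update have
  jointly bounded supports, so its evaluation can begin with an injection of bounded size. The order
  of choice is: the program gives the exponent \<open>d\<close>, then \<open>K = 4 * d + 1\<close>
  (at most \<open>d\<close> atoms from each of four classes), then \<open>L\<close>, and last
  \<open>m\<close>, for which a binomial coefficient of order \<open>d + 1\<close> exceeds the
  polynomial bound of degree \<open>d\<close>.\<close>

lemma elts_map_obj: "elts (map_obj f x) = map_obj f |`| elts x"
  by (cases x) auto

lemma map_obj_inverse:
  assumes "bij f" shows "map_obj (inv f) (map_obj f x) = x" "map_obj f (map_obj (inv f) y) = y"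
  using assms
  by (simp_all add: obj.map_comp bij_is_inj inv_o_cancel bij_is_surj obj.map_id0 surj_iff[THEN iffD1])

lemma inj_map_obj: assumes "bij f" shows "map_obj f x = map_obj f y \<longleftrightarrow> x = y"
proof
  assume "map_obj f x = map_obj f y"
  then have "map_obj (inv f) (map_obj f x) = map_obj (inv f) (map_obj f y)" by (rule arg_cong)
  then show "x = y" by (simp only: map_obj_inverse(1)[OF assms])
qed simp

lemma mem_elts_map_obj: "bij f \<Longrightarrow> map_obj f y |\<in>| elts (map_obj f x) \<longleftrightarrow> y |\<in>| elts x"
  by (auto simp: elts_map_obj inj_map_obj)

definition transitive :: "'a obj set \<Rightarrow> bool" where
  "transitive W \<longleftrightarrow> (\<forall>x\<in>W. fset (elts x) \<subseteq> W)"

locale coloured_set =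
  fixes X :: "'a set" and col :: "'a \<Rightarrow> nat"
  assumes finite_X: "finite X"
begin

definition auts :: "('a \<Rightarrow> 'a) set" where
  "auts = {\<pi>. \<pi> permutes X \<and> (\<forall>a. col (\<pi> a) = col a)}"

text \<open>Support in the sense of permutation models. It is neither unique nor minimal: every
  larger set is a support as well.\<close>

definition supports :: "'a set \<Rightarrow> 'a obj \<Rightarrow> bool" where
  "supports F x \<longleftrightarrow> (\<forall>\<pi>\<in>auts. (\<forall>a\<in>F. \<pi> a = a) \<longrightarrow> map_obj \<pi> x = x)"

definition symmetric :: "'a obj set \<Rightarrow> bool" where
  "symmetric W \<longleftrightarrow> (\<forall>\<pi>\<in>auts. \<forall>x\<in>W. map_obj \<pi> x \<in> W)"

definition cls :: "'a \<Rightarrow> 'a set" where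
  "cls a = {b \<in> X. col b = col a}"

text \<open>There is no condition on atoms, since \<open>{a}\<close> is a support of \<open>a\<close>.\<close>

inductive_set hsym :: "nat \<Rightarrow> 'a obj set" for K :: nat where
  hsym_Atom: "a \<in> X \<Longrightarrow> Atom a \<in> hsym K"
| hsym_HSet: "\<forall>s\<in>fset S. s \<in> hsym K \<Longrightarrow> F \<subseteq> X \<Longrightarrow> card F \<le> K \<Longrightarrow> supports F (HSet S)
    \<Longrightarrow> HSet S \<in> hsym K"

section \<open>The automorphism group and its action on supports\<close>

lemma autsD:
  assumes "\<pi> \<in> auts" shows "\<pi> permutes X" "bij \<pi>" "col (\<pi> a) = col a" "\<pi> a \<in> X \<longleftrightarrow> a \<in> X"
  using assms by (auto simp: auts_def permutes_in_image permutes_bij)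

lemma aut_eq_iff: "\<pi> \<in> auts \<Longrightarrow> \<pi> a = \<pi> b \<longleftrightarrow> a = b"
  using autsD(2) by (metis bij_is_inj injD)

lemma id_auts: "id \<in> auts"
  by (simp add: auts_def permutes_id)

lemma comp_auts: "\<pi> \<in> auts \<Longrightarrow> \<rho> \<in> auts \<Longrightarrow> \<pi> \<circ> \<rho> \<in> auts"
  by (simp add: auts_def permutes_compose)

lemma inv_auts: assumes "\<pi> \<in> auts" shows "inv \<pi> \<in> auts"
proof -
  have "col (inv \<pi> a) = col a" for a
    using autsD(3)[OF assms, of "inv \<pi> a"] autsD(1)[OF assms] by (simp add: permutes_inverses)
  then show ?thesis using assms by (simp add: auts_def permutes_inv)
qed

lemma transpose_auts: "a \<in> X \<Longrightarrow> b \<in> X \<Longrightarrow> col a = col b \<Longrightarrow> transpose a b \<in> auts"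
  by (simp add: auts_def permutes_swap_id transpose_def)

lemma finite_auts: "finite auts"
  by (rule finite_subset[OF _ finite_permutations[OF finite_X]]) (auto simp: auts_def)

lemma supports_mono: "supports F x \<Longrightarrow> F \<subseteq> G \<Longrightarrow> supports G x"
  by (auto simp: supports_def)

text \<open>If \<rho> fixes the image of \<open>F\<close> pointwise, its conjugate by \<pi> fixes
  \<open>F\<close> pointwise and hence fixes \<open>x\<close>.\<close>

lemma supports_image:
  assumes \<pi>: "\<pi> \<in> auts" and F: "supports F x"
  shows "supports (\<pi> ` F) (map_obj \<pi> x)"
  unfolding supports_def
proof (intro ballI impI)
  fix \<rho> assume \<rho>: "\<rho> \<in> auts" "\<forall>a\<in>\<pi> ` F. \<rho> a = a"
  have "inv \<pi> \<circ> \<rho> \<circ> \<pi> \<in> auts" using \<pi> \<rho> by (simp add: comp_auts inv_auts)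
  moreover have "(inv \<pi> \<circ> \<rho> \<circ> \<pi>) a = a" if "a \<in> F" for a
    using \<rho>(2) that autsD(1)[OF \<pi>] by (simp add: permutes_inverses)
  ultimately have "map_obj (inv \<pi> \<circ> \<rho> \<circ> \<pi>) x = x"
    using F by (auto simp: supports_def)
  then have "map_obj \<pi> (map_obj (inv \<pi> \<circ> \<rho> \<circ> \<pi>) x) = map_obj \<pi> x" by simp
  then show "map_obj \<rho> (map_obj \<pi> x) = map_obj \<pi> x"
    using autsD(2)[OF \<pi>] by (simp add: obj.map_comp[symmetric] map_obj_inverse)
qed

lemma supports_elt:
  assumes "supports F x" "\<pi> \<in> auts" "\<forall>a\<in>F. \<pi> a = a" "s |\<in>| elts x"
  shows "map_obj \<pi> s |\<in>| elts x"
  using assms mem_elts_map_obj[of \<pi> s x] autsD(2) by (auto simp: supports_def)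

lemma hsym_elts: "x \<in> hsym K \<Longrightarrow> s |\<in>| elts x \<Longrightarrow> s \<in> hsym K"
  by (erule hsym.cases) auto

lemma hsym_map_obj:
  assumes "x \<in> hsym K" "\<pi> \<in> auts" shows "map_obj \<pi> x \<in> hsym K"
  using assms(1)
proof induction
  case (hsym_Atom a)
  then show ?case using autsD(4)[OF assms(2)] by (auto intro: hsym.hsym_Atom)
next
  case (hsym_HSet S F)
  have "\<pi> ` F \<subseteq> X" using hsym_HSet autsD(4)[OF assms(2)] by auto
  moreover have "card (\<pi> ` F) \<le> K"
    using hsym_HSet(2,3) finite_subset[OF hsym_HSet(2) finite_X] card_image_le le_trans by metis
  moreover have "supports (\<pi> ` F) (HSet (map_obj \<pi> |`| S))"
    using supports_image[OF assms(2) hsym_HSet(4)] by simp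
  moreover have "\<forall>s\<in>fset (map_obj \<pi> |`| S). s \<in> hsym K" using hsym_HSet(1) by auto
  ultimately have "HSet (map_obj \<pi> |`| S) \<in> hsym K" by (intro hsym.hsym_HSet)
  then show ?case by simp
qed

lemma hsym_support:
  assumes "x \<in> hsym K" "1 \<le> K"
  obtains F where "F \<subseteq> X" "card F \<le> K" "supports F x"
  using assms
proof cases
  case (hsym_Atom a)
  have "supports {a} x" using hsym_Atom by (auto simp: supports_def)
  then show ?thesis using that[of "{a}"] hsym_Atom assms(2) by auto
qed blast

text \<open>Points are assigned one at a time. The transposition composed at each stage corrects the
  value at the new point and leaves the earlier values alone, because \<open>g\<close> and the
  permutation built so far are both injective.\<close>

lemma extend_to_aut:
  assumes "finite D" "D \<subseteq> X" "inj_on g D" "g ` D \<subseteq> X" "\<forall>a\<in>D. col (g a) = col a"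
  obtains \<pi> where "\<pi> \<in> auts" "\<forall>a\<in>D. \<pi> a = g a"
proof -
  have "\<exists>\<pi>\<in>auts. \<forall>a\<in>D. \<pi> a = g a"
    using assms
  proof (induction D)
    case empty
    then show ?case using id_auts by auto
  next
    case (insert a D)
    then obtain \<pi> where \<pi>: "\<pi> \<in> auts" "\<forall>d\<in>D. \<pi> d = g d" by auto
    have "transpose (\<pi> a) (g a) \<in> auts"
      using insert.prems autsD(3,4)[OF \<pi>(1)] by (intro transpose_auts) auto
    then have "transpose (\<pi> a) (g a) \<circ> \<pi> \<in> auts" using \<pi>(1) by (rule comp_auts)
    moreover have "(transpose (\<pi> a) (g a) \<circ> \<pi>) d = g d" if d: "d \<in> D" for d
    proof -
      have "g d \<noteq> g a" using d insert.hyps insert.prems(2) by (auto simp: inj_on_def)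
      moreover have "\<pi> d \<noteq> \<pi> a"
        using d insert.hyps aut_eq_iff[OF \<pi>(1)] by auto
      ultimately show ?thesis using d \<pi>(2) by (simp add: transpose_def)
    qed
    ultimately show ?case by (intro bexI[of _ "transpose (\<pi> a) (g a) \<circ> \<pi>"]) auto
  qed
  then show ?thesis using that by blast
qed

text \<open>Induction on the number of moved atoms: composing \<pi> with the transposition of
  \<open>a\<close> and \<open>\<pi> a\<close> fixes \<open>a\<close> and moves nothing new, and this
  transposition avoids \<open>B\<close>. So the transpositions within colour classes outside
  \<open>B\<close> generate the pointwise stabiliser of \<open>B\<close>.\<close>

lemma supports_if_transpositions:
  assumes "\<And>a b. a \<in> X - B \<Longrightarrow> b \<in> X - B \<Longrightarrow> col a = col b \<Longrightarrow> map_obj (transpose a b) x = x"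
  shows "supports B x"
  unfolding supports_def
proof (intro ballI impI)
  fix \<pi> assume "\<pi> \<in> auts" "\<forall>a\<in>B. \<pi> a = a"
  then show "map_obj \<pi> x = x"
  proof (induction "card {a \<in> X. \<pi> a \<noteq> a}" arbitrary: \<pi> rule: less_induct)
    case less
    note p = autsD[OF less.prems(1)]
    show ?case
    proof (cases "\<exists>a\<in>X. \<pi> a \<noteq> a")
      case False
      then have "\<pi> = id" using p(1) by (auto simp: fun_eq_iff permutes_def)
      then show ?thesis by (simp add: obj.map_id0)
    next
      case True
      then obtain a where a: "a \<in> X" "\<pi> a \<noteq> a" by auto
      let ?\<tau> = "transpose a (\<pi> a)"
      have nB: "a \<notin> B" "\<pi> a \<notin> B" using less.prems(2) a(2) aut_eq_iff[OF less.prems(1), of "\<pi> a" a] by (blast, metis)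
      have \<tau>: "?\<tau> \<in> auts" using a p by (intro transpose_auts) auto
      have *: "?\<tau> \<circ> \<pi> \<in> auts" using \<tau> less.prems(1) by (rule comp_auts)
      have "{d \<in> X. (?\<tau> \<circ> \<pi>) d \<noteq> d} \<subset> {d \<in> X. \<pi> d \<noteq> d}"
      proof
        show "{d \<in> X. (?\<tau> \<circ> \<pi>) d \<noteq> d} \<subseteq> {d \<in> X. \<pi> d \<noteq> d}"
          using a aut_eq_iff[OF less.prems(1), of "\<pi> a" a] by (auto simp: transpose_def)
        have "(?\<tau> \<circ> \<pi>) a = a" by simp
        then show "{d \<in> X. (?\<tau> \<circ> \<pi>) d \<noteq> d} \<noteq> {d \<in> X. \<pi> d \<noteq> d}" using a by blast
      qed
      then have "card {d \<in> X. (?\<tau> \<circ> \<pi>) d \<noteq> d} < card {d \<in> X. \<pi> d \<noteq> d}"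
        using finite_X by (intro psubset_card_mono) auto
      moreover have "\<forall>d\<in>B. (?\<tau> \<circ> \<pi>) d = d"
        using less.prems(2) nB by (auto simp: transpose_def)
      ultimately have "map_obj (?\<tau> \<circ> \<pi>) x = x" using * less.hyps by blast
      moreover have "map_obj ?\<tau> x = x" using a nB p by (intro assms) auto
      moreover have "\<pi> = ?\<tau> \<circ> (?\<tau> \<circ> \<pi>)" by (simp add: fun_eq_iff)
      ultimately show ?thesis by (metis obj.map_comp)
    qed
  qed
qed

section \<open>Orbits and exchangeable atoms\<close>

definition orbit_on :: "'a set \<Rightarrow> 'a obj \<Rightarrow> 'a obj set" where
  "orbit_on U x = (\<lambda>\<pi>. map_obj \<pi> x) ` {\<pi> \<in> auts. \<forall>a. a \<notin> U \<longrightarrow> \<pi> a = a}"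

text \<open>For fixed \<open>x\<close> an equivalence relation; its classes consist of atoms of one
  colour that \<open>x\<close> cannot tell apart.\<close>

definition exchangeable :: "'a obj \<Rightarrow> 'a \<Rightarrow> 'a \<Rightarrow> bool" where
  "exchangeable x a b \<longleftrightarrow> col a = col b \<and> map_obj (transpose a b) x = x"

lemma finite_orbit_on: "finite (orbit_on U x)"
  unfolding orbit_on_def using finite_auts by auto

text \<open>A permutation that moves only points of \<open>U - F - {a, b}\<close> fixes
  \<open>s\<close> and commutes with the transposition, so it fixes the transpose of
  \<open>s\<close> too. Hence no set in the smaller orbit contains the transpose of
  \<open>s\<close>, whereas every set in the transposed copy of that orbit does. The two copies are
  disjoint, equally large, and both lie in the larger orbit.\<close>

lemma double_orbit:
  assumes s: "s |\<in>| S" and F: "supports F s"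
    and ab: "a \<in> U" "b \<in> U" "U \<subseteq> X" "col a = col b"
    and ns: "map_obj (transpose a b) s |\<notin>| S"
  shows "2 * card (orbit_on (U - F - {a, b}) (HSet S)) \<le> card (orbit_on U (HSet S))"
proof -
  let ?\<tau> = "transpose a b" and ?O = "orbit_on (U - F - {a, b}) (HSet S)"
  have \<tau>: "?\<tau> \<in> auts" using ab by (intro transpose_auts) auto
  have 1: "?O \<subseteq> orbit_on U (HSet S)" by (auto simp: orbit_on_def)
  have 2: "map_obj ?\<tau> ` ?O \<subseteq> orbit_on U (HSet S)"
  proof
    fix y assume "y \<in> map_obj ?\<tau> ` ?O"
    then obtain \<pi> where \<pi>: "\<pi> \<in> auts" "\<And>d. d \<notin> U - F - {a, b} \<Longrightarrow> \<pi> d = d"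
      and y: "y = map_obj (?\<tau> \<circ> \<pi>) (HSet S)"
      by (auto simp: orbit_on_def obj.map_comp simp del: obj.map)
    have "?\<tau> \<circ> \<pi> \<in> {\<pi> \<in> auts. \<forall>a. a \<notin> U \<longrightarrow> \<pi> a = a}"
      using \<pi>(2) ab comp_auts[OF \<tau> \<pi>(1)] by (auto simp: transpose_def)
    then show "y \<in> orbit_on U (HSet S)" unfolding orbit_on_def y by blast
  qed
  have "?O \<inter> map_obj ?\<tau> ` ?O = {}"
  proof (rule ccontr)
    assume "\<not> ?thesis"
    then obtain \<pi> \<rho> where \<pi>: "\<pi> \<in> auts" "\<And>d. d \<notin> U - F - {a, b} \<Longrightarrow> \<pi> d = d"
      and \<rho>: "\<rho> \<in> auts" "\<And>d. d \<notin> U - F - {a, b} \<Longrightarrow> \<rho> d = d"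
      and eq: "map_obj \<pi> (HSet S) = map_obj ?\<tau> (map_obj \<rho> (HSet S))"
      by (fastforce simp: orbit_on_def)
    have "map_obj \<rho> s = s" using F \<rho> by (auto simp: supports_def)
    then have "map_obj ?\<tau> s |\<in>| elts (map_obj ?\<tau> (map_obj \<rho> (HSet S)))"
      using s \<rho>(1) \<tau> by (metis autsD(2) elts.simps(2) mem_elts_map_obj)
    then obtain s' where s': "s' |\<in>| S" "map_obj ?\<tau> s = map_obj \<pi> s'"
      unfolding eq[symmetric] by auto
    have "\<pi> \<circ> ?\<tau> = ?\<tau> \<circ> \<pi>"
    proof
      fix d
      have "\<pi> d = a \<longleftrightarrow> d = a" "\<pi> d = b \<longleftrightarrow> d = b"
        using \<pi>(2)[of a] \<pi>(2)[of b] aut_eq_iff[OF \<pi>(1), of d a] aut_eq_iff[OF \<pi>(1), of d b]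
        by auto
      then show "(\<pi> \<circ> ?\<tau>) d = (?\<tau> \<circ> \<pi>) d"
        using \<pi>(2)[of a] \<pi>(2)[of b] by (auto simp: transpose_def)
    qed
    moreover have "map_obj \<pi> s = s" using F \<pi> by (auto simp: supports_def)
    ultimately have "map_obj \<pi> (map_obj ?\<tau> s) = map_obj ?\<tau> s"
      by (metis obj.map_comp)
    then have "map_obj \<pi> (map_obj ?\<tau> s) = map_obj \<pi> s'" using s'(2) by simp
    then have "map_obj ?\<tau> s = s'" using \<pi>(1) autsD(2) inj_map_obj by blast
    then show False using ns s' by simp
  qed
  moreover have "card (map_obj ?\<tau> ` ?O) = card ?O"
    using autsD(2)[OF \<tau>] by (intro card_image) (auto simp: inj_on_def inj_map_obj)
  ultimately have "card (?O \<union> map_obj ?\<tau> ` ?O) = 2 * card ?O"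
    using finite_orbit_on by (simp add: card_Un_disjoint)
  then show ?thesis using 1 2 finite_orbit_on by (metis Un_least card_mono)
qed

text \<open>A pair that is not exchangeable is removed together with a support of an element that
  separates it. This costs at most \<open>K + 2\<close> atoms and halves the orbit by
  \<open>double_orbit\<close>, so an orbit smaller than \<open>2 ^ t\<close> permits fewer than
  \<open>t\<close> rounds.\<close>

lemma large_exchangeable_set:
  assumes "\<forall>s\<in>fset S. \<exists>F\<subseteq>X. card F \<le> K \<and> supports F s"
    and "U \<subseteq> X" and "card (orbit_on U (HSet S)) < 2 ^ t"
  shows "\<exists>V\<subseteq>U. card (U - V) \<le> (K + 2) * t \<and>
    (\<forall>a\<in>V. \<forall>b\<in>V. col a = col b \<longrightarrow> exchangeable (HSet S) a b)"
  using assms(2,3)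
proof (induction t arbitrary: U)
  case 0
  have "HSet S \<in> orbit_on U (HSet S)"
    unfolding orbit_on_def by (rule image_eqI[of _ _ id]) (auto simp: id_auts obj.map_id0 fset.map_id0)
  then have "0 < card (orbit_on U (HSet S))" using finite_orbit_on card_gt_0_iff by blast
  then show ?case using 0 by simp
next
  case (Suc t)
  show ?case
  proof (cases "\<forall>a\<in>U. \<forall>b\<in>U. col a = col b \<longrightarrow> exchangeable (HSet S) a b")
    case True
    then show ?thesis by (intro exI[of _ U]) auto
  next
    case False
    then obtain a b where ab: "a \<in> U" "b \<in> U" "col a = col b"
      "map_obj (transpose a b) (HSet S) \<noteq> HSet S" by (auto simp: exchangeable_def)
    \<comment> \<open>The transposition is its own inverse, so if it mapped every element of
      \<open>S\<close> into \<open>S\<close> it would fix \<open>S\<close>.\<close>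
    have "\<exists>s. s |\<in>| S \<and> map_obj (transpose a b) s |\<notin>| S"
    proof (rule ccontr)
      assume "\<not> ?thesis"
      then have *: "map_obj (transpose a b) s |\<in>| S" if "s |\<in>| S" for s using that by auto
      have "map_obj (transpose a b) |`| S = S"
      proof (intro fset_eqI iffI)
        fix s assume "s |\<in>| S"
        have "s = map_obj (transpose a b) (map_obj (transpose a b) s)"
          by (simp add: obj.map_comp obj.map_id0)
        then show "s |\<in>| map_obj (transpose a b) |`| S" using *[OF \<open>s |\<in>| S\<close>] by blast
      qed (use * in auto)
      then show False using ab(4) by simp
    qed
    then obtain s where s: "s |\<in>| S" "map_obj (transpose a b) s |\<notin>| S" by auto
    obtain F where F: "F \<subseteq> X" "card F \<le> K" "supports F s" using s assms(1) by auto
    let ?U = "U - F - {a, b}"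
    have "card (orbit_on ?U (HSet S)) < 2 ^ t"
      using double_orbit[OF s(1) F(3) ab(1,2) Suc.prems(1) ab(3) s(2)] Suc.prems(2) by simp
    then obtain V where V: "V \<subseteq> ?U" "card (?U - V) \<le> (K + 2) * t"
      "\<forall>a\<in>V. \<forall>b\<in>V. col a = col b \<longrightarrow> exchangeable (HSet S) a b"
      using Suc.IH[of ?U] Suc.prems(1) by auto
    have fin: "finite U" "finite F" using finite_subset Suc.prems(1) F(1) finite_X by auto
    have "U - V \<subseteq> (?U - V) \<union> (F \<union> {a, b})" by auto
    then have "card (U - V) \<le> card ((?U - V) \<union> (F \<union> {a, b}))"
      using fin by (intro card_mono) auto
    also have "\<dots> \<le> card (?U - V) + (card F + card {a, b})"
      using card_Un_le add_left_mono le_trans by metis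
    also have "card {a, b} \<le> 2" by (simp add: card_insert_if)
    finally have "card (U - V) \<le> (K + 2) * Suc t" using V(2) F(2) by simp
    then show ?thesis using V by blast
  qed
qed

lemma exchangeable_sym: "exchangeable x a b \<Longrightarrow> exchangeable x b a"
  by (auto simp: exchangeable_def transpose_commute)

lemma exchangeable_trans:
  assumes "exchangeable x a b" "exchangeable x b d" shows "exchangeable x a d"
\<comment> \<open>The conjugation identity below can fail when two of the three points
  coincide.\<close>
proof (cases "a = b \<or> b = d \<or> a = d")
  case True
  then show ?thesis using assms by (auto simp: exchangeable_def obj.map_id0)
next
  case False
  then have "transpose a d = transpose a b \<circ> transpose b d \<circ> transpose a b"
    by (auto simp: transpose_def fun_eq_iff)
  then show ?thesis using assms by (auto simp: exchangeable_def obj.map_comp[symmetric])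
qed

lemma exchangeable_aut:
  assumes g: "g \<in> auts" "map_obj g x = x"
  shows "exchangeable x (g a) (g b) \<longleftrightarrow> exchangeable x a b"
proof -
  note bg = autsD(2)[OF g(1)]
  have "transpose (g a) (g b) = g \<circ> transpose a b \<circ> inv g"
  proof
    fix y
    obtain z where "y = g z" using bg by (metis bij_pointE)
    then show "transpose (g a) (g b) y = (g \<circ> transpose a b \<circ> inv g) y"
      using aut_eq_iff[OF g(1)] bg by (auto simp: transpose_def bij_is_inj)
  qed
  moreover have "map_obj (inv g) x = x" using map_obj_inverse(1)[OF bg, of x] g(2) by simp
  ultimately have "map_obj (transpose (g a) (g b)) x = map_obj g (map_obj (transpose a b) x)"
    by (simp add: obj.map_comp[symmetric])
  then have "map_obj (transpose (g a) (g b)) x = x \<longleftrightarrow> map_obj (transpose a b) x = x"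
    using g(2) inj_map_obj[OF bg, of "map_obj (transpose a b) x" x] by simp
  then show ?thesis using autsD(3)[OF g(1)] unfolding exchangeable_def by simp
qed

section \<open>Supports of constant size\<close>

lemma orbit_on_subset:
  assumes "symmetric W" "x \<in> W" shows "orbit_on U x \<subseteq> W"
  using assms by (auto simp: symmetric_def orbit_on_def)

lemma aut_image_cls: assumes "g \<in> auts" shows "g ` cls a = cls a"
proof (rule card_subset_eq)
  show "finite (cls a)" using finite_X by (simp add: cls_def)
  show "g ` cls a \<subseteq> cls a" using autsD(3,4)[OF assms] by (auto simp: cls_def)
  show "card (g ` cls a) = card (cls a)"
    using aut_eq_iff[OF assms] by (intro card_image) (auto simp: inj_on_def)
qed

text \<open>An automorphism fixing \<open>x\<close> preserves this set, so the orbit of \<open>x\<close> is at least as large as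
  the orbit of the set.\<close>

definition minority :: "'a obj \<Rightarrow> 'a set" where
  "minority x = {a \<in> X. 2 * card {b \<in> cls a. exchangeable x a b} \<le> card (cls a)}"

lemma minority_aut:
  assumes g: "g \<in> auts" "map_obj g x = x"
  shows "g ` minority x = minority x"
proof (rule card_subset_eq)
  show "finite (minority x)" using finite_X by (simp add: minority_def)
  show "card (g ` minority x) = card (minority x)"
    using aut_eq_iff[OF g(1)] by (intro card_image) (auto simp: inj_on_def)
  show "g ` minority x \<subseteq> minority x"
  proof
    fix y assume "y \<in> g ` minority x"
    then obtain a where a: "a \<in> X" "2 * card {b \<in> cls a. exchangeable x a b} \<le> card (cls a)" "y = g a"
      by (auto simp: minority_def)
    have ca: "cls (g a) = cls a" using autsD(3)[OF g(1)] by (simp add: cls_def)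
    have "{b \<in> cls a. exchangeable x (g a) b} = g ` {b \<in> cls a. exchangeable x a b}"
    proof (intro set_eqI iffI)
      fix b assume b: "b \<in> {b \<in> cls a. exchangeable x (g a) b}"
      then obtain d where "d \<in> cls a" "b = g d" using aut_image_cls[OF g(1), of a] by blast
      then show "b \<in> g ` {b \<in> cls a. exchangeable x a b}" using b exchangeable_aut[OF g] by auto
    next
      fix b assume "b \<in> g ` {b \<in> cls a. exchangeable x a b}"
      then obtain d where "d \<in> cls a" "exchangeable x a d" "b = g d" by blast
      then show "b \<in> {b \<in> cls a. exchangeable x (g a) b}"
        using exchangeable_aut[OF g] aut_image_cls[OF g(1), of a] by auto
    qed
    also have "card \<dots> = card {b \<in> cls a. exchangeable x a b}"
      using aut_eq_iff[OF g(1)] by (intro card_image) (auto simp: inj_on_def)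
    finally show "y \<in> minority x" using a autsD(4)[OF g(1)] by (simp add: minority_def ca)
  qed
qed

text \<open>Two atoms of one colour outside the minority set are each exchangeable with more than
  half of their class. They therefore share a partner \<open>d\<close>, and transitivity makes them
  exchangeable with each other.\<close>

lemma supports_minority: "supports (minority x) x"
proof (rule supports_if_transpositions)
  fix a b assume a: "a \<in> X - minority x" and b: "b \<in> X - minority x" and ab: "col a = col b"
  let ?A = "{d \<in> cls a. exchangeable x a d}" and ?B = "{d \<in> cls a. exchangeable x b d}"
  have ca: "cls b = cls a" using ab by (simp add: cls_def)
  have "card (cls a) < 2 * card ?A" "card (cls a) < 2 * card ?B"
    using a b ca by (auto simp: minority_def)
  moreover have fin: "finite (cls a)" using finite_X by (simp add: cls_def)
  moreover have "card (?A \<union> ?B) \<le> card (cls a)" using fin by (intro card_mono) auto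
  moreover have "card ?A + card ?B = card (?A \<union> ?B) + card (?A \<inter> ?B)"
    using fin by (intro card_Un_Int) auto
  ultimately have "card (?A \<inter> ?B) \<noteq> 0" by linarith
  then have "?A \<inter> ?B \<noteq> {}" using card.empty by metis
  then obtain d where "exchangeable x a d" "exchangeable x b d" by auto
  then have "exchangeable x a b" using exchangeable_sym exchangeable_trans by blast
  then show "map_obj (transpose a b) x = x" by (simp add: exchangeable_def)
qed

text \<open>Every subset \<open>D\<close> of the class with as many atoms as \<open>?B\<close> is
  the image of \<open>?B\<close> under some automorphism. Different \<open>D\<close> yield different
  images of \<open>x\<close>: two automorphisms with the same image of \<open>x\<close> differ by
  one that fixes \<open>x\<close>, which maps the minority set, and so \<open>?B\<close>, to
  itself.\<close>

lemma card_orbit_ge_binomial: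
  assumes W: "finite W" "symmetric W" "x \<in> W"
  shows "card (cls a) choose card (minority x \<inter> cls a) \<le> card W"
proof -
  let ?B = "minority x \<inter> cls a"
  have fin: "finite (cls a)" using finite_X by (simp add: cls_def)
  have "\<exists>\<pi>\<in>auts. \<pi> ` ?B = D" if D: "D \<subseteq> cls a" "card D = card ?B" for D
  proof -
    have "finite D" "finite ?B" using D(1) fin finite_subset by auto
    then obtain g where g: "bij_betw g ?B D"
      using D(2) finite_same_card_bij by metis
    have gd: "g b \<in> X \<and> col (g b) = col b" if "b \<in> ?B" for b
    proof -
      have "g b \<in> D" using g that by (auto simp: bij_betw_def)
      then show ?thesis using D(1) that by (auto simp: cls_def)
    qed
    obtain \<pi> where "\<pi> \<in> auts" "\<forall>b\<in>?B. \<pi> b = g b"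
      using extend_to_aut[of ?B g] g gd \<open>finite ?B\<close> by (auto simp: bij_betw_def cls_def)
    then show ?thesis using g by (intro bexI[of _ \<pi>]) (auto simp: bij_betw_def image_iff)
  qed
  then obtain P where P: "\<And>D. D \<subseteq> cls a \<Longrightarrow> card D = card ?B \<Longrightarrow> P D \<in> auts \<and> P D ` ?B = D"
    by metis
  let ?Ds = "{D. D \<subseteq> cls a \<and> card D = card ?B}"
  have "inj_on (\<lambda>D. map_obj (P D) x) ?Ds"
  proof
    fix D E assume DE: "D \<in> ?Ds" "E \<in> ?Ds" and eq: "map_obj (P D) x = map_obj (P E) x"
    note D = P[of D] and E = P[of E]
    have aD: "P D \<in> auts" "P D ` ?B = D" and aE: "P E \<in> auts" "P E ` ?B = E" using D E DE by auto
    let ?g = "inv (P E) \<circ> P D"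
    have g: "?g \<in> auts" using aD aE by (simp add: comp_auts inv_auts)
    have "map_obj ?g x = x"
      using eq map_obj_inverse(1)[OF autsD(2)[OF aE(1)], of x] by (simp add: obj.map_comp[symmetric])
    then have "?g ` minority x = minority x" by (rule minority_aut[OF g])
    moreover have "?g ` ?B = ?g ` minority x \<inter> ?g ` cls a"
      using bij_is_inj[OF autsD(2)[OF g]] by (rule image_Int)
    ultimately have "?g ` ?B = ?B" using aut_image_cls[OF g] by simp
    then have "P E ` ?B = P E ` ?g ` ?B" by simp
    also have "\<dots> = P D ` ?B"
      using autsD(2)[OF aE(1)] by (simp add: image_image bij_is_surj surj_f_inv_f)
    finally show "D = E" using aD aE by simp
  qed
  moreover have "(\<lambda>D. map_obj (P D) x) ` ?Ds \<subseteq> W"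
    using P W(2,3) by (auto simp: symmetric_def)
  ultimately have "card ?Ds \<le> card W" using W(1) card_inj_on_le by blast
  then show ?thesis using n_subsets[OF fin] by simp
qed

text \<open>The doubling of orbits gives a support of size \<open>(K + 2) * t\<close>, logarithmic in \<open>card W\<close>. Counting
  the images of the minority set improves this to a constant, so that the induction on \<open>x\<close> can
  proceed with the same \<open>K\<close>.\<close>

theorem small_supports:
  assumes W: "finite W" "symmetric W" "transitive W" "W \<subseteq> HF X"
    and t: "card W < 2 ^ t" "\<And>a. a \<in> X \<Longrightarrow> 2 * ((K + 2) * t) < card (cls a)"
    and k: "\<And>a. a \<in> X \<Longrightarrow> card W < card (cls a) choose Suc k"
    and K: "card (col ` X) * k \<le> K" "1 \<le> K"
    and x: "x \<in> W"
  shows "x \<in> hsym K"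
  using x
proof (induction x)
  case (Atom a)
  then have "Atom a \<in> HF X" using W(4) by blast
  then show ?case by (auto elim: HF.cases intro: hsym_Atom)
next
  case (HSet S)
  let ?x = "HSet S" let ?B = "minority ?x"
  have S: "s \<in> hsym K \<and> s \<in> W" if "s |\<in>| S" for s
    using HSet that W(3) unfolding transitive_def by fastforce
  have BX: "?B \<subseteq> X" by (auto simp: minority_def)
  have fin: "finite (cls a)" for a using finite_X by (simp add: cls_def)
  have "card ?B \<le> K"
  proof -
    have "\<forall>s\<in>fset S. \<exists>F\<subseteq>X. card F \<le> K \<and> supports F s"
      using S hsym_support[OF _ K(2)] by metis
    moreover have "card (orbit_on X ?x) < 2 ^ t"
      using orbit_on_subset[OF W(2) HSet.prems] W(1) t(1) by (meson card_mono le_less_trans)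
    ultimately obtain V where V: "V \<subseteq> X" "card (X - V) \<le> (K + 2) * t"
      "\<forall>a\<in>V. \<forall>b\<in>V. col a = col b \<longrightarrow> exchangeable ?x a b"
      using large_exchangeable_set[of S K X t] by blast
    \<comment> \<open>An atom of \<open>V\<close> is exchangeable with all atoms of \<open>V\<close>
      of its colour, and \<open>V\<close> omits at most \<open>(K + 2) * t\<close> atoms, less than
      half of any class.\<close>
    have "?B \<inter> V = {}"
    proof (rule ccontr)
      assume "?B \<inter> V \<noteq> {}"
      then obtain a where a: "a \<in> V" "a \<in> X" "2 * card {b \<in> cls a. exchangeable ?x a b} \<le> card (cls a)"
        by (auto simp: minority_def)
      have "cls a - (X - V) \<subseteq> {b \<in> cls a. exchangeable ?x a b}"
        using V(3) a(1) by (auto simp: cls_def)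
      then have "card (cls a - (X - V)) \<le> card {b \<in> cls a. exchangeable ?x a b}"
        using fin by (intro card_mono) auto
      moreover have "card (cls a) - card (X - V) \<le> card (cls a - (X - V))"
        using finite_X by (intro diff_card_le_card_Diff) auto
      ultimately show False using V(2) t(2)[OF a(2)] a(3) by linarith
    qed
    then have BV: "?B \<subseteq> X - V" using BX by auto
    have small: "card (?B \<inter> cls a) \<le> k" if a: "a \<in> X" for a
    proof (rule ccontr)
      assume "\<not> ?thesis"
      then have "Suc k \<le> card (?B \<inter> cls a)" by simp
      moreover have "card (?B \<inter> cls a) \<le> card (X - V)"
        using BV finite_X by (intro card_mono) auto
      then have "2 * card (?B \<inter> cls a) \<le> card (cls a)" using V(2) t(2)[OF a] by linarith
      \<comment> \<open>Up to half the size of the class, binomial coefficients do not decrease; the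
        logarithmic bound puts \<open>?B\<close> into that range.\<close>
      ultimately have "card (cls a) choose Suc k \<le> card (cls a) choose card (?B \<inter> cls a)"
        by (rule binomial_mono)
      then show False
        using k[OF a] card_orbit_ge_binomial[OF W(1,2) HSet.prems, of a] by linarith
    qed
    let ?C = "\<lambda>i. {b \<in> ?B. col b = i}"
    have "?B = (\<Union>i\<in>col ` X. ?C i)" using BX by auto
    then have "card ?B \<le> (\<Sum>i\<in>col ` X. card (?C i))"
      using card_UN_le[of "col ` X" ?C] finite_X by simp
    also have "\<dots> \<le> (\<Sum>i\<in>col ` X. k)"
    proof (rule sum_mono)
      fix i assume "i \<in> col ` X"
      then obtain a where a: "a \<in> X" "i = col a" by auto
      have "?C i = ?B \<inter> cls a" using BX a by (auto simp: cls_def)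
      then show "card (?C i) \<le> k" using small[OF a(1)] by simp
    qed
    also have "\<dots> \<le> K" using K(1) by simp
    finally show ?thesis .
  qed
  then show ?case using S BX supports_minority \<open>card ?B \<le> K\<close>
    by (intro hsym_HSet[where F = ?B]) auto
qed

end

section \<open>Transport along partial injections\<close>

locale transport = coloured_set X col for X :: "'a set" and col :: "'a \<Rightarrow> nat" +
  fixes col' :: "'a \<Rightarrow> nat" and K L :: nat
  assumes K_pos: "1 \<le> K" and L_large: "2 * K + 2 \<le> L"
    and room: "\<And>a. a \<in> X \<Longrightarrow> 8 * L \<le> card {b \<in> X. col b = col a}"
    and room': "\<And>a. a \<in> X \<Longrightarrow> 8 * L \<le> card {b \<in> X. col' b = col a}"
    and colours: "col' ` X \<subseteq> col ` X"
begin

text \<open>Both structures live on \<open>X\<close>. The first component of a pair is read with the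
  colouring \<open>col\<close>, the second with \<open>col'\<close>.\<close>

definition pinj :: "('a \<times> 'a) set \<Rightarrow> bool" where
  "pinj p \<longleftrightarrow> p \<subseteq> X \<times> X \<and> single_valued p \<and> single_valued (p\<inverse>) \<and> (\<forall>(a, b)\<in>p. col' b = col a)"

lemma pinj_iff: "pinj p \<longleftrightarrow>
    (\<forall>a b. (a, b) \<in> p \<longrightarrow> a \<in> X \<and> b \<in> X \<and> col' b = col a) \<and>
    (\<forall>a b b'. (a, b) \<in> p \<longrightarrow> (a, b') \<in> p \<longrightarrow> b = b') \<and>
    (\<forall>a a' b. (a, b) \<in> p \<longrightarrow> (a', b) \<in> p \<longrightarrow> a = a')"
  by (auto simp: pinj_def single_valued_def; blast)

lemma pinj_subset: "pinj q \<Longrightarrow> p \<subseteq> q \<Longrightarrow> pinj p"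
  unfolding pinj_iff by blast

lemma pinj_finite: "pinj p \<Longrightarrow> finite p"
  unfolding pinj_def using finite_X by (meson finite_SigmaI finite_subset)

lemma pinj_insert:
  assumes "pinj p" "a \<in> X" "b \<in> X" "col' b = col a" "a \<notin> Domain p" "b \<notin> Range p"
  shows "pinj (insert (a, b) p)"
  using assms unfolding pinj_iff by (auto simp: Domain_iff Range_iff)

lemma card_Domain_le: "finite p \<Longrightarrow> card (Domain p) \<le> card p"
  by (simp add: Domain_fst card_image_le)

lemma card_Range_le: "finite p \<Longrightarrow> card (Range p) \<le> card p"
  by (simp add: Range_snd card_image_le)

lemma fresh_elem:
  assumes "finite A" "card A < card B" obtains b where "b \<in> B" "b \<notin> A"
  using assms by (meson card_mono not_le subsetI)

text \<open>For a permutation this is \<open>p\<close> composed with the inverse of \<pi>: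
  automorphisms act on the source side only.\<close>

definition pmap :: "('a \<Rightarrow> 'a) \<Rightarrow> ('a \<times> 'a) set \<Rightarrow> ('a \<times> 'a) set" where
  "pmap \<pi> p = map_prod \<pi> id ` p"

lemma mem_pmap: "(a, b) \<in> pmap \<pi> p \<longleftrightarrow> (\<exists>d. (d, b) \<in> p \<and> a = \<pi> d)"
  by (force simp: pmap_def)

lemma mem_pmap_aut: "\<pi> \<in> auts \<Longrightarrow> (\<pi> a, b) \<in> pmap \<pi> p \<longleftrightarrow> (a, b) \<in> p"
  by (auto simp: mem_pmap aut_eq_iff)

lemma pmap_Un: "pmap \<pi> (p \<union> q) = pmap \<pi> p \<union> pmap \<pi> q"
  by (simp add: pmap_def image_Un)

lemma Domain_pmap: "Domain (pmap \<pi> p) = \<pi> ` Domain p"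
  by (force simp: mem_pmap Domain_iff)

lemma Range_pmap: "Range (pmap \<pi> p) = Range p"
  by (force simp: mem_pmap Range_iff)

lemma pmap_comp: "pmap \<pi> (pmap \<rho> p) = pmap (\<pi> \<circ> \<rho>) p"
  by (simp add: pmap_def image_comp map_prod.comp)

lemma pmap_inv:
  assumes "\<pi> \<in> auts" shows "pmap \<pi> (pmap (inv \<pi>) p) = p" "pmap (inv \<pi>) (pmap \<pi> p) = p"
proof -
  have "\<pi> \<circ> inv \<pi> = id" "inv \<pi> \<circ> \<pi> = id"
    using autsD(2)[OF assms] by (auto simp: bij_is_surj surj_iff[symmetric] bij_is_inj)
  then show "pmap \<pi> (pmap (inv \<pi>) p) = p" "pmap (inv \<pi>) (pmap \<pi> p) = p"
    by (simp_all add: pmap_comp) (simp_all add: pmap_def map_prod.id)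
qed

lemma pinj_pmap: assumes "\<pi> \<in> auts" shows "pinj (pmap \<pi> p) \<longleftrightarrow> pinj p"
proof -
  have *: "pinj (pmap \<rho> p)" if "pinj p" "\<rho> \<in> auts" for \<rho> p
    using that(1) autsD(3,4)[OF that(2)] aut_eq_iff[OF that(2)]
    unfolding pinj_iff mem_pmap by (auto; blast)
  show ?thesis using *[OF _ assms] *[OF _ inv_auts[OF assms]] pmap_inv(2)[OF assms] by metis
qed

lemma card_pmap: "\<pi> \<in> auts \<Longrightarrow> card (pmap \<pi> p) = card p"
  unfolding pmap_def by (intro card_image) (auto simp: inj_on_def aut_eq_iff)

text \<open>Amalgamation: \<open>q\<close> and \<open>p'\<close> both agree with \<open>p\<close>
  but may conflict with each other, and renaming source atoms of \<open>q\<close> outside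
  \<open>Domain p\<close> removes the conflict. Pairs are treated one at a time; the colour classes
  of the source are large enough to supply new names.\<close>

lemma align:
  assumes "pinj (q \<union> p)" "pinj p'" "p \<subseteq> p'" "card p' + card q < 8 * L"
  obtains \<pi> where "\<pi> \<in> auts" "\<forall>a\<in>Domain p. \<pi> a = a" "pinj (pmap \<pi> q \<union> p')"
proof -
  have "finite q" using assms(1) pinj_finite by blast
  then have "\<exists>\<pi>\<in>auts. (\<forall>a\<in>Domain p. \<pi> a = a) \<and> pinj (pmap \<pi> q \<union> p')"
    using assms(1,4)
  proof (induction q)
    case empty
    then show ?case using id_auts assms(2) by (intro bexI[of _ id]) (auto simp: pmap_def)
  next
    case (insert ab q)
    obtain a b where ab: "ab = (a, b)" by (cases ab)
    have qp: "pinj (q \<union> p)" using insert.prems(1) by (rule pinj_subset) auto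
    then obtain \<pi> where \<pi>: "\<pi> \<in> auts" "\<forall>d\<in>Domain p. \<pi> d = d" "pinj (pmap \<pi> q \<union> p')"
      using insert by auto
    have abX: "a \<in> X" "b \<in> X" "col' b = col a"
      using insert.prems(1) unfolding ab pinj_iff by auto
    have uniq: "a' = a" if "(a', b) \<in> q \<union> p" for a'
      using insert.prems(1) that unfolding ab pinj_iff by blast
    have uniq2: "b' = b" if "(a, b') \<in> q \<union> p" for b'
      using insert.prems(1) that unfolding ab pinj_iff by blast
    show ?case
    proof (cases "a \<in> Domain p")
      case True
      then have "(a, b) \<in> p" using uniq2 by blast
      moreover from this have "\<pi> a = a" using \<pi>(2) by blast
      ultimately have "pmap \<pi> (insert ab q) \<union> p' = pmap \<pi> q \<union> p'"
        using assms(3) by (auto simp: ab pmap_def)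
      then show ?thesis using \<pi> by (intro bexI[of _ \<pi>]) auto
    next
      case aD: False
      have "(a, b) \<notin> q" using insert.hyps ab by simp
      then have aq: "a \<notin> Domain q" using uniq2 by blast
      have bR: "b \<notin> Range q" "b \<notin> Range p" using uniq aD aq by blast+
      have \<pi>a: "\<pi> a \<in> X" "col (\<pi> a) = col a" using abX autsD(3,4)[OF \<pi>(1)] by auto
      obtain e where e: "e \<in> X" "col e = col a" "pinj (insert (e, b) (pmap \<pi> q \<union> p'))"
        "\<forall>d\<in>Domain q. e \<noteq> \<pi> d" "e \<notin> Domain p"
      proof (cases "b \<in> Range p'")
        case True
        then obtain e where e: "(e, b) \<in> p'" by blast
        have "e \<in> X \<and> col e = col a" using e assms(2) abX(3) unfolding pinj_iff by metis
        moreover have "insert (e, b) (pmap \<pi> q \<union> p') = pmap \<pi> q \<union> p'" using e by blast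
        moreover have "e \<noteq> \<pi> d" if d: "d \<in> Domain q" for d
        proof
          assume "e = \<pi> d"
          obtain b' where b': "(d, b') \<in> q" using d by blast
          then have "(e, b') \<in> pmap \<pi> q \<union> p'" using \<open>e = \<pi> d\<close> by (auto simp: mem_pmap)
          then have "b' = b" using \<pi>(3) e unfolding pinj_iff by blast
          then show False using b' bR by blast
        qed
        moreover have "e \<notin> Domain p"
        proof
          assume "e \<in> Domain p"
          then obtain b' where b': "(e, b') \<in> p" by blast
          then have "b' = b" using assms(2,3) e unfolding pinj_iff by blast
          then show False using b' bR by blast
        qed
        ultimately show ?thesis using that \<pi>(3) by metis
      next
        case False
        let ?r = "pmap \<pi> q \<union> p'"
        have "card (Domain ?r) \<le> card ?r" using \<pi>(3) pinj_finite card_Domain_le by blast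
        also have "\<dots> \<le> card q + card p'" using card_Un_le[of "pmap \<pi> q" p'] card_pmap[OF \<pi>(1)] by simp
        also have "\<dots> < 8 * L" using insert by simp
        also have "\<dots> \<le> card {d \<in> X. col d = col a}" using room abX by simp
        finally have lt: "card (Domain ?r) < card {d \<in> X. col d = col a}" .
        have "finite (Domain ?r)" using finite_Domain[OF pinj_finite[OF \<pi>(3)]] .
        then obtain e where e: "e \<in> {d \<in> X. col d = col a}" "e \<notin> Domain ?r"
          using lt by (rule fresh_elem)
        have "b \<notin> Range ?r" using False bR by (auto simp: Range_Un_eq Range_pmap)
        then have "pinj (insert (e, b) ?r)" using \<pi>(3) e abX by (intro pinj_insert) auto
        moreover have "e \<notin> \<pi> ` Domain q" "e \<notin> Domain p"
          using e(2) Domain_mono[OF assms(3)] by (auto simp: Domain_pmap Domain_Un_eq)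
        ultimately show ?thesis using that[of e] e(1) by blast
      qed
      \<comment> \<open>The transposition sends \<open>a\<close> to \<open>e\<close> and changes the
        image of no atom of \<open>Domain q\<close> or \<open>Domain p\<close>.\<close>
      let ?\<rho> = "transpose (\<pi> a) e \<circ> \<pi>"
      have \<rho>: "?\<rho> \<in> auts" using \<pi>a e by (intro comp_auts[OF transpose_auts \<pi>(1)]) auto
      have same: "?\<rho> d = \<pi> d" if "d \<in> Domain q \<union> Domain p" for d
      proof -
        have "d \<noteq> a" using that aq aD by auto
        then have "\<pi> d \<noteq> \<pi> a" using aut_eq_iff[OF \<pi>(1)] by simp
        moreover have "\<pi> d \<noteq> e" using that e(4,5) \<pi>(2) by (metis Un_iff)
        ultimately show ?thesis by (simp add: transpose_def)
      qed
      have "pmap ?\<rho> q = pmap \<pi> q" using same unfolding pmap_def by (intro image_cong) force+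
      then have "pmap ?\<rho> (insert ab q) \<union> p' = insert (e, b) (pmap \<pi> q \<union> p')"
        by (simp add: ab pmap_def)
      then have "pinj (pmap ?\<rho> (insert ab q) \<union> p')" using e(3) by simp
      moreover have "\<forall>d\<in>Domain p. ?\<rho> d = d" using same \<pi>(2) by (metis UnI2)
      ultimately show ?thesis using \<rho> by blast
    qed
  qed
  then show ?thesis using that by blast
qed

text \<open>Greedy choice of partners in the target classes. \<open>q\<close> may repeat pairs of
  \<open>p\<close>: its domain is exactly \<open>F\<close>, so that with a support \<open>F\<close>
  of size at most \<open>K\<close> it is one of the injections that \<open>T\<close> ranges
  over.\<close>

lemma extend_pinj:
  assumes "pinj p" "F \<subseteq> X" "card p + card F \<le> 8 * L"
  obtains q where "pinj (q \<union> p)" "Domain q = F" "card q \<le> card F"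
proof -
  have "finite F" using assms(2) finite_X finite_subset by blast
  then have "\<exists>q. pinj (q \<union> p) \<and> Domain q = F \<and> card q \<le> card F"
    using assms(2,3)
  proof (induction F)
    case empty
    then show ?case using assms(1) by (intro exI[of _ "{}"]) auto
  next
    case (insert a F)
    then obtain q where q: "pinj (q \<union> p)" "Domain q = F" "card q \<le> card F" by auto
    have fin: "finite (q \<union> p)" using q pinj_finite by blast
    have aX: "a \<in> X" using insert by auto
    have "\<exists>b. pinj (insert (a, b) (q \<union> p))"
    proof (cases "a \<in> Domain p")
      case True
      then obtain b where "(a, b) \<in> p" by blast
      then have "insert (a, b) (q \<union> p) = q \<union> p" by blast
      then show ?thesis using q by metis
    next
      case False
      have "card (Range (q \<union> p)) \<le> card (q \<union> p)" using fin by (rule card_Range_le)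
      also have "\<dots> \<le> card q + card p" by (rule card_Un_le)
      also have "\<dots> < 8 * L" using insert q by simp
      also have "\<dots> \<le> card {b \<in> X. col' b = col a}" using room' aX by simp
      finally have lt: "card (Range (q \<union> p)) < card {b \<in> X. col' b = col a}" .
      obtain b where "b \<in> {b \<in> X. col' b = col a}" "b \<notin> Range (q \<union> p)"
        using finite_Range[OF fin] lt by (rule fresh_elem)
      moreover have "a \<notin> Domain (q \<union> p)" using False q insert by auto
      ultimately show ?thesis using pinj_insert[OF q(1) aX] by auto
    qed
    then obtain b where "pinj (insert (a, b) (q \<union> p))" by blast
    moreover have "card (insert (a, b) q) \<le> card (insert a F)"
      using insert q fin by (simp add: card_insert_if)
    ultimately show ?case using q by (intro exI[of _ "insert (a, b) q"]) auto
  qed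
  then show ?thesis using that by blast
qed

text \<open>\<open>T x p\<close> is the object corresponding to \<open>x\<close> in the other structure, when the atoms
  supporting \<open>x\<close> correspond along the partial injection \<open>p\<close>. Elements of \<open>x\<close> that need
  further atoms are transported along all small injections compatible with \<open>p\<close>.\<close>

primrec T :: "'a obj \<Rightarrow> ('a \<times> 'a) set \<Rightarrow> 'a obj" where
  "T (Atom a) = (\<lambda>p. Atom (THE b. (a, b) \<in> p))"
| "T (HSet S) = (\<lambda>p. HSet (Abs_fset {t q | s t q. (s, t) |\<in>| (\<lambda>s. (s, T s)) |`| S \<and>
      pinj (q \<union> p) \<and> card q \<le> K \<and> supports (Domain q) s}))"

section \<open>Transport of objects: equivariance, independence of choices, injectivity\<close>

lemma T_Atom: "pinj p \<Longrightarrow> (a, b) \<in> p \<Longrightarrow> T (Atom a) p = Atom b"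
  unfolding pinj_iff by (auto intro!: the_equality)

text \<open>The recursion carries pairs \<open>(s, T s)\<close> to remain primitive; here they are
  eliminated. \<open>Abs_fset\<close> is harmless because the injections are subsets of the finite
  set \<open>X \<times> X\<close>.\<close>

lemma mem_T: "y |\<in>| elts (T x p) \<longleftrightarrow>
  (\<exists>s q. s |\<in>| elts x \<and> pinj (q \<union> p) \<and> card q \<le> K \<and> supports (Domain q) s \<and> y = T s q)"
proof (cases x)
  case (HSet S)
  let ?A = "{t q | s t q. (s, t) |\<in>| (\<lambda>s. (s, T s)) |`| S \<and>
      pinj (q \<union> p) \<and> card q \<le> K \<and> supports (Domain q) s}"
  have "?A \<subseteq> (\<lambda>(s, q). T s q) ` (fset S \<times> Pow (X \<times> X))"
    by (force simp: pinj_def)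
  then have "finite ?A" by (rule finite_subset) (auto simp: finite_X)
  then have "fset (Abs_fset ?A) = ?A" by (simp add: Abs_fset_inverse)
  then show ?thesis by (auto simp: HSet)
qed simp

lemma T_is_HSet: "T (HSet S) p = HSet (elts (T (HSet S) p))"
  by simp

lemma T_HSet_eqI:
  assumes "\<And>y. y |\<in>| elts (T (HSet S) p) \<longleftrightarrow> y |\<in>| elts z" "\<And>a. z \<noteq> Atom a"
  shows "T (HSet S) p = z"
proof -
  have "elts (T (HSet S) p) = elts z" using assms(1) by (intro fset_eqI) auto
  moreover have "z = HSet (elts z)" using assms(2) by (cases z) auto
  ultimately show ?thesis by (metis T_is_HSet)
qed

text \<open>\<open>pmap \<pi>\<close> is a bijection from the injections compatible with
  \<open>p\<close> to those compatible with \<open>pmap \<pi> p\<close>, and it moves supports along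
  with the elements, so both sides collect the same objects.\<close>

lemma T_equivariant:
  assumes "\<pi> \<in> auts" shows "T (map_obj \<pi> x) (pmap \<pi> p) = T x p"
proof (induction x arbitrary: p)
  case (Atom a)
  then show ?case using mem_pmap_aut[OF assms] by simp
next
  case (HSet S)
  have "y |\<in>| elts (T (map_obj \<pi> (HSet S)) (pmap \<pi> p)) \<longleftrightarrow> y |\<in>| elts (T (HSet S) p)" for y
  proof
    assume "y |\<in>| elts (T (map_obj \<pi> (HSet S)) (pmap \<pi> p))"
    then obtain s q where s: "s |\<in>| S" and q: "pinj (q \<union> pmap \<pi> p)" "card q \<le> K"
      "supports (Domain q) (map_obj \<pi> s)" "y = T (map_obj \<pi> s) q"
      unfolding mem_T by auto
    let ?q = "pmap (inv \<pi>) q"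
    have qq: "q = pmap \<pi> ?q" using pmap_inv[OF assms] by simp
    have "pinj (pmap \<pi> (?q \<union> p))" using q(1) qq by (simp add: pmap_Un)
    then have "pinj (?q \<union> p)" using pinj_pmap[OF assms] by blast
    moreover have "card ?q \<le> K" using q(2) inv_auts[OF assms] by (simp add: card_pmap)
    moreover have "supports (Domain ?q) s"
      using supports_image[OF inv_auts[OF assms] q(3)] map_obj_inverse(1)[OF autsD(2)[OF assms]]
      by (simp add: Domain_pmap)
    moreover have "y = T s ?q" using HSet.IH[OF s, of ?q] q(4) qq by simp
    ultimately show "y |\<in>| elts (T (HSet S) p)" using s unfolding mem_T by auto
  next
    assume "y |\<in>| elts (T (HSet S) p)"
    then obtain s q where s: "s |\<in>| S" and q: "pinj (q \<union> p)" "card q \<le> K"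
      "supports (Domain q) s" "y = T s q"
      unfolding mem_T by auto
    have "pinj (pmap \<pi> q \<union> pmap \<pi> p)" using q(1) pinj_pmap[OF assms] by (simp add: pmap_Un[symmetric])
    moreover have "supports (Domain (pmap \<pi> q)) (map_obj \<pi> s)"
      using supports_image[OF assms q(3)] by (simp add: Domain_pmap)
    moreover have "y = T (map_obj \<pi> s) (pmap \<pi> q)" using HSet.IH[OF s, of q] q(4) by simp
    moreover have "map_obj \<pi> s |\<in>| elts (map_obj \<pi> (HSet S))" using s by simp
    ultimately show "y |\<in>| elts (T (map_obj \<pi> (HSet S)) (pmap \<pi> p))"
      using q(2) card_pmap[OF assms] unfolding mem_T by metis
  qed
  then have "T (HSet S) p = T (map_obj \<pi> (HSet S)) (pmap \<pi> p)"
    by (intro T_HSet_eqI) auto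
  then show ?case by simp
qed

text \<open>Otherwise \<open>a\<close> could be swapped with another atom of its colour outside
  \<open>F\<close>, which \<open>room\<close> provides.\<close>

lemma atom_in_support:
  assumes "supports F (Atom a)" "a \<in> X" "finite F" "card F + 1 < 8 * L"
  shows "a \<in> F"
proof (rule ccontr)
  assume "a \<notin> F"
  have "card (insert a F) < card {b \<in> X. col b = col a}"
    using assms room[of a] by (simp add: card_insert_if \<open>a \<notin> F\<close>)
  then obtain b where b: "b \<in> X" "col b = col a" "b \<notin> insert a F"
    using assms(3) fresh_elem[of "insert a F"] by auto
  then have "transpose a b \<in> auts" using assms by (intro transpose_auts) auto
  moreover have "\<forall>d\<in>F. transpose a b d = d"
    using b(3) \<open>a \<notin> F\<close> by (auto simp: transpose_def)
  ultimately have "map_obj (transpose a b) (Atom a) = Atom a"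
    using assms(1) unfolding supports_def by blast
  then show False using b by simp
qed

text \<open>The bound leaves \<open>2 * L\<close> atoms of slack in each colour class, enough for
  one more support and one aligned injection since \<open>2 * K + 2 \<le> L\<close>.\<close>

definition small :: "('a \<times> 'a) set \<Rightarrow> bool" where
  "small p \<longleftrightarrow> pinj p \<and> card p \<le> 6 * L"

lemma smallD: "small p \<Longrightarrow> pinj p" "small p \<Longrightarrow> card p \<le> 6 * L" "small p \<Longrightarrow> finite p"
  by (auto simp: small_def pinj_finite)

text \<open>An injection compatible with \<open>p'\<close> is compatible with \<open>p\<close>.
  Conversely, one compatible with \<open>p\<close> is realigned with \<open>p'\<close> by an
  automorphism fixing \<open>Domain p\<close>; this automorphism fixes \<open>x\<close>, so it
  permutes the elements of \<open>x\<close>, and equivariance shows that the transported element is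
  unchanged.\<close>

lemma T_mono:
  assumes p: "pinj p'" "p \<subseteq> p'" "card p' + K + 1 < 8 * L"
    and x: "x \<in> hsym K" "supports (Domain p) x"
  shows "T x p = T x p'"
proof (cases x)
  case (Atom a)
  have fin: "finite p" "card p \<le> card p'" using p pinj_finite finite_subset card_mono by metis+
  have "a \<in> X" using x(1) Atom by (auto elim: hsym.cases)
  moreover have "card (Domain p) + 1 < 8 * L" using fin(2) card_Domain_le[OF fin(1)] p(3) by linarith
  ultimately have "a \<in> Domain p"
    using atom_in_support[OF _ _ finite_Domain[OF fin(1)]] x(2) Atom by blast
  then obtain b where "(a, b) \<in> p" by blast
  then show ?thesis
    using T_Atom[OF pinj_subset[OF p(1,2)]] T_Atom[OF p(1), of a b] p(2) Atom by auto
next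
  case (HSet S)
  have "y |\<in>| elts (T x p) \<longleftrightarrow> y |\<in>| elts (T x p')" for y
  proof
    assume "y |\<in>| elts (T x p)"
    then obtain s q where s: "s |\<in>| elts x" and q: "pinj (q \<union> p)" "card q \<le> K"
      "supports (Domain q) s" "y = T s q"
      unfolding mem_T by auto
    obtain \<pi> where \<pi>: "\<pi> \<in> auts" "\<forall>a\<in>Domain p. \<pi> a = a" "pinj (pmap \<pi> q \<union> p')"
      using align[OF q(1) p(1,2)] p(3) q(2) by auto
    have "map_obj \<pi> s |\<in>| elts x" using supports_elt[OF x(2) \<pi>(1,2) s] .
    moreover have "supports (Domain (pmap \<pi> q)) (map_obj \<pi> s)"
      using supports_image[OF \<pi>(1) q(3)] by (simp add: Domain_pmap)
    moreover have "y = T (map_obj \<pi> s) (pmap \<pi> q)" using T_equivariant[OF \<pi>(1)] q(4) by simp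
    ultimately show "y |\<in>| elts (T x p')"
      using q(2) card_pmap[OF \<pi>(1)] \<pi>(3) unfolding mem_T by metis
  next
    assume "y |\<in>| elts (T x p')"
    then obtain s q where s: "s |\<in>| elts x" and q: "pinj (q \<union> p')" "card q \<le> K"
      "supports (Domain q) s" "y = T s q"
      unfolding mem_T by auto
    then show "y |\<in>| elts (T x p)"
      using pinj_subset[OF q(1), of "q \<union> p"] p(2) unfolding mem_T by blast
  qed
  then show ?thesis unfolding HSet by (rule T_HSet_eqI) simp
qed

lemma T_compatible:
  assumes "pinj (p \<union> q)" "card (p \<union> q) + K + 1 < 8 * L" "x \<in> hsym K"
    "supports (Domain p) x" "supports (Domain q) x"
  shows "T x p = T x q"
  using T_mono[OF assms(1) _ assms(2,3,4)] T_mono[OF assms(1) _ assms(2,3,5)] by simp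

text \<open>Half of the induction step for injectivity, stated so that it applies in both
  directions; \<open>inj\<close> is the induction hypothesis. If \<open>s\<close> along
  \<open>q\<close> equals \<open>t\<close> along \<open>q'\<close>, an automorphism that fixes the
  support of \<open>y\<close> makes \<open>q\<close> and \<open>q'\<close> compatible. It replaces
  \<open>t\<close> by another element of \<open>y\<close>, which the hypothesis identifies with
  \<open>s\<close>.\<close>

lemma T_reflects_subset:
  assumes inj: "\<And>s t r. s |\<in>| elts x \<Longrightarrow> t |\<in>| elts y \<Longrightarrow> small r \<Longrightarrow> supports (Domain r) s \<Longrightarrow>
      supports (Domain r) t \<Longrightarrow> T s r = T t r \<Longrightarrow> s = t"
    and x: "x \<in> hsym K" and y: "y \<in> hsym K" "supports (Domain p) y"
    and p: "small p"
    and sub: "elts (T x p) |\<subseteq>| elts (T y p)"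
  shows "elts x |\<subseteq>| elts y"
proof
  fix s assume s: "s |\<in>| elts x"
  have sH: "s \<in> hsym K" using hsym_elts[OF x s] .
  then obtain F where F: "F \<subseteq> X" "card F \<le> K" "supports F s" using hsym_support K_pos by blast
  obtain q where q: "pinj (q \<union> p)" "Domain q = F" "card q \<le> card F"
    using extend_pinj[OF smallD(1)[OF p] F(1)] F(2) smallD(2)[OF p] L_large by force
  have qF: "supports (Domain q) s" "card q \<le> K" using q F by auto
  then have "T s q |\<in>| elts (T x p)" using s q(1) unfolding mem_T by blast
  then have "T s q |\<in>| elts (T y p)" using sub by blast
  then obtain t q' where t: "t |\<in>| elts y" and q': "pinj (q' \<union> p)" "card q' \<le> K"
    "supports (Domain q') t" "T s q = T t q'"
    unfolding mem_T by auto
  have qp: "card (q \<union> p) \<le> 6 * L + K" using card_Un_le[of q p] qF(2) smallD(2)[OF p] by linarith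
  then obtain \<pi> where \<pi>: "\<pi> \<in> auts" "\<forall>a\<in>Domain p. \<pi> a = a" "pinj (pmap \<pi> q' \<union> (q \<union> p))"
    using align[OF q'(1) q(1)] q'(2) L_large by auto
  let ?t = "map_obj \<pi> t" and ?q' = "pmap \<pi> q'"
  \<comment> \<open>\<open>p\<close> is left out, so the size stays at most \<open>2 * K\<close> and
    does not accumulate with the depth of the recursion.\<close>
  let ?r = "?q' \<union> q"
  have tH: "?t \<in> hsym K" using hsym_map_obj[OF hsym_elts[OF y(1) t] \<pi>(1)] .
  have st: "supports (Domain ?q') ?t" using supports_image[OF \<pi>(1) q'(3)] by (simp add: Domain_pmap)
  have r: "pinj ?r" using \<pi>(3) by (rule pinj_subset) auto
  have cr: "card ?r \<le> 2 * K" using card_Un_le[of ?q' q] card_pmap[OF \<pi>(1)] q'(2) qF(2) by simp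
  have "T s ?r = T s q" using T_mono[OF r _ _ sH qF(1)] cr L_large by simp
  also have "\<dots> = T ?t ?q'" using q'(4) T_equivariant[OF \<pi>(1)] by simp
  also have "\<dots> = T ?t ?r" using T_mono[OF r _ _ tH st] cr L_large by simp
  finally have eq: "T s ?r = T ?t ?r" .
  have tm: "?t |\<in>| elts y" using supports_elt[OF y(2) \<pi>(1,2) t] .
  have "small ?r" using r cr L_large by (simp add: small_def)
  then have "s = ?t"
    using inj[OF s tm _ _ _ eq] supports_mono[OF qF(1), of "Domain ?r"] supports_mono[OF st, of "Domain ?r"]
    by auto
  then show "s |\<in>| elts y" using tm by simp
qed

text \<open>The injection varies in the induction along with \<open>y\<close>, because elements are
  compared along injections that support them and not along the one given for the sets.\<close>

lemma T_inj:
  assumes "x \<in> hsym K" "y \<in> hsym K" "small p" "supports (Domain p) x" "supports (Domain p) y"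
    and "T x p = T y p"
  shows "x = y"
  using assms
proof (induction x arbitrary: y p rule: obj.induct)
  case (Atom a)
  obtain b where y: "y = Atom b" using Atom.prems(6) by (cases y) auto
  have c: "card (Domain p) + 1 < 8 * L"
    using smallD[OF Atom.prems(3)] card_Domain_le[of p] L_large by linarith
  have fin: "finite (Domain p)" using smallD(3)[OF Atom.prems(3)] by (rule finite_Domain)
  have "a \<in> X" "b \<in> X" using Atom.prems(1,2) y by (auto elim: hsym.cases)
  then have "a \<in> Domain p" "b \<in> Domain p"
    using Atom.prems(4,5) atom_in_support[OF _ _ fin c] y by auto
  then obtain a' b' where *: "(a, a') \<in> p" "(b, b') \<in> p" by blast
  then have "a' = b'"
    using Atom.prems(6) T_Atom[OF smallD(1)[OF Atom.prems(3)]] y by simp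
  then show ?case using * smallD(1)[OF Atom.prems(3)] y unfolding pinj_iff by blast
next
  case (HSet S)
  obtain R where y: "y = HSet R" using HSet.prems(6) by (cases y) auto
  have el: "t \<in> hsym K" if "t |\<in>| R" for t using hsym_elts[OF HSet.prems(2)] y that by simp
  have el': "t \<in> hsym K" if "t |\<in>| S" for t using hsym_elts[OF HSet.prems(1)] that by simp
  have inj: "s = t" if "s |\<in>| S" "t |\<in>| R" "small r" "supports (Domain r) s"
    "supports (Domain r) t" "T s r = T t r" for s t r
    using HSet.IH[OF that(1) el'[OF that(1)] el[OF that(2)] that(3-6)] .
  have sub: "elts (T (HSet S) p) |\<subseteq>| elts (T y p)" "elts (T y p) |\<subseteq>| elts (T (HSet S) p)"
    using HSet.prems(6) by (simp_all del: T.simps)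
  have "elts (HSet S) |\<subseteq>| elts y"
  proof (rule T_reflects_subset[OF _ HSet.prems(1,2,5,3) sub(1)])
    fix s t r assume "s |\<in>| elts (HSet S)" "t |\<in>| elts y" "small r" "supports (Domain r) s"
      "supports (Domain r) t" "T s r = T t r"
    then show "s = t" using inj[of s t r] y by (simp del: T.simps)
  qed
  moreover have "elts y |\<subseteq>| elts (HSet S)"
  proof (rule T_reflects_subset[OF _ HSet.prems(2,1,4,3) sub(2)])
    fix s t r assume "s |\<in>| elts y" "t |\<in>| elts (HSet S)" "small r" "supports (Domain r) s"
      "supports (Domain r) t" "T s r = T t r"
    then show "s = t" using inj[of t s r] y by (simp del: T.simps)
  qed
  ultimately show ?case using y by auto
qed

lemma T_eq_iff:
  assumes "x \<in> hsym K" "y \<in> hsym K" "small p" "supports (Domain p) x" "supports (Domain p) y"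
  shows "T x p = T y p \<longleftrightarrow> x = y"
  using T_inj[OF assms] by blast

text \<open>\<open>T\<close> ranges over injections with at most \<open>K\<close> pairs only. For a
  larger \<open>r\<close>, a support of \<open>s\<close> with at most \<open>K\<close> atoms gives
  such a \<open>q\<close> compatible with \<open>r\<close>, and both transport \<open>s\<close> to
  the same object.\<close>

lemma T_in_T:
  assumes x: "x \<in> hsym K" and s: "s |\<in>| elts x" "supports (Domain r) s"
    and r: "p \<subseteq> r" "small r"
  shows "T s r |\<in>| elts (T x p)"
proof -
  have sH: "s \<in> hsym K" using hsym_elts[OF x s(1)] .
  then obtain F where F: "F \<subseteq> X" "card F \<le> K" "supports F s" using hsym_support K_pos by blast
  obtain q where q: "pinj (q \<union> r)" "Domain q = F" "card q \<le> card F"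
    using extend_pinj[OF smallD(1)[OF r(2)] F(1)] F(2) smallD(2)[OF r(2)] L_large by force
  have "card (q \<union> r) \<le> 6 * L + K" using card_Un_le[of q r] q(3) F(2) smallD(2)[OF r(2)] by linarith
  then have "T s q = T s r" using q F s sH L_large by (intro T_compatible) auto
  moreover have "pinj (q \<union> p)" using q(1) r(1) by (rule_tac pinj_subset) auto
  ultimately show ?thesis using s q F unfolding mem_T by (metis le_trans)
qed

text \<open>The injection produced by \<open>mem_T\<close> need not extend \<open>p\<close>. Its
  union with \<open>p\<close> does, and then continues to support whatever \<open>p\<close>
  supports.\<close>

lemma T_elem:
  assumes x: "x \<in> hsym K" and p: "small p" and y: "y |\<in>| elts (T x p)"
  obtains s r where "s |\<in>| elts x" "p \<subseteq> r" "pinj r" "card r \<le> card p + K"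
    "supports (Domain r) s" "y = T s r"
proof -
  obtain s q where s: "s |\<in>| elts x" and q: "pinj (q \<union> p)" "card q \<le> K"
    "supports (Domain q) s" "y = T s q"
    using y unfolding mem_T by auto
  have c: "card (q \<union> p) \<le> card p + K" using card_Un_le[of q p] q(2) by linarith
  have "T s q = T s (q \<union> p)"
    using c smallD(2)[OF p] L_large q hsym_elts[OF x s] by (intro T_mono) auto
  then show ?thesis
    using that[of s "q \<union> p"] s q c supports_mono[OF q(3), of "Domain (q \<union> p)"] by auto
qed

text \<open>The bound \<open>5 * L\<close> keeps the injection \<open>small\<close> after the
  extension by up to \<open>K\<close> pairs that an element requires.\<close>

lemma T_in_T_iff:
  assumes "x \<in> hsym K" "s \<in> hsym K" "card p \<le> 5 * L" "pinj p"
    and "supports (Domain p) x" "supports (Domain p) s"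
  shows "T s p |\<in>| elts (T x p) \<longleftrightarrow> s |\<in>| elts x"
proof
  have p: "small p" using assms by (simp add: small_def)
  show "T s p |\<in>| elts (T x p)" if "s |\<in>| elts x"
    using T_in_T[OF assms(1) that assms(6) _ p] by simp
  assume "T s p |\<in>| elts (T x p)"
  then obtain t r where t: "t |\<in>| elts x" "p \<subseteq> r" "pinj r" "card r \<le> card p + K"
    "supports (Domain r) t" "T s p = T t r"
    using T_elem[OF assms(1) p] by metis
  have "T s r = T t r" using T_mono[OF t(3,2) _ assms(2,6)] t(4,6) assms(3) L_large by simp
  moreover have "small r" using t(3,4) assms(3) L_large by (simp add: small_def)
  ultimately have "s = t"
    using T_inj[OF assms(2) hsym_elts[OF assms(1) t(1)]] t(5) supports_mono[OF assms(6), of "Domain r"] t(2)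
    by blast
  then show "s |\<in>| elts x" using t by simp
qed

end

section \<open>Evaluation commutes with transport\<close>

lemma map_obj_constants [simp]:
  "map_obj \<pi> empty_obj = empty_obj" "map_obj \<pi> true_obj = true_obj"
  "map_obj \<pi> false_obj = false_obj" "map_obj \<pi> (of_bool_obj b) = of_bool_obj b"
  by (auto simp: empty_obj_def true_obj_def false_obj_def of_bool_obj_def)

lemma map_obj_eq_empty: "map_obj \<pi> x = empty_obj \<longleftrightarrow> x = empty_obj"
  by (cases x) (auto simp: empty_obj_def)

lemma map_obj_eq_true: "map_obj \<pi> x = true_obj \<longleftrightarrow> x = true_obj"
proof (cases x)
  case (HSet S)
  have "map_obj \<pi> |`| S = {|empty_obj|} \<longleftrightarrow> S = {|empty_obj|}"
  proof
    assume S: "map_obj \<pi> |`| S = {|empty_obj|}"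
    then have "s = empty_obj" if "s |\<in>| S" for s using that map_obj_eq_empty by blast
    moreover have "S \<noteq> {||}" using S by auto
    ultimately show "S = {|empty_obj|}" by blast
  qed simp
  then show ?thesis using HSet by (simp add: true_obj_def)
qed (simp add: true_obj_def)

lemmas map_obj_eq_constants =
  map_obj_eq_empty map_obj_eq_true map_obj_eq_empty[folded false_obj_def]

lemma is_boolean_map_obj: "is_boolean (map_obj \<pi> x) \<longleftrightarrow> is_boolean x"
  by (simp add: is_boolean_def map_obj_eq_constants)

lemma interp_TheUnique: "elts x = {|y|} \<Longrightarrow> interp A TheUniqueS [x] = y"
  "\<nexists>y. elts x = {|y|} \<Longrightarrow> interp A TheUniqueS [x] = empty_obj"
  by auto

lemma mem_Union_obj: "y |\<in>| ffUnion (elts |`| elts x) \<longleftrightarrow> (\<exists>s. s |\<in>| elts x \<and> y |\<in>| elts s)"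
  by (auto simp: ffUnion.rep_eq)

section \<open>Evaluation commutes with automorphisms\<close>

context coloured_set
begin

definition sym_state :: "'a state \<Rightarrow> bool" where
  "sym_state A \<longleftrightarrow> fset (universe (input A)) = X \<and>
     (\<forall>\<pi>\<in>auts. (\<forall>P as. map \<pi> as \<in> rels (input A) P \<longleftrightarrow> as \<in> rels (input A) P) \<and>
       (\<forall>f xs. dyn A f (map (map_obj \<pi>) xs) = map_obj \<pi> (dyn A f xs)))"

lemma interp_map_obj:
  assumes A: "sym_state A" and \<pi>: "\<pi> \<in> auts"
  shows "interp A f (map (map_obj \<pi>) xs) = map_obj \<pi> (interp A f xs)"
proof -
  note inj = inj_map_obj[OF autsD(2)[OF \<pi>]]
  have atoms: "(\<lambda>a. Atom (\<pi> a)) |`| universe (input A) = Atom |`| universe (input A)"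
  proof -
    have "\<pi> ` fset (universe (input A)) = fset (universe (input A))"
      using A autsD(1)[OF \<pi>] by (simp add: sym_state_def permutes_image)
    then have "\<pi> |`| universe (input A) = universe (input A)" by (simp add: fset_inject[symmetric])
    then have "Atom |`| (\<pi> |`| universe (input A)) = Atom |`| universe (input A)" by simp
    then show ?thesis by (simp add: fset.map_comp comp_def)
  qed
  have mem: "map_obj \<pi> x |\<in>| elts (map_obj \<pi> y) \<longleftrightarrow> x |\<in>| elts y" for x y
    using mem_elts_map_obj autsD(2)[OF \<pi>] by blast
  have union: "ffUnion (elts |`| elts (map_obj \<pi> x)) = map_obj \<pi> |`| ffUnion (elts |`| elts x)" for x
  proof (intro fset_eqI iffI)
    fix y assume "y |\<in>| ffUnion (elts |`| elts (map_obj \<pi> x))"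
    then obtain s where "s |\<in>| elts x" "y |\<in>| elts (map_obj \<pi> s)"
      unfolding mem_Union_obj by (auto simp: elts_map_obj)
    then show "y |\<in>| map_obj \<pi> |`| ffUnion (elts |`| elts x)"
      using mem_Union_obj[of _ x] by (auto simp: elts_map_obj)
  next
    fix y assume "y |\<in>| map_obj \<pi> |`| ffUnion (elts |`| elts x)"
    then obtain z where z: "z |\<in>| ffUnion (elts |`| elts x)" "y = map_obj \<pi> z" by blast
    then obtain s where "s |\<in>| elts x" "z |\<in>| elts s" unfolding mem_Union_obj by blast
    then show "y |\<in>| ffUnion (elts |`| elts (map_obj \<pi> x))"
      unfolding mem_Union_obj z(2) using mem by (intro exI[of _ "map_obj \<pi> s"]) simp
  qed
  have unique: "interp A TheUniqueS [map_obj \<pi> x] = map_obj \<pi> (interp A TheUniqueS [x])" for x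
  proof (cases "\<exists>y. elts x = {|y|}")
    case True
    then obtain y where y: "elts x = {|y|}" by blast
    then have "elts (map_obj \<pi> x) = {|map_obj \<pi> y|}" by (simp add: elts_map_obj)
    then show ?thesis using y interp_TheUnique(1) by metis
  next
    case False
    have "\<nexists>y. elts (map_obj \<pi> x) = {|y|}"
    proof
      assume "\<exists>y. elts (map_obj \<pi> x) = {|y|}"
      then obtain y where y: "map_obj \<pi> |`| elts x = {|y|}" by (auto simp: elts_map_obj)
      then obtain z where z: "z |\<in>| elts x" "y = map_obj \<pi> z" by blast
      have "w = z" if "w |\<in>| elts x" for w using y z that inj by blast
      then have "elts x = {|z|}" using z by blast
      then show False using False by blast
    qed
    then show ?thesis using False interp_TheUnique(2) map_obj_constants(1) by metis
  qed
  have ins: "(\<exists>as. map (map_obj \<pi>) xs = map Atom as \<and> as \<in> rels (input A) P) \<longleftrightarrow>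
      (\<exists>as. xs = map Atom as \<and> as \<in> rels (input A) P)" for P xs
  proof
    assume "\<exists>as. map (map_obj \<pi>) xs = map Atom as \<and> as \<in> rels (input A) P"
    then obtain as where as: "map (map_obj \<pi>) xs = map Atom as" "as \<in> rels (input A) P" by auto
    have "map (map_obj (inv \<pi>)) (map (map_obj \<pi>) xs) = map (map_obj (inv \<pi>)) (map Atom as)"
      using as(1) by simp
    then have "xs = map Atom (map (inv \<pi>) as)"
      using map_obj_inverse(1)[OF autsD(2)[OF \<pi>]] by (simp add: comp_def)
    moreover have "map (inv \<pi>) as \<in> rels (input A) P"
      using A inv_auts[OF \<pi>] as(2) by (auto simp: sym_state_def)
    ultimately show "\<exists>as. xs = map Atom as \<and> as \<in> rels (input A) P" by blast
  next
    assume "\<exists>as. xs = map Atom as \<and> as \<in> rels (input A) P"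
    then obtain as where as: "xs = map Atom as" "as \<in> rels (input A) P" by auto
    have "map \<pi> as \<in> rels (input A) P" using A \<pi> as(2) by (auto simp: sym_state_def)
    moreover have "map (map_obj \<pi>) xs = map Atom (map \<pi> as)" using as(1) by simp
    ultimately show "\<exists>as. map (map_obj \<pi>) xs = map Atom as \<and> as \<in> rels (input A) P" by blast
  qed
  have dyn: "dyn A g (map (map_obj \<pi>) ys) = map_obj \<pi> (dyn A g ys)" for g ys
    using A \<pi> by (auto simp: sym_state_def)
  show ?thesis
    by (cases "(A, f, xs)" rule: interp.cases)
      (auto simp: inj map_obj_eq_constants is_boolean_map_obj mem union atoms ins dyn
        fset.map_comp comp_def unique[simplified] simp del: ex_simps split del: if_split)
qed

lemma fun_upd_map: "(\<lambda>w. h (e w))(v := h a) = (\<lambda>w. h ((e(v := a)) w))"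
  by auto

lemma val_map_obj:
  assumes A: "sym_state A" and \<pi>: "\<pi> \<in> auts"
  shows "val A t (\<lambda>v. map_obj \<pi> (e v)) = map_obj \<pi> (val A t e)"
proof (induction t arbitrary: e)
  case (App f ts)
  have "map (\<lambda>t. val A t (\<lambda>v. map_obj \<pi> (e v))) ts = map (map_obj \<pi>) (map (\<lambda>t. val A t e) ts)"
    using App by simp
  then show ?case
    using interp_map_obj[OF A \<pi>, of f "map (\<lambda>t. val A t e) ts"] by (simp only: val.simps)
next
  case (Compr t v r g)
  let ?e = "\<lambda>w. map_obj \<pi> (e w)"
  have upd: "?e(v := map_obj \<pi> a) = (\<lambda>w. map_obj \<pi> ((e(v := a)) w))" for a
    by (rule fun_upd_map)
  have "elts (val A (Compr t v r g) ?e) = map_obj \<pi> |`| elts (val A (Compr t v r g) e)"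
  proof (intro fset_eqI iffI)
    fix y assume "y |\<in>| elts (val A (Compr t v r g) ?e)"
    then obtain b where b: "b |\<in>| elts (val A r ?e)" "val A g (?e(v := b)) = true_obj"
      "y = val A t (?e(v := b))" by auto
    then obtain a where a: "a |\<in>| elts (val A r e)" "b = map_obj \<pi> a"
      by (auto simp: Compr.IH(2) elts_map_obj)
    have "val A g (e(v := a)) = true_obj"
      using b(2) unfolding a(2) upd Compr.IH(3) map_obj_eq_constants .
    moreover have "y = map_obj \<pi> (val A t (e(v := a)))"
      using b(3) unfolding a(2) upd Compr.IH(1) .
    ultimately show "y |\<in>| map_obj \<pi> |`| elts (val A (Compr t v r g) e)" using a(1) by auto
  next
    fix y assume "y |\<in>| map_obj \<pi> |`| elts (val A (Compr t v r g) e)"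
    then obtain a where a: "a |\<in>| elts (val A r e)" "val A g (e(v := a)) = true_obj"
      "y = map_obj \<pi> (val A t (e(v := a)))" by auto
    have "map_obj \<pi> a |\<in>| elts (val A r ?e)" using a(1) by (simp add: Compr.IH(2) elts_map_obj)
    moreover have "val A g (?e(v := map_obj \<pi> a)) = true_obj"
      unfolding upd Compr.IH(3) a(2) by simp
    moreover have "y = val A t (?e(v := map_obj \<pi> a))"
      unfolding a(3) upd Compr.IH(1) ..
    ultimately show "y |\<in>| elts (val A (Compr t v r g) ?e)" by auto
  qed
  then show ?case by simp
qed simp

lemma val_supports:
  assumes "sym_state A" "\<And>v. supports F (e v)"
  shows "supports F (val A t e)"
  unfolding supports_def
proof (intro ballI impI)
  fix \<pi> assume \<pi>: "\<pi> \<in> auts" "\<forall>a\<in>F. \<pi> a = a"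
  then have "(\<lambda>v. map_obj \<pi> (e v)) = e" using assms(2) by (auto simp: supports_def)
  then show "map_obj \<pi> (val A t e) = val A t e" using val_map_obj[OF assms(1) \<pi>(1), of t e] by simp
qed

lemma Den_map_obj:
  assumes A: "sym_state A" and \<pi>: "\<pi> \<in> auts"
  shows "(f, xs, b) \<in> Den R A e \<Longrightarrow>
    (f, map (map_obj \<pi>) xs, map_obj \<pi> b) \<in> Den R A (\<lambda>v. map_obj \<pi> (e v))"
proof (induction R arbitrary: e)
  case (Update g ss t)
  then show ?case by (auto simp: val_map_obj[OF A \<pi>])
next
  case (IfElse g R1 R2)
  then show ?case by (auto simp: val_map_obj[OF A \<pi>] map_obj_eq_constants split: if_splits)
next
  case (Forall v r R)
  then obtain a where a: "a |\<in>| elts (val A r e)" "(f, xs, b) \<in> Den R A (e(v := a))" by auto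
  have "map_obj \<pi> a |\<in>| elts (val A r (\<lambda>v. map_obj \<pi> (e v)))"
    using a(1) by (simp add: val_map_obj[OF A \<pi>] elts_map_obj)
  moreover have "(f, map (map_obj \<pi>) xs, map_obj \<pi> b) \<in>
      Den R A ((\<lambda>v. map_obj \<pi> (e v))(v := map_obj \<pi> a))"
    unfolding fun_upd_map using Forall.IH[OF a(2)] .
  ultimately show ?case by auto
qed simp

lemma Den_closed_map_obj:
  assumes A: "sym_state A" and \<pi>: "\<pi> \<in> auts"
    and "(f, xs, b) \<in> Den R A (\<lambda>_. empty_obj)"
  shows "(f, map (map_obj \<pi>) xs, map_obj \<pi> b) \<in> Den R A (\<lambda>_. empty_obj)"
  using Den_map_obj[OF A \<pi> assms(3)] by simp

lemma dyn_sequel: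
  assumes "S = Den R A (\<lambda>_. empty_obj)" "\<not> clash S"
  shows "(f, xs, b) \<in> S \<Longrightarrow> dyn (sequel R A) f xs = b"
    and "\<nexists>b. (f, xs, b) \<in> S \<Longrightarrow> dyn (sequel R A) f xs = dyn A f xs"
proof -
  show "dyn (sequel R A) f xs = b" if b: "(f, xs, b) \<in> S"
  proof -
    have "(THE c. (f, xs, c) \<in> S) = b"
      using b assms(2) unfolding clash_def by (intro the_equality) blast+
    moreover have "dyn (sequel R A) f xs = (THE c. (f, xs, c) \<in> S)"
      using b assms(2) unfolding assms(1) by (auto simp: sequel_def apply_updates_def Let_def)
    ultimately show ?thesis by simp
  qed
  show "\<nexists>b. (f, xs, b) \<in> S \<Longrightarrow> dyn (sequel R A) f xs = dyn A f xs"
    using assms by (auto simp: sequel_def apply_updates_def Let_def)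
qed

lemma input_sequel: "input (sequel R A) = input A"
  by (simp add: sequel_def apply_updates_def Let_def)

lemma sym_state_sequel:
  assumes A: "sym_state A" shows "sym_state (sequel R A)"
proof (cases "clash (Den R A (\<lambda>_. empty_obj))")
  case True
  then show ?thesis using A by (simp add: sequel_def)
next
  case False
  let ?S = "Den R A (\<lambda>_. empty_obj)"
  note d = dyn_sequel[OF refl False]
  have "dyn (sequel R A) f (map (map_obj \<pi>) xs) = map_obj \<pi> (dyn (sequel R A) f xs)"
    if \<pi>: "\<pi> \<in> auts" for \<pi> f xs
  proof (cases "\<exists>b. (f, xs, b) \<in> ?S")
    case True
    then obtain b where b: "(f, xs, b) \<in> ?S" by blast
    then show ?thesis using d(1)[OF b] d(1)[OF Den_closed_map_obj[OF A \<pi> b]] by simp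
  next
    case no: False
    have "(f, map (map_obj \<pi>) xs, b) \<notin> ?S" for b
    proof
      assume "(f, map (map_obj \<pi>) xs, b) \<in> ?S"
      then have "(f, map (map_obj (inv \<pi>)) (map (map_obj \<pi>) xs), map_obj (inv \<pi>) b) \<in> ?S"
        using Den_closed_map_obj[OF A inv_auts[OF \<pi>]] by blast
      then show False
        using no map_obj_inverse(1)[OF autsD(2)[OF \<pi>]] by (auto simp: comp_def)
    qed
    then have "dyn (sequel R A) f (map (map_obj \<pi>) xs) = dyn A f (map (map_obj \<pi>) xs)"
      using d(2) by blast
    then show ?thesis using d(2)[OF no] A \<pi> by (simp add: sym_state_def)
  qed
  then show ?thesis using A by (simp add: sym_state_def input_sequel)
qed

end

text \<open>Active objects are those stored in a state and their hereditary elements. Values of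
  subterms are merely transient, so their membership in \<open>W\<close> is demanded here. It is
  demanded at every element of a range, whatever the guard says there.\<close>

primrec tame :: "'a obj set \<Rightarrow> 'a state \<Rightarrow> tm \<Rightarrow> 'a env \<Rightarrow> bool" where
  "tame W A (Var v) = (\<lambda>e. e v \<in> W)"
| "tame W A (App f ts) = (\<lambda>e. list_all (\<lambda>t. tame W A t e) ts \<and> val A (App f ts) e \<in> W)"
| "tame W A (Compr t v r g) = (\<lambda>e. tame W A r e \<and>
     (\<forall>a\<in>fset (elts (val A r e)). tame W A g (e(v := a)) \<and> tame W A t (e(v := a))) \<and>
     val A (Compr t v r g) e \<in> W)"

primrec tame_rule :: "'a obj set \<Rightarrow> 'a state \<Rightarrow> asm_rule \<Rightarrow> 'a env \<Rightarrow> bool" where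
  "tame_rule W A Skip = (\<lambda>e. True)"
| "tame_rule W A (Update f ss t) = (\<lambda>e. list_all (\<lambda>s. tame W A s e) ss \<and> tame W A t e)"
| "tame_rule W A (IfElse g R1 R2) = (\<lambda>e. tame W A g e \<and> tame_rule W A R1 e \<and> tame_rule W A R2 e)"
| "tame_rule W A (Forall v r R) = (\<lambda>e. tame W A r e \<and>
     (\<forall>a\<in>fset (elts (val A r e)). tame_rule W A R (e(v := a))))"

lemma tame_val: "tame W A t e \<Longrightarrow> val A t e \<in> W"
  by (cases t) auto

lemma tame_mono: "tame W A t e \<Longrightarrow> W \<subseteq> W' \<Longrightarrow> tame W' A t e"
  by (induction t arbitrary: e) (auto simp: list_all_iff)

lemma tame_rule_mono: "tame_rule W A R e \<Longrightarrow> W \<subseteq> W' \<Longrightarrow> tame_rule W' A R e"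
  by (induction R arbitrary: e) (auto simp: list_all_iff tame_mono)

text \<open>Bounds, in units of \<open>K\<close>, the number of atoms by which a partial injection has to be
  extended during the evaluation of a term or rule.\<close>

primrec need_tm :: "tm \<Rightarrow> nat" where
  "need_tm (Var v) = 0"
| "need_tm (App f ts) = sum_list (map need_tm ts)"
| "need_tm (Compr t v r g) = 2 + need_tm t + need_tm r + need_tm g"

primrec need_rule :: "asm_rule \<Rightarrow> nat" where
  "need_rule Skip = 0"
| "need_rule (Update f ss t) = sum_list (map need_tm ss) + need_tm t"
| "need_rule (IfElse g R1 R2) = need_tm g + need_rule R1 + need_rule R2"
| "need_rule (Forall v r R) = 1 + need_tm r + need_rule R"

text \<open>Bounds the number of arguments of an update, hence the number of supports that one
  injection must cover jointly. The sum for a conditional serves as a bound for both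
  branches.\<close>

primrec max_arity :: "asm_rule \<Rightarrow> nat" where
  "max_arity Skip = 0"
| "max_arity (Update f ss t) = length ss"
| "max_arity (IfElse g R1 R2) = max_arity R1 + max_arity R2"
| "max_arity (Forall v r R) = max_arity R"

lemma Den_arity: "(f, xs, b) \<in> Den R A e \<Longrightarrow> length xs \<le> max_arity R"
  by (induction R arbitrary: e) (force split: if_splits)+

lemma tame_rule_Den:
  "tame_rule W A R e \<Longrightarrow> (f, xs, b) \<in> Den R A e \<Longrightarrow> set xs \<subseteq> W \<and> b \<in> W"
proof (induction R arbitrary: e)
  case (Update g ss t)
  then show ?case using tame_val by (auto simp: list_all_iff)
next
  case (IfElse g R1 R2)
  then show ?case by (auto split: if_splits)
next
  case (Forall v r R)
  then show ?case by auto
qed simp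

lemma list_relation_map:
  assumes "\<And>x b. x \<in> set xs \<Longrightarrow> h x = Atom b \<longleftrightarrow> (\<exists>a. x = Atom a \<and> (a, b) \<in> p)"
  shows "map h xs = map Atom bs \<longleftrightarrow> (\<exists>as. xs = map Atom as \<and> list_all2 (\<lambda>a b. (a, b) \<in> p) as bs)"
  using assms
proof (induction xs arbitrary: bs)
  case (Cons x xs)
  show ?case
  proof (cases bs)
    case (Cons b bs')
    have "map h (x # xs) = map Atom bs \<longleftrightarrow>
        (\<exists>a. x = Atom a \<and> (a, b) \<in> p) \<and> (\<exists>as. xs = map Atom as \<and> list_all2 (\<lambda>a b. (a, b) \<in> p) as bs')"
      using Cons.IH[of bs'] Cons.prems \<open>bs = b # bs'\<close> by simp
    also have "\<dots> \<longleftrightarrow> (\<exists>as. x # xs = map Atom as \<and> list_all2 (\<lambda>a b. (a, b) \<in> p) as bs)"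
      unfolding \<open>bs = b # bs'\<close> by (auto simp: Cons_eq_map_conv list_all2_Cons2 intro: list_all2_Cons[THEN iffD2])
    finally show ?thesis .
  qed simp
qed auto

text \<open>In both structures the relations depend only on the colours of a tuple, through the same
  patterns \<open>Q\<close>. Hence matching atoms by colour preserves all relations.\<close>

locale similar_structures = transport X col col' K L
  for X :: "'a set" and col col' :: "'a \<Rightarrow> nat" and K L :: nat +
  fixes I I' :: "'a rel_struct" and Q :: "name \<Rightarrow> nat list set"
  assumes universe: "fset (universe I) = X" "fset (universe I') = X"
    and rels: "\<And>P. rels I P = {as. set as \<subseteq> X \<and> map col as \<in> Q P}"
      "\<And>P. rels I' P = {as. set as \<subseteq> X \<and> map col' as \<in> Q P}"
begin

text \<open>All injections up to size \<open>L\<close> are allowed, instead of one fixed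
  correspondence; this is what survives arbitrarily many steps. That \<open>Domain p\<close>
  supports the value along with the arguments follows from \<open>sym_state\<close>, see
  \<open>dyn_supports\<close>.\<close>

definition sim :: "'a state \<Rightarrow> 'a state \<Rightarrow> bool" where
  "sim A A' \<longleftrightarrow> input A = I \<and> input A' = I' \<and> sym_state A \<and>
     (\<forall>f xs p. set xs \<subseteq> hsym K \<and> pinj p \<and> card p \<le> L \<and> (\<forall>x\<in>set xs. supports (Domain p) x) \<longrightarrow>
       dyn A f xs \<in> hsym K \<and> T (dyn A f xs) p = dyn A' f (map (\<lambda>x. T x p) xs))"

section \<open>Transport of constants and built-in functions\<close>

lemma constants_hsym: "empty_obj \<in> hsym K" "true_obj \<in> hsym K" "false_obj \<in> hsym K"
proof -
  have s: "supports {} empty_obj" "supports {} true_obj" by (auto simp: supports_def)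
  show e: "empty_obj \<in> hsym K"
    using s(1) unfolding empty_obj_def by (intro hsym_HSet[where F = "{}"]) auto
  show "true_obj \<in> hsym K"
    using s(2) e unfolding true_obj_def by (intro hsym_HSet[where F = "{}"]) auto
  show "false_obj \<in> hsym K" using e by (simp add: false_obj_def)
qed

lemma constants_supports: "supports F empty_obj" "supports F true_obj" "supports F false_obj"
  "supports F (of_bool_obj b)"
  by (auto simp: supports_def)

lemma T_empty: "T empty_obj p = empty_obj"
  unfolding empty_obj_def by (rule T_HSet_eqI) (simp_all add: mem_T del: T.simps)

lemma T_false: "T false_obj p = false_obj"
  by (simp add: false_obj_def T_empty)

lemma T_true: assumes "pinj p" shows "T true_obj p = true_obj"
  unfolding true_obj_def
proof (rule T_HSet_eqI)
  fix y
  have "pinj ({} \<union> p)" "card {} \<le> K" "supports (Domain {}) empty_obj"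
    using assms constants_supports by auto
  then show "y |\<in>| elts (T (HSet {|empty_obj|}) p) \<longleftrightarrow> y |\<in>| elts (HSet {|empty_obj|})"
    unfolding mem_T using T_empty by (auto simp del: T.simps intro: exI[of _ "{}"])
qed simp

lemma T_of_bool: "pinj p \<Longrightarrow> T (of_bool_obj b) p = of_bool_obj b"
  by (simp add: of_bool_obj_def T_true T_false)

lemma T_eq_constants:
  assumes "x \<in> hsym K" "small p" "supports (Domain p) x"
  shows "T x p = true_obj \<longleftrightarrow> x = true_obj" "T x p = false_obj \<longleftrightarrow> x = false_obj"
    "is_boolean (T x p) \<longleftrightarrow> is_boolean x"
proof -
  show *: "T x p = true_obj \<longleftrightarrow> x = true_obj" "T x p = false_obj \<longleftrightarrow> x = false_obj"
    using T_eq_iff[OF assms(1) constants_hsym(2) assms(2,3) constants_supports(2)]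
      T_eq_iff[OF assms(1) constants_hsym(3) assms(2,3) constants_supports(3)]
      T_true[OF smallD(1)[OF assms(2)]] T_false by simp_all
  then show "is_boolean (T x p) \<longleftrightarrow> is_boolean x" by (simp add: is_boolean_def)
qed

lemma T_is_Atom:
  assumes "x \<in> hsym K" "small p" "supports (Domain p) x"
  shows "T x p = Atom b \<longleftrightarrow> (\<exists>a. x = Atom a \<and> (a, b) \<in> p)"
proof (cases x)
  case (Atom a)
  have "card (Domain p) + 1 < 8 * L"
    using smallD[OF assms(2)] card_Domain_le[of p] L_large by linarith
  moreover have "finite (Domain p)" using smallD(3)[OF assms(2)] by (rule finite_Domain)
  moreover have "a \<in> X" using assms(1) Atom by (auto elim: hsym.cases)
  ultimately have "a \<in> Domain p" using assms(3) Atom atom_in_support by blast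
  then obtain c where c: "(a, c) \<in> p" by blast
  moreover have "(a, b) \<in> p \<longleftrightarrow> b = c"
    using c smallD(1)[OF assms(2)] unfolding pinj_iff by blast
  ultimately show ?thesis using Atom T_Atom[OF smallD(1)[OF assms(2)] c] by auto
qed simp

lemma extend_support:
  assumes "pinj p" "card p \<le> 5 * L" "x \<in> hsym K"
  obtains q where "p \<subseteq> q" "pinj q" "card q \<le> card p + K" "supports (Domain q) x"
proof -
  obtain F where F: "F \<subseteq> X" "card F \<le> K" "supports F x"
    using hsym_support[OF assms(3) K_pos] by blast
  obtain q where q: "pinj (q \<union> p)" "Domain q = F" "card q \<le> card F"
    using extend_pinj[OF assms(1) F(1)] F(2) assms(2) L_large by force
  have "card (q \<union> p) \<le> card p + K" using card_Un_le[of q p] q(3) F(2) by linarith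
  moreover have "supports (Domain (q \<union> p)) x"
    using F(3) by (rule supports_mono) (auto simp: q(2)[symmetric])
  ultimately show ?thesis using that[of "q \<union> p"] q(1) by auto
qed

text \<open>A member of the union and the element of \<open>x\<close> that contains it may need
  different further atoms, so the injection is extended twice, by up to \<open>K\<close> pairs each
  time.\<close>

lemma T_Union:
  assumes p: "pinj p" "card p \<le> L" and x: "x \<in> hsym K" "supports (Domain p) x"
    and u: "HSet (ffUnion (elts |`| elts x)) \<in> hsym K"
  shows "T (HSet (ffUnion (elts |`| elts x))) p = HSet (ffUnion (elts |`| elts (T x p)))"
proof (rule T_HSet_eqI)
  let ?u = "HSet (ffUnion (elts |`| elts x))"
  have sp: "small p" using p by (simp add: small_def)
  have mu: "y |\<in>| elts ?u \<longleftrightarrow> (\<exists>s. s |\<in>| elts x \<and> y |\<in>| elts s)" for y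
    by (simp add: mem_Union_obj)
  fix y
  show "y |\<in>| elts (T ?u p) \<longleftrightarrow> y |\<in>| elts (HSet (ffUnion (elts |`| elts (T x p))))"
  proof
    assume "y |\<in>| elts (T ?u p)"
    then obtain w r where w: "w |\<in>| elts ?u" "p \<subseteq> r" "pinj r" "card r \<le> card p + K"
      "supports (Domain r) w" "y = T w r"
      using T_elem[OF u sp] by metis
    obtain s where s: "s |\<in>| elts x" "w |\<in>| elts s" using w(1) mu by blast
    have sH: "s \<in> hsym K" using hsym_elts[OF x(1) s(1)] .
    obtain q where q: "r \<subseteq> q" "pinj q" "card q \<le> card r + K" "supports (Domain q) s"
      using extend_support[OF w(3) _ sH] w(4) p(2) L_large by force
    have sq: "small q" using q(2,3) w(4) p(2) L_large by (simp add: small_def)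
    have "y = T w q"
      unfolding w(6) using q w(4) p(2) L_large w(5) hsym_elts[OF sH s(2)] by (intro T_mono) auto
    moreover have "T w q |\<in>| elts (T s q)"
      using T_in_T[OF sH s(2) supports_mono[OF w(5) Domain_mono[OF q(1)]] _ sq] by blast
    moreover have "T s q |\<in>| elts (T x p)"
      using T_in_T[OF x(1) s(1) q(4) _ sq] w(2) q(1) by blast
    ultimately show "y |\<in>| elts (HSet (ffUnion (elts |`| elts (T x p))))"
      unfolding elts.simps mem_Union_obj by blast
  next
    assume "y |\<in>| elts (HSet (ffUnion (elts |`| elts (T x p))))"
    then obtain z where z: "z |\<in>| elts (T x p)" "y |\<in>| elts z"
      unfolding elts.simps mem_Union_obj by blast
    obtain s r where s: "s |\<in>| elts x" "p \<subseteq> r" "pinj r" "card r \<le> card p + K"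
      "supports (Domain r) s" "z = T s r"
      using T_elem[OF x(1) sp z(1)] by metis
    have sH: "s \<in> hsym K" using hsym_elts[OF x(1) s(1)] .
    have sr: "small r" using s(3,4) p(2) L_large by (simp add: small_def)
    obtain w q where w: "w |\<in>| elts s" "r \<subseteq> q" "pinj q" "card q \<le> card r + K"
      "supports (Domain q) w" "y = T w q"
      using T_elem[OF sH sr z(2)[unfolded s(6)]] by metis
    have sq: "small q" using w(3,4) s(4) p(2) L_large by (simp add: small_def)
    have "w |\<in>| elts ?u" using mu s(1) w(1) by blast
    then show "y |\<in>| elts (T ?u p)"
      unfolding w(6) using T_in_T[OF u _ w(5) _ sq] s(2) w(2) by blast
  qed
qed simp

text \<open>\<open>u\<close> is a genuine restriction: two objects with supports of size
  \<open>K\<close> may form a pair that needs up to \<open>2 * K\<close> atoms. Tameness supplies it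
  when terms are evaluated.\<close>

lemma T_pair:
  assumes p: "pinj p" "card p \<le> L" and x: "x \<in> hsym K" "supports (Domain p) x"
    and y: "y \<in> hsym K" "supports (Domain p) y" and u: "HSet {|x, y|} \<in> hsym K"
  shows "T (HSet {|x, y|}) p = HSet {|T x p, T y p|}"
proof (rule T_HSet_eqI)
  have sp: "small p" using p by (simp add: small_def)
  fix w
  show "w |\<in>| elts (T (HSet {|x, y|}) p) \<longleftrightarrow> w |\<in>| elts (HSet {|T x p, T y p|})"
  proof
    assume "w |\<in>| elts (T (HSet {|x, y|}) p)"
    then obtain s r where s: "s |\<in>| elts (HSet {|x, y|})" "p \<subseteq> r" "pinj r" "card r \<le> card p + K"
      "w = T s r"
      using T_elem[OF u sp] by metis
    have "T x p = T x r" "T y p = T y r"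
      using s p(2) L_large x y by (auto intro!: T_mono)
    then show "w |\<in>| elts (HSet {|T x p, T y p|})" using s(1,5) by auto
  next
    assume "w |\<in>| elts (HSet {|T x p, T y p|})"
    then have "w = T x p \<or> w = T y p" by simp
    moreover have "T x p |\<in>| elts (T (HSet {|x, y|}) p)"
      using T_in_T[OF u _ x(2) _ sp] by simp
    moreover have "T y p |\<in>| elts (T (HSet {|x, y|}) p)"
      using T_in_T[OF u _ y(2) _ sp] by simp
    ultimately show "w |\<in>| elts (T (HSet {|x, y|}) p)" by blast
  qed
qed simp

lemma T_atoms:
  assumes p: "pinj p" "card p \<le> L" and u: "HSet (Atom |`| universe I) \<in> hsym K"
  shows "T (HSet (Atom |`| universe I)) p = HSet (Atom |`| universe I')"
proof (rule T_HSet_eqI)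
  let ?u = "HSet (Atom |`| universe I)"
  have sp: "small p" using p by (simp add: small_def)
  have mu: "y |\<in>| elts ?u \<longleftrightarrow> (\<exists>a\<in>X. y = Atom a)" for y using universe(1) by auto
  have mu': "y |\<in>| elts (HSet (Atom |`| universe I')) \<longleftrightarrow> (\<exists>a\<in>X. y = Atom a)" for y
    using universe(2) by auto
  have aH: "Atom a \<in> hsym K" if "a \<in> X" for a using that by (rule hsym_Atom)
  fix w
  show "w |\<in>| elts (T ?u p) \<longleftrightarrow> w |\<in>| elts (HSet (Atom |`| universe I'))"
  proof
    assume "w |\<in>| elts (T ?u p)"
    then obtain s r where s: "s |\<in>| elts ?u" "p \<subseteq> r" "pinj r" "card r \<le> card p + K"
      "supports (Domain r) s" "w = T s r"
      using T_elem[OF u sp] by metis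
    obtain a where a: "a \<in> X" "s = Atom a" using s(1) mu by blast
    have "a \<in> Domain r"
      using atom_in_support[of "Domain r" a] s(5) a card_Domain_le[OF pinj_finite[OF s(3)]]
        finite_Domain[OF pinj_finite[OF s(3)]] s(4) p(2) L_large by auto
    then obtain b where b: "(a, b) \<in> r" by blast
    then have "w = Atom b" "b \<in> X" using s(3,6) a T_Atom[OF s(3) b] unfolding pinj_iff by auto
    then show "w |\<in>| elts (HSet (Atom |`| universe I'))" using mu' by blast
  next
    assume "w |\<in>| elts (HSet (Atom |`| universe I'))"
    then obtain b where b: "b \<in> X" "w = Atom b" using mu' by blast
    have "\<exists>r a. p \<subseteq> r \<and> (a, b) \<in> r \<and> small r"
    proof (cases "b \<in> Range p")
      case True
      then show ?thesis using sp by blast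
    next
      case False
      obtain a0 where a0: "a0 \<in> X" "col a0 = col' b" using colours b(1) by (metis imageE image_subset_iff)
      have "card (Domain p) < card {a \<in> X. col a = col a0}"
        using card_Domain_le[OF pinj_finite[OF p(1)]] p(2) room[OF a0(1)] L_large by linarith
      then obtain a where a: "a \<in> {a \<in> X. col a = col a0}" "a \<notin> Domain p"
        using fresh_elem[OF finite_Domain[OF pinj_finite[OF p(1)]]] by metis
      have "pinj (insert (a, b) p)" using a a0 b False p(1) by (intro pinj_insert) auto
      moreover have "card (insert (a, b) p) \<le> 6 * L"
        using p(2) L_large pinj_finite[OF p(1)] by (simp add: card_insert_if)
      ultimately show ?thesis unfolding small_def by blast
    qed
    then obtain r a where r: "p \<subseteq> r" "(a, b) \<in> r" "small r" by blast
    have "a \<in> X" using r(2) smallD(1)[OF r(3)] unfolding pinj_iff by blast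
    moreover have "supports (Domain r) (Atom a)" using r(2) by (auto simp: supports_def)
    ultimately have "T (Atom a) r |\<in>| elts (T ?u p)"
      using T_in_T[OF u _ _ r(1,3)] mu by blast
    then show "w |\<in>| elts (T ?u p)" using T_Atom[OF smallD(1)[OF r(3)] r(2)] b(2) by simp
  qed
qed simp

text \<open>An automorphism that fixes a singleton fixes its element, so the element needs no new
  atoms. If there are two elements, an injection supporting both exists after two extensions, and
  along it their transports differ by injectivity.\<close>

lemma T_TheUnique:
  assumes p: "pinj p" "card p \<le> L" and x: "x \<in> hsym K" "supports (Domain p) x"
  shows "T (interp A TheUniqueS [x]) p = interp A' TheUniqueS [T x p]"
proof -
  have sp: "small p" using p by (simp add: small_def)
  show ?thesis
  proof (cases "\<exists>s. elts x = {|s|}")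
    case True
    then obtain s where s: "elts x = {|s|}" by blast
    have sH: "s \<in> hsym K" using hsym_elts[OF x(1)] s by simp
    have ss: "supports (Domain p) s"
      using supports_elt[OF x(2)] s unfolding supports_def by auto
    have "elts (T x p) = {|T s p|}"
    proof (intro fset_eqI iffI)
      fix w assume "w |\<in>| elts (T x p)"
      then obtain t r where t: "t |\<in>| elts x" "p \<subseteq> r" "pinj r" "card r \<le> card p + K" "w = T t r"
        using T_elem[OF x(1) sp] by metis
      have "T s p = T s r" using t p(2) L_large sH ss by (intro T_mono) auto
      then show "w |\<in>| {|T s p|}" using t s by auto
    next
      fix w assume "w |\<in>| {|T s p|}"
      then show "w |\<in>| elts (T x p)" using T_in_T[OF x(1) _ ss _ sp] s by auto
    qed
    then show ?thesis using s interp_TheUnique(1) by metis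
  next
    case False
    have "\<nexists>w. elts (T x p) = {|w|}"
    proof
      assume "\<exists>w. elts (T x p) = {|w|}"
      then obtain w where w: "elts (T x p) = {|w|}" by blast
      obtain s0 where s0: "s0 |\<in>| elts x" using w T_elem[OF x(1) sp, of w] by auto
      then obtain t where t: "t |\<in>| elts x" "t \<noteq> s0" using False by blast
      obtain q where q: "p \<subseteq> q" "pinj q" "card q \<le> card p + K" "supports (Domain q) s0"
        using extend_support[OF p(1) _ hsym_elts[OF x(1) s0]] p(2) by force
      obtain r where r: "q \<subseteq> r" "pinj r" "card r \<le> card q + K" "supports (Domain r) t"
        using extend_support[OF q(2) _ hsym_elts[OF x(1) t(1)]] p(2) q(3) L_large by force
      have sr: "small r" using r q p(2) L_large by (simp add: small_def)
      have s0r: "supports (Domain r) s0" using supports_mono[OF q(4) Domain_mono[OF r(1)]] .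
      have "T s0 r = w" "T t r = w"
        using T_in_T[OF x(1) s0 s0r _ sr, of p] T_in_T[OF x(1) t(1) r(4) _ sr, of p] q(1) r(1) w by auto
      then show False
        using T_inj[OF hsym_elts[OF x(1) t(1)] hsym_elts[OF x(1) s0] sr r(4) s0r] t(2) by simp
    qed
    then show ?thesis using False interp_TheUnique(2) T_empty by metis
  qed
qed

lemma T_input:
  assumes p: "pinj p" "card p \<le> L" and xs: "set xs \<subseteq> hsym K" "\<forall>x\<in>set xs. supports (Domain p) x"
  shows "(\<exists>bs. map (\<lambda>x. T x p) xs = map Atom bs \<and> bs \<in> rels I' P) \<longleftrightarrow>
    (\<exists>as. xs = map Atom as \<and> as \<in> rels I P)"
proof -
  have sp: "small p" using p by (simp add: small_def)
  have rel: "as \<in> rels I P \<longleftrightarrow> bs \<in> rels I' P" if "list_all2 (\<lambda>a b. (a, b) \<in> p) as bs" for as bs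
  proof -
    have "map col as = map col' bs \<and> set as \<subseteq> X \<and> set bs \<subseteq> X"
      using that by induction (use p(1) in \<open>auto simp: pinj_iff\<close>)
    then show ?thesis by (simp add: rels)
  qed
  have *: "map (\<lambda>x. T x p) xs = map Atom bs \<longleftrightarrow>
      (\<exists>as. xs = map Atom as \<and> list_all2 (\<lambda>a b. (a, b) \<in> p) as bs)" for bs
    using xs T_is_Atom[OF _ sp] by (intro list_relation_map) blast
  have ex: "\<exists>bs. list_all2 (\<lambda>a b. (a, b) \<in> p) as bs" if as: "xs = map Atom as" "as \<in> rels I P" for as
  proof -
    have "a \<in> Domain p" if "a \<in> set as" for a
    proof (rule atom_in_support)
      show "supports (Domain p) (Atom a)" using that as xs(2) by auto
      show "a \<in> X" using that as(2) by (auto simp: rels)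
      show "finite (Domain p)" using finite_Domain[OF pinj_finite[OF p(1)]] .
      show "card (Domain p) + 1 < 8 * L"
        using card_Domain_le[OF pinj_finite[OF p(1)]] p(2) L_large by linarith
    qed
    then have "\<forall>a\<in>set as. (a, SOME b. (a, b) \<in> p) \<in> p" by (metis DomainE someI_ex)
    then have "list_all2 (\<lambda>a b. (a, b) \<in> p) as (map (\<lambda>a. SOME b. (a, b) \<in> p) as)"
      by (auto simp: list_all2_conv_all_nth)
    then show ?thesis by blast
  qed
  show ?thesis unfolding * using rel ex by blast
qed

lemma interp_sim:
  assumes A: "sim A A'" and p: "pinj p" "card p \<le> L"
    and xs: "set xs \<subseteq> hsym K" "\<forall>x\<in>set xs. supports (Domain p) x"
    and v: "interp A f xs \<in> hsym K"
  shows "interp A' f (map (\<lambda>x. T x p) xs) = T (interp A f xs) p"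
proof -
  have sp: "small p" using p by (simp add: small_def)
  have eq: "T x p = T y p \<longleftrightarrow> x = y" if "x \<in> set xs" "y \<in> set xs" for x y
    using that xs sp by (intro T_eq_iff) auto
  have const: "T x p = true_obj \<longleftrightarrow> x = true_obj" "T x p = false_obj \<longleftrightarrow> x = false_obj"
    "is_boolean (T x p) \<longleftrightarrow> is_boolean x" if "x \<in> set xs" for x
    using T_eq_constants[OF _ sp, of x] that xs by auto
  have mem: "T x p |\<in>| elts (T y p) \<longleftrightarrow> x |\<in>| elts y" if "x \<in> set xs" "y \<in> set xs" for x y
    using that xs p by (intro T_in_T_iff) auto
  have I: "input A = I" "input A' = I'" using A by (auto simp: sim_def)
  have dyn: "dyn A' g (map (\<lambda>x. T x p) xs) = T (dyn A g xs) p" for g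
    using A p xs by (simp add: sim_def)
  have b: "T (of_bool_obj c) p = of_bool_obj c" "T true_obj p = true_obj" for c
    using T_of_bool[OF p(1)] T_true[OF p(1)] by auto
  note simps = b T_empty T_false
  show ?thesis
    using v eq const mem T_input[OF p xs] dyn xs
    by (cases "(A, f, xs)" rule: interp.cases)
      (auto simp: simps I T_atoms[OF p] T_Union[OF p] T_pair[OF p]
        T_TheUnique[OF p, of _ A A', simplified] simp del: T.simps split del: if_split)
qed

end

context coloured_set
begin

lemma dyn_supports:
  assumes "sym_state A" "\<forall>x\<in>set xs. supports F x"
  shows "supports F (dyn A f xs)"
  unfolding supports_def
proof (intro ballI impI)
  fix \<pi> assume \<pi>: "\<pi> \<in> auts" "\<forall>a\<in>F. \<pi> a = a"
  then have "map (map_obj \<pi>) xs = xs" using assms(2) by (auto simp: supports_def intro: map_idI)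
  moreover have "dyn A f (map (map_obj \<pi>) xs) = map_obj \<pi> (dyn A f xs)"
    using assms(1) \<pi>(1) by (simp add: sym_state_def)
  ultimately show "map_obj \<pi> (dyn A f xs) = dyn A f xs" by simp
qed

lemma hsym_list_support:
  assumes "set ys \<subseteq> hsym K" "1 \<le> K"
  shows "\<exists>F\<subseteq>X. card F \<le> K * length ys \<and> (\<forall>y\<in>set ys. supports F y)"
  using assms(1)
proof (induction ys)
  case Nil
  then show ?case by (intro exI[of _ "{}"]) auto
next
  case (Cons y ys)
  then obtain F where F: "F \<subseteq> X" "card F \<le> K * length ys" "\<forall>y\<in>set ys. supports F y" by auto
  have "y \<in> hsym K" using Cons.prems by simp
  then obtain G where G: "G \<subseteq> X" "card G \<le> K" "supports G y"
    using hsym_support assms(2) by blast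
  have "card (G \<union> F) \<le> K * length (y # ys)" using card_Un_le[of G F] F(2) G(2) by simp
  then show ?case
    using F G supports_mono[of _ _ "G \<union> F"] by (intro exI[of _ "G \<union> F"]) auto
qed

end

section \<open>Transport of terms, rules and steps\<close>

context similar_structures
begin

text \<open>In a comprehension an element of the result does not determine the \<open>a\<close> that
  produced it. Following it back costs one extension to support the element and one to support
  \<open>a\<close>, which is the summand 2 in \<open>need_tm\<close>.\<close>

lemma val_sim:
  assumes A: "sim A A'"
  shows "tame (hsym K) A t e \<Longrightarrow> (\<And>v. e v \<in> hsym K) \<Longrightarrow> (\<And>v. supports (Domain p) (e v)) \<Longrightarrow>
    pinj p \<Longrightarrow> card p + K * need_tm t \<le> L \<Longrightarrow>
    val A' t (\<lambda>v. T (e v) p) = T (val A t e) p"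
proof (induction t arbitrary: e p)
  case (App f ts)
  have sA: "sym_state A" using A by (simp add: sim_def)
  have need: "need_tm t \<le> need_tm (App f ts)" if "t \<in> set ts" for t
    using that by (simp add: member_le_sum_list)
  have "val A' t (\<lambda>v. T (e v) p) = T (val A t e) p" if t: "t \<in> set ts" for t
  proof (rule App.IH[OF t _ App.prems(2,3,4)])
    show "tame (hsym K) A t e" using App.prems(1) t by (auto simp: list_all_iff)
    have "K * need_tm t \<le> K * need_tm (App f ts)" using need[OF t] by (rule mult_le_mono2)
    then show "card p + K * need_tm t \<le> L" using App.prems(5) by linarith
  qed
  then have m: "map (\<lambda>t. val A' t (\<lambda>v. T (e v) p)) ts = map (\<lambda>x. T x p) (map (\<lambda>t. val A t e) ts)"
    by simp
  have "interp A' f (map (\<lambda>x. T x p) (map (\<lambda>t. val A t e) ts)) =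
      T (interp A f (map (\<lambda>t. val A t e) ts)) p"
  proof (rule interp_sim[OF A App.prems(4)])
    show "card p \<le> L" using App.prems(5) by linarith
    show "set (map (\<lambda>t. val A t e) ts) \<subseteq> hsym K"
      using App.prems(1) by (auto simp: list_all_iff intro: tame_val)
    show "\<forall>x\<in>set (map (\<lambda>t. val A t e) ts). supports (Domain p) x"
      using val_supports[OF sA App.prems(3)] by auto
    show "interp A f (map (\<lambda>t. val A t e) ts) \<in> hsym K" using App.prems(1) by simp
  qed
  then show ?case by (simp only: val.simps m)
next
  case (Compr t v r g)
  have sA: "sym_state A" using A by (simp add: sim_def)
  let ?e = "\<lambda>v. T (e v) p"
  let ?z = "val A (Compr t v r g) e" and ?z' = "val A' (Compr t v r g) ?e"
  have need: "card p + (2 * K + K * need_tm t + K * need_tm r + K * need_tm g) \<le> L"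
    using Compr.prems(5) by (simp add: algebra_simps)
  have sp: "small p" using Compr.prems(4) need by (simp add: small_def)
  have z: "?z \<in> hsym K" "val A r e \<in> hsym K" "tame (hsym K) A r e"
    using Compr.prems(1) tame_val by auto
  have ta: "tame (hsym K) A t (e(v := a))" "tame (hsym K) A g (e(v := a))"
    if "a |\<in>| elts (val A r e)" for a
    using Compr.prems(1) that by auto
  have r: "val A' r ?e = T (val A r e) p"
    using Compr.prems need by (intro Compr.IH(2)) auto
  \<comment> \<open>Passing from \<open>p\<close> to a larger \<open>q\<close> changes no value of
    the old assignment, since \<open>p\<close> supports them all; only the bound variable uses the
    new pairs.\<close>
  have upd: "?e(v := T a q) = (\<lambda>w. T ((e(v := a)) w) q)" if q: "p \<subseteq> q" "pinj q" "card q \<le> 5 * L" for a q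
  proof -
    have "T (e w) p = T (e w) q" for w
      using q Compr.prems L_large by (intro T_mono) auto
    then show ?thesis by auto
  qed
  have sub: "val A' t (?e(v := T a q)) = T (val A t (e(v := a))) q"
      "val A' g (?e(v := T a q)) = T (val A g (e(v := a))) q"
    if a: "a |\<in>| elts (val A r e)" and q: "p \<subseteq> q" "pinj q" "card q \<le> card p + 2 * K"
      "supports (Domain q) a" for a q
  proof -
    have e: "(e(v := a)) w \<in> hsym K" "supports (Domain q) ((e(v := a)) w)" for w
      using Compr.prems(2) hsym_elts[OF z(2) a] q(4)
        supports_mono[OF Compr.prems(3) Domain_mono[OF q(1)]] by auto
    have c: "card q \<le> 5 * L" using q(3) need by linarith
    show "val A' t (?e(v := T a q)) = T (val A t (e(v := a))) q"
      unfolding upd[OF q(1,2) c] using q(3) need by (intro Compr.IH(1)[OF ta(1)[OF a] e q(2)]) auto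
    show "val A' g (?e(v := T a q)) = T (val A g (e(v := a))) q"
      unfolding upd[OF q(1,2) c] using q(3) need by (intro Compr.IH(3)[OF ta(2)[OF a] e q(2)]) auto
  qed
  have mz: "y |\<in>| elts ?z \<longleftrightarrow> (\<exists>a. a |\<in>| elts (val A r e) \<and> val A g (e(v := a)) = true_obj \<and>
      y = val A t (e(v := a)))" for y
    by auto
  have mz': "y |\<in>| elts ?z' \<longleftrightarrow> (\<exists>b. b |\<in>| elts (T (val A r e) p) \<and>
      val A' g (?e(v := b)) = true_obj \<and> y = val A' t (?e(v := b)))" for y
    unfolding r[symmetric] by auto
  have zz: "?z = HSet (elts ?z)" by simp
  have "T (HSet (elts ?z)) p = ?z'"
  proof (rule T_HSet_eqI)
    fix y
    show "y |\<in>| elts (T (HSet (elts ?z)) p) \<longleftrightarrow> y |\<in>| elts ?z'"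
      unfolding zz[symmetric]
    proof
      assume "y |\<in>| elts (T ?z p)"
      then obtain s q where s: "s |\<in>| elts ?z" "p \<subseteq> q" "pinj q" "card q \<le> card p + K"
        "supports (Domain q) s" "y = T s q"
        using T_elem[OF z(1) sp] by metis
      obtain a where a: "a |\<in>| elts (val A r e)" "val A g (e(v := a)) = true_obj"
        "s = val A t (e(v := a))" using s(1) mz by blast
      have aH: "a \<in> hsym K" using hsym_elts[OF z(2) a(1)] .
      \<comment> \<open>\<open>q\<close> supports the value \<open>s\<close>; \<open>u\<close>
        supports also the index \<open>a\<close> at which it arises.\<close>
      obtain u where u: "q \<subseteq> u" "pinj u" "card u \<le> card q + K" "supports (Domain u) a"
        using extend_support[OF s(3) _ aH] s(4) need by force
      have u': "p \<subseteq> u" "card u \<le> card p + 2 * K" using u s by auto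
      have su: "small u" using u(2) u'(2) need by (simp add: small_def)
      have "y = T s u"
        unfolding s(6) using u s(5) hsym_elts[OF z(1) s(1)] u' need L_large by (intro T_mono) auto
      then have "y = val A' t (?e(v := T a u))" using sub(1)[OF a(1) u'(1) u(2) u'(2) u(4)] a(3) by simp
      moreover have "val A' g (?e(v := T a u)) = true_obj"
        using sub(2)[OF a(1) u'(1) u(2) u'(2) u(4)] a(2) T_true[OF u(2)] by simp
      moreover have "T a u |\<in>| elts (T (val A r e) p)"
        using T_in_T[OF z(2) a(1) u(4) u'(1) su] .
      ultimately show "y |\<in>| elts ?z'" using mz' by blast
    next
      assume "y |\<in>| elts ?z'"
      then obtain b where b: "b |\<in>| elts (T (val A r e) p)" "val A' g (?e(v := b)) = true_obj"
        "y = val A' t (?e(v := b))" using mz' by blast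
      obtain a q where a: "a |\<in>| elts (val A r e)" "p \<subseteq> q" "pinj q" "card q \<le> card p + K"
        "supports (Domain q) a" "b = T a q"
        using T_elem[OF z(2) sp b(1)] by metis
      have c: "card q \<le> card p + 2 * K" using a(4) by simp
      have sq: "small q" using a(3) c need by (simp add: small_def)
      have se: "supports (Domain q) ((e(v := a)) w)" for w
        using a(5) supports_mono[OF Compr.prems(3) Domain_mono[OF a(2)]] by auto
      have sv: "supports (Domain q) (val A s (e(v := a)))" for s
        by (rule val_supports[OF sA se])
      have "T (val A g (e(v := a))) q = true_obj"
        using b(2) sub(2)[OF a(1,2,3) c a(5)] a(6) by simp
      then have "val A g (e(v := a)) = true_obj"
        unfolding T_eq_constants(1)[OF tame_val[OF ta(2)[OF a(1)]] sq sv] .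
      then have "val A t (e(v := a)) |\<in>| elts ?z" using mz a(1) by blast
      then have "T (val A t (e(v := a))) q |\<in>| elts (T ?z p)"
        using T_in_T[OF z(1) _ sv a(2) sq] by blast
      moreover have "y = T (val A t (e(v := a))) q"
        using b(3) sub(1)[OF a(1,2,3) c a(5)] a(6) by simp
      ultimately show "y |\<in>| elts (T ?z p)" by simp
    qed
  qed simp
  then show ?case using zz by (metis (no_types, lifting))
qed simp

text \<open>\<open>p\<close> has to support the update itself. In a do-forall rule the index may
  require a larger \<open>q\<close>, but the update is transported in the same way along
  \<open>p\<close> and \<open>q\<close> because \<open>p\<close> already supports it.\<close>

lemma Den_sim_into:
  assumes A: "sim A A'"
  shows "tame_rule (hsym K) A R e \<Longrightarrow> (\<And>v. e v \<in> hsym K) \<Longrightarrow>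
    (\<And>v. supports (Domain p) (e v)) \<Longrightarrow> pinj p \<Longrightarrow> card p + K * need_rule R \<le> L \<Longrightarrow>
    (f, xs, b) \<in> Den R A e \<Longrightarrow> \<forall>x\<in>set (b # xs). supports (Domain p) x \<Longrightarrow>
    (f, map (\<lambda>x. T x p) xs, T b p) \<in> Den R A' (\<lambda>v. T (e v) p)"
proof (induction R arbitrary: e p)
  case (Update g ss t)
  have need: "K * need_tm s \<le> K * need_rule (Update g ss t)" if "s \<in> set ss \<or> s = t" for s
    using that member_le_sum_list[of "need_tm s" "map need_tm ss"] by (intro mult_le_mono2) auto
  have *: "val A' s (\<lambda>v. T (e v) p) = T (val A s e) p" if "s \<in> set ss \<or> s = t" for s
    using that Update.prems(1) le_trans[OF add_left_mono[OF need[OF that]] Update.prems(5)]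
    by (intro val_sim[OF A _ Update.prems(2,3,4)]) (auto simp: list_all_iff)
  have "f = g" "xs = map (\<lambda>s. val A s e) ss" "b = val A t e" using Update.prems(6) by auto
  then show ?case using * by (auto simp del: T.simps)
next
  case (IfElse g R1 R2)
  have sp: "small p" using IfElse.prems(4,5) by (simp add: small_def)
  have need: "card p + (K * need_tm g + K * need_rule R1 + K * need_rule R2) \<le> L"
    using IfElse.prems(5) by (simp add: algebra_simps)
  have "val A' g (\<lambda>v. T (e v) p) = T (val A g e) p"
    using IfElse.prems need by (intro val_sim[OF A]) auto
  moreover have "T (val A g e) p = true_obj \<longleftrightarrow> val A g e = true_obj"
    using A IfElse.prems(1) sp tame_val val_supports[OF _ IfElse.prems(3)]
    by (intro T_eq_constants) (auto simp: sim_def)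
  ultimately show ?case
    using IfElse.IH(1)[OF _ IfElse.prems(2,3,4)] IfElse.IH(2)[OF _ IfElse.prems(2,3,4)]
      IfElse.prems(1,6,7) need by (auto simp del: T.simps split: if_splits)
next
  case (Forall v r R)
  have need: "card p + (K + K * need_tm r + K * need_rule R) \<le> L"
    using Forall.prems(5) by (simp add: algebra_simps)
  obtain a where a: "a |\<in>| elts (val A r e)" "(f, xs, b) \<in> Den R A (e(v := a))"
    using Forall.prems(6) by auto
  have rH: "val A r e \<in> hsym K" using Forall.prems(1) tame_val by auto
  have aH: "a \<in> hsym K" using hsym_elts[OF rH a(1)] .
  obtain q where q: "p \<subseteq> q" "pinj q" "card q \<le> card p + K" "supports (Domain q) a"
    using extend_support[OF Forall.prems(4) _ aH] need by force
  have sq: "small q" using q(2,3) need by (simp add: small_def)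
  have Tq: "T x p = T x q" if "x \<in> hsym K" "supports (Domain p) x" for x
    using that q need L_large by (intro T_mono) auto
  have "val A' r (\<lambda>v. T (e v) p) = T (val A r e) p"
    using Forall.prems need by (intro val_sim[OF A]) auto
  then have "T a q |\<in>| elts (val A' r (\<lambda>v. T (e v) p))"
    using T_in_T[OF rH a(1) q(4,1) sq] by simp
  moreover have "(f, map (\<lambda>x. T x q) xs, T b q) \<in> Den R A' (\<lambda>w. T ((e(v := a)) w) q)"
  proof (rule Forall.IH[OF _ _ _ q(2) _ a(2)])
    show "tame_rule (hsym K) A R (e(v := a))" using Forall.prems(1) a(1) by auto
    show "(e(v := a)) w \<in> hsym K" for w using Forall.prems(2) aH by simp
    show "supports (Domain q) ((e(v := a)) w)" for w
      using q(4) supports_mono[OF Forall.prems(3) Domain_mono[OF q(1)]] by simp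
    show "card q + K * need_rule R \<le> L" using q(3) need by linarith
    show "\<forall>x\<in>set (b # xs). supports (Domain q) x"
      using Forall.prems(7) supports_mono[OF _ Domain_mono[OF q(1)]] by auto
  qed
  moreover have "(\<lambda>w. T ((e(v := a)) w) q) = (\<lambda>w. T (e w) p)(v := T a q)"
    using Tq[OF Forall.prems(2,3)] by auto
  moreover have "set xs \<subseteq> hsym K \<and> b \<in> hsym K"
    using tame_rule_Den[OF Forall.prems(1,6)] .
  then have "map (\<lambda>x. T x q) xs = map (\<lambda>x. T x p) xs" "T b q = T b p"
    using Tq Forall.prems(7) by (auto simp del: T.simps)
  ultimately show ?case by (auto simp del: T.simps)
qed simp

text \<open>The injection is not prescribed: an update of the second machine is traced back along
  whatever extensions its evaluation needs, and only their total size is controlled.\<close>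

lemma Den_sim_onto:
  assumes A: "sim A A'"
  shows "tame_rule (hsym K) A R e \<Longrightarrow> (\<And>v. e v \<in> hsym K) \<Longrightarrow>
    (\<And>v. supports (Domain p) (e v)) \<Longrightarrow> pinj p \<Longrightarrow> card p + K * need_rule R \<le> L \<Longrightarrow>
    (f, ys, c) \<in> Den R A' (\<lambda>v. T (e v) p) \<Longrightarrow>
    \<exists>xs b q. (f, xs, b) \<in> Den R A e \<and> pinj q \<and> card q \<le> card p + K * need_rule R \<and>
      (\<forall>x\<in>set (b # xs). supports (Domain q) x) \<and> ys = map (\<lambda>x. T x q) xs \<and> c = T b q"
proof (induction R arbitrary: e p)
  case (Update g ss t)
  have sA: "sym_state A" using A by (simp add: sim_def)
  have need: "K * need_tm s \<le> K * need_rule (Update g ss t)" if "s \<in> set ss \<or> s = t" for s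
    using that member_le_sum_list[of "need_tm s" "map need_tm ss"] by (intro mult_le_mono2) auto
  have *: "val A' s (\<lambda>v. T (e v) p) = T (val A s e) p" if "s \<in> set ss \<or> s = t" for s
    using that Update.prems(1) le_trans[OF add_left_mono[OF need[OF that]] Update.prems(5)]
    by (intro val_sim[OF A _ Update.prems(2,3,4)]) (auto simp: list_all_iff)
  have "f = g" "ys = map (\<lambda>s. val A' s (\<lambda>v. T (e v) p)) ss" "c = val A' t (\<lambda>v. T (e v) p)"
    using Update.prems(6) by auto
  then have "ys = map (\<lambda>x. T x p) (map (\<lambda>s. val A s e) ss)" "c = T (val A t e) p"
    using * by (auto simp del: T.simps)
  then show ?case
    using Update.prems(4) val_supports[OF sA Update.prems(3)] \<open>f = g\<close>
    by (intro exI[of _ "map (\<lambda>s. val A s e) ss"] exI[of _ "val A t e"] exI[of _ p])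
      (auto simp del: T.simps)
next
  case (IfElse g R1 R2)
  have sp: "small p" using IfElse.prems(4,5) by (simp add: small_def)
  have need: "card p + (K * need_tm g + K * need_rule R1 + K * need_rule R2) \<le> L"
    using IfElse.prems(5) by (simp add: algebra_simps)
  have need': "K * need_rule (IfElse g R1 R2) = K * need_tm g + K * need_rule R1 + K * need_rule R2"
    by (simp add: algebra_simps)
  have v: "val A' g (\<lambda>v. T (e v) p) = T (val A g e) p"
    using IfElse.prems need by (intro val_sim[OF A]) auto
  have tr: "T (val A g e) p = true_obj \<longleftrightarrow> val A g e = true_obj"
    using A IfElse.prems(1) sp tame_val val_supports[OF _ IfElse.prems(3)]
    by (intro T_eq_constants) (auto simp: sim_def)
  show ?case
  proof (cases "val A g e = true_obj")
    case True
    then have "(f, ys, c) \<in> Den R1 A' (\<lambda>v. T (e v) p)" using IfElse.prems(6) v tr by simp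
    then obtain xs b q where "(f, xs, b) \<in> Den R1 A e" "pinj q" "card q \<le> card p + K * need_rule R1"
      "\<forall>x\<in>set (b # xs). supports (Domain q) x" "ys = map (\<lambda>x. T x q) xs" "c = T b q"
      using IfElse.IH(1)[where e = e and p = p, OF _ IfElse.prems(2,3,4)] IfElse.prems(1) need
      by (auto simp del: T.simps)
    moreover from this have "card q \<le> card p + K * need_rule (IfElse g R1 R2)"
      unfolding need' by linarith
    ultimately show ?thesis using True by (auto simp del: need_rule.simps T.simps)
  next
    case False
    then have "(f, ys, c) \<in> Den R2 A' (\<lambda>v. T (e v) p)" using IfElse.prems(6) v tr by simp
    then obtain xs b q where "(f, xs, b) \<in> Den R2 A e" "pinj q" "card q \<le> card p + K * need_rule R2"
      "\<forall>x\<in>set (b # xs). supports (Domain q) x" "ys = map (\<lambda>x. T x q) xs" "c = T b q"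
      using IfElse.IH(2)[where e = e and p = p, OF _ IfElse.prems(2,3,4)] IfElse.prems(1) need
      by (auto simp del: T.simps)
    moreover from this have "card q \<le> card p + K * need_rule (IfElse g R1 R2)"
      unfolding need' by linarith
    ultimately show ?thesis using False by (auto simp del: need_rule.simps T.simps)
  qed
next
  case (Forall v r R)
  have need: "card p + (K + K * need_tm r + K * need_rule R) \<le> L"
    using Forall.prems(5) by (simp add: algebra_simps)
  have sp: "small p" using Forall.prems(4,5) by (simp add: small_def)
  have rH: "val A r e \<in> hsym K" using Forall.prems(1) tame_val by auto
  have r: "val A' r (\<lambda>v. T (e v) p) = T (val A r e) p"
    using Forall.prems need by (intro val_sim[OF A]) auto
  obtain d where d: "d |\<in>| elts (T (val A r e) p)"
    "(f, ys, c) \<in> Den R A' ((\<lambda>v. T (e v) p)(v := d))"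
    using Forall.prems(6) r by (auto simp del: T.simps)
  obtain a q where a: "a |\<in>| elts (val A r e)" "p \<subseteq> q" "pinj q" "card q \<le> card p + K"
    "supports (Domain q) a" "d = T a q"
    using T_elem[OF rH sp d(1)] by metis
  have aH: "a \<in> hsym K" using hsym_elts[OF rH a(1)] .
  have "T (e w) p = T (e w) q" for w
    using a need L_large Forall.prems by (intro T_mono) auto
  then have "(\<lambda>v. T (e v) p)(v := d) = (\<lambda>w. T ((e(v := a)) w) q)" using a(6) by auto
  then have *: "(f, ys, c) \<in> Den R A' (\<lambda>w. T ((e(v := a)) w) q)" using d(2) by simp
  have "\<exists>xs b q'. (f, xs, b) \<in> Den R A (e(v := a)) \<and> pinj q' \<and> card q' \<le> card q + K * need_rule R \<and>
      (\<forall>x\<in>set (b # xs). supports (Domain q') x) \<and> ys = map (\<lambda>x. T x q') xs \<and> c = T b q'"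
  proof (rule Forall.IH[OF _ _ _ a(3) _ *])
    show "tame_rule (hsym K) A R (e(v := a))" using Forall.prems(1) a(1) by auto
    show "(e(v := a)) w \<in> hsym K" for w using Forall.prems(2) aH by simp
    show "supports (Domain q) ((e(v := a)) w)" for w
      using a(5) supports_mono[OF Forall.prems(3) Domain_mono[OF a(2)]] by simp
    show "card q + K * need_rule R \<le> L" using a(4) need by linarith
  qed
  then obtain xs b q' where q': "(f, xs, b) \<in> Den R A (e(v := a))" "pinj q'"
    "card q' \<le> card q + K * need_rule R" "\<forall>x\<in>set (b # xs). supports (Domain q') x"
    "ys = map (\<lambda>x. T x q') xs" "c = T b q'" by blast
  have "card q' \<le> card p + K * need_rule (Forall v r R)"
    using q'(3) a(4) by (simp add: algebra_simps)
  moreover have "(f, xs, b) \<in> Den (Forall v r R) A e" using q'(1) a(1) by auto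
  ultimately show ?case using q' by blast
qed simp

lemma pinj_empty: "pinj {}"
  by (simp add: pinj_iff)

lemma Den_sim_onto_closed:
  assumes A: "sim A A'" and tame: "tame_rule (hsym K) A R (\<lambda>_. empty_obj)"
    and need: "K * need_rule R \<le> L"
    and c: "(f, ys, c) \<in> Den R A' (\<lambda>_. empty_obj)"
  obtains xs b q where "(f, xs, b) \<in> Den R A (\<lambda>_. empty_obj)" "pinj q" "card q \<le> L"
    "\<forall>x\<in>set (b # xs). supports (Domain q) x" "ys = map (\<lambda>x. T x q) xs" "c = T b q"
proof -
  have "(f, ys, c) \<in> Den R A' (\<lambda>v. T ((\<lambda>_. empty_obj) v) {})"
    using c by (simp add: T_empty)
  from Den_sim_onto[OF A tame constants_hsym(1) constants_supports(1) pinj_empty _ this] need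
  show ?thesis using that by (metis (no_types, lifting) add_0 card.empty le_trans)
qed

text \<open>The allowance \<open>L\<close> is renewed: each update is transported along an injection
  built from supports of its own arguments and values, whose size depends on the rule and on
  \<open>K\<close> alone.\<close>

lemma sim_sequel:
  assumes A: "sim A A'" and tame: "tame_rule (hsym K) A R (\<lambda>_. empty_obj)"
    and need: "K * (need_rule R + max_arity R + 2) \<le> L"
  shows "sim (sequel R A) (sequel R A')"
proof -
  define S S' where S: "S = Den R A (\<lambda>_. empty_obj)" and S': "S' = Den R A' (\<lambda>_. empty_obj)"
  have sA: "sym_state A" using A by (simp add: sim_def)
  have need': "K * need_rule R + K * (max_arity R + 2) \<le> L"
    using need by (simp add: algebra_simps)
  have ee: "(\<lambda>v. T ((\<lambda>_. empty_obj) v) q) = (\<lambda>_. empty_obj)" for q by (simp add: T_empty)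
  have SH: "set xs \<subseteq> hsym K \<and> b \<in> hsym K" if "(f, xs, b) \<in> S" for f xs b
    using tame_rule_Den[OF tame] that S by blast
  \<comment> \<open>\<open>q\<close> is compatible with \<open>p\<close> but need not extend it, so
    room for the evaluation of \<open>R\<close> remains even if \<open>p\<close> has size
    \<open>L\<close>. Two values are covered at once for the sake of clashes.\<close>
  have into: "\<exists>q. pinj (q \<union> p) \<and> card q \<le> L \<and>
      (\<forall>x\<in>set (b # b' # xs). supports (Domain q) x) \<and>
      (f, map (\<lambda>x. T x q) xs, T b q) \<in> S' \<and> (f, map (\<lambda>x. T x q) xs, T b' q) \<in> S'"
    if b: "(f, xs, b) \<in> S" "(f, xs, b') \<in> S" and p: "pinj p" "card p \<le> L" for f xs b b' p
  proof -
    have "set (b # b' # xs) \<subseteq> hsym K" using SH[OF b(1)] SH[OF b(2)] by simp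
    then obtain F where F: "F \<subseteq> X" "card F \<le> K * length (b # b' # xs)"
      "\<forall>x\<in>set (b # b' # xs). supports F x"
      using hsym_list_support[of "b # b' # xs", OF _ K_pos] by blast
    have "K * length (b # b' # xs) \<le> K * (max_arity R + 2)"
      using Den_arity[OF b(1)[unfolded S]] by (intro mult_le_mono2) simp
    then have cF: "card F \<le> K * (max_arity R + 2)" using F(2) by (rule_tac le_trans)
    then obtain q where q: "pinj (q \<union> p)" "Domain q = F" "card q \<le> card F"
      using extend_pinj[OF p(1) F(1)] p(2) need' by force
    have qq: "pinj q" using q(1) by (rule pinj_subset) auto
    have c: "card q + K * need_rule R \<le> L" using q(3) cF need' by linarith
    have "(f, map (\<lambda>x. T x q) xs, T d q) \<in> S'" if "(f, xs, d) \<in> S" "d \<in> {b, b'}" for d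
      using Den_sim_into[OF A tame _ _ qq c, of f xs d] that F(3) constants_hsym(1) constants_supports(1)
      unfolding ee q(2) S S' by auto
    then show ?thesis using q F(3) c b by (intro exI[of _ q]) auto
  qed
  \<comment> \<open>The update of the second machine stems from some location \<open>ys\<close>
    along some \<open>r\<close>. An automorphism aligns \<open>r\<close> with \<open>p\<close>,
    injectivity of \<open>T\<close> turns the image of \<open>ys\<close> into \<open>xs\<close>, and
    the update set of the first machine is closed under automorphisms.\<close>
  have onto: "\<exists>b u. (f, xs, b) \<in> S \<and> p \<subseteq> u \<and> small u \<and> card u \<le> 2 * L \<and> supports (Domain u) b \<and> c = T b u"
    if xs: "set xs \<subseteq> hsym K" "\<forall>x\<in>set xs. supports (Domain p) x" and p: "pinj p" "card p \<le> L"
      and c: "(f, map (\<lambda>x. T x p) xs, c) \<in> S'" for f xs p c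
  proof -
    have nR: "K * need_rule R \<le> L" using need' by linarith
    obtain ys b r where r: "(f, ys, b) \<in> S" "pinj r" "card r \<le> L"
      "\<forall>x\<in>set (b # ys). supports (Domain r) x"
      "map (\<lambda>x. T x p) xs = map (\<lambda>x. T x r) ys" "c = T b r"
      using Den_sim_onto_closed[OF A tame nR c[unfolded S']] unfolding S by metis
    note cr = r(3)
    obtain \<pi> where \<pi>: "\<pi> \<in> auts" "pinj (pmap \<pi> r \<union> p)"
      using align[of r "{}" p] r(2) p cr L_large by auto
    let ?r = "pmap \<pi> r"
    let ?u = "?r \<union> p"
    have cu: "card ?u \<le> 2 * L" using card_Un_le[of ?r p] card_pmap[OF \<pi>(1)] cr p(2) by simp
    have su: "small ?u" using \<pi>(2) cu by (simp add: small_def)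
    have Tu: "T x r = T (map_obj \<pi> x) ?u" "supports (Domain ?u) (map_obj \<pi> x)" "map_obj \<pi> x \<in> hsym K"
      if x: "x \<in> hsym K" "supports (Domain r) x" for x
    proof -
      have s: "supports (Domain ?r) (map_obj \<pi> x)"
        using supports_image[OF \<pi>(1) x(2)] by (simp add: Domain_pmap)
      show H: "map_obj \<pi> x \<in> hsym K" using hsym_map_obj[OF x(1) \<pi>(1)] .
      have "T x r = T (map_obj \<pi> x) ?r" using T_equivariant[OF \<pi>(1)] by simp
      also have "\<dots> = T (map_obj \<pi> x) ?u" using \<pi>(2) cu L_large H s by (intro T_mono) auto
      finally show "T x r = T (map_obj \<pi> x) ?u" .
      show "supports (Domain ?u) (map_obj \<pi> x)" using s by (rule supports_mono) auto
    qed
    have "map (map_obj \<pi>) ys = xs"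
    proof (rule nth_equalityI)
      show len: "length (map (map_obj \<pi>) ys) = length xs" using map_eq_imp_length_eq[OF r(5)] by simp
      fix i assume "i < length (map (map_obj \<pi>) ys)"
      then have i: "i < length xs" "i < length ys" using len by auto
      have yi: "ys ! i \<in> hsym K" "supports (Domain r) (ys ! i)" using SH[OF r(1)] r(4) i by auto
      have xi: "xs ! i \<in> hsym K" "supports (Domain p) (xs ! i)" using xs i by auto
      have "T (map_obj \<pi> (ys ! i)) ?u = T (ys ! i) r" using Tu(1)[OF yi] by simp
      also have "\<dots> = T (xs ! i) p" using arg_cong[OF r(5), of "\<lambda>l. l ! i"] i by simp
      also have "\<dots> = T (xs ! i) ?u" using \<pi>(2) cu L_large xi by (intro T_mono) auto
      finally have "map_obj \<pi> (ys ! i) = xs ! i"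
        using T_inj[OF Tu(3)[OF yi] xi(1) su Tu(2)[OF yi]] supports_mono[OF xi(2), of "Domain ?u"] by auto
      then show "map (map_obj \<pi>) ys ! i = xs ! i" using i by simp
    qed
    then have "(f, xs, map_obj \<pi> b) \<in> S"
      using Den_closed_map_obj[OF sA \<pi>(1)] r(1) unfolding S by blast
    moreover have "c = T (map_obj \<pi> b) ?u" "supports (Domain ?u) (map_obj \<pi> b)"
      using Tu[of b] SH[OF r(1)] r(4,6) by auto
    ultimately show ?thesis using su cu by blast
  qed
  have clash: "clash S \<longleftrightarrow> clash S'"
  proof
    assume "clash S"
    then obtain f xs b c where b: "(f, xs, b) \<in> S" "(f, xs, c) \<in> S" "b \<noteq> c" unfolding clash_def by blast
    obtain q where q: "pinj (q \<union> {})" "card q \<le> L" "\<forall>x\<in>set (b # c # xs). supports (Domain q) x"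
      "(f, map (\<lambda>x. T x q) xs, T b q) \<in> S'" "(f, map (\<lambda>x. T x q) xs, T c q) \<in> S'"
      using into[OF b(1,2) pinj_empty] by auto
    have "small q" using q by (simp add: small_def)
    then have "T b q \<noteq> T c q" using T_inj[of b c q] SH[OF b(1)] SH[OF b(2)] q(3) b(3) by auto
    then show "clash S'" using q unfolding clash_def by blast
  next
    assume "clash S'"
    then obtain f ys c1 c2 where c: "(f, ys, c1) \<in> S'" "(f, ys, c2) \<in> S'" "c1 \<noteq> c2"
      unfolding clash_def by blast
    have nR: "K * need_rule R \<le> L" using need' by linarith
    obtain xs b r where r: "(f, xs, b) \<in> S" "pinj r" "card r \<le> L"
      "\<forall>x\<in>set (b # xs). supports (Domain r) x"
      "ys = map (\<lambda>x. T x r) xs" "c1 = T b r"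
      using Den_sim_onto_closed[OF A tame nR c(1)[unfolded S']] unfolding S by metis
    note cr = r(3)
    \<comment> \<open>With \<open>r\<close> in place of \<open>p\<close>, the second of the clashing
      updates is traced back to the same location \<open>xs\<close> as the first.\<close>
    obtain b' u where u: "(f, xs, b') \<in> S" "r \<subseteq> u" "small u" "card u \<le> 2 * L" "c2 = T b' u"
      using onto[of xs r f c2] SH[OF r(1)] r(2,4,5) cr c(2) by auto
    have "c1 = T b u" unfolding r(6)
      using u r(4) SH[OF r(1)] smallD(1)[OF u(3)] L_large by (intro T_mono) auto
    then have "b \<noteq> b'" using c(3) u(5) by blast
    then show "clash S" using r(1) u(1) unfolding clash_def by blast
  qed
  show ?thesis
  proof (cases "clash S")
    case True
    then show ?thesis using A clash by (simp add: sequel_def S[symmetric] S'[symmetric])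
  next
    case False
    then have no: "\<not> clash S'" using clash by simp
    note d = dyn_sequel[OF S False] and d' = dyn_sequel[OF S' no]
    have sB: "sym_state (sequel R A)" using sym_state_sequel[OF sA] .
    have "dyn (sequel R A) f xs \<in> hsym K \<and>
        T (dyn (sequel R A) f xs) p = dyn (sequel R A') f (map (\<lambda>x. T x p) xs)"
      if xs: "set xs \<subseteq> hsym K" "\<forall>x\<in>set xs. supports (Domain p) x" and p: "pinj p" "card p \<le> L"
      for f xs p
    proof (cases "\<exists>b. (f, xs, b) \<in> S")
      case True
      then obtain b where b: "(f, xs, b) \<in> S" by blast
      obtain q where q: "pinj (q \<union> p)" "card q \<le> L" "\<forall>x\<in>set (b # b # xs). supports (Domain q) x"
        "(f, map (\<lambda>x. T x q) xs, T b q) \<in> S'"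
        using into[OF b b p] by blast
      have cu: "card (q \<union> p) + K + 1 < 8 * L" using card_Un_le[of q p] q(2) p(2) L_large by linarith
      have "T x q = T x p" if "x \<in> hsym K" "supports (Domain q) x" "supports (Domain p) x" for x
        using T_compatible[OF q(1) cu that] .
      \<comment> \<open>\<open>p\<close> is only assumed to support the arguments; symmetry of the
        new state extends this to the value.\<close>
      moreover have "supports (Domain p) b"
        using dyn_supports[OF sB xs(2), of f] d(1)[OF b] by simp
      ultimately have "map (\<lambda>x. T x q) xs = map (\<lambda>x. T x p) xs" "T b q = T b p"
        using xs q(3) SH[OF b] by (auto simp del: T.simps)
      then have "dyn (sequel R A') f (map (\<lambda>x. T x p) xs) = T b p" using d'(1)[OF q(4)] by metis
      then show ?thesis using d(1)[OF b] SH[OF b] by simp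
    next
      case F: False
      then have "\<nexists>c. (f, map (\<lambda>x. T x p) xs, c) \<in> S'" using onto[OF xs p] by blast
      then show ?thesis using d(2)[OF F] d'(2) A xs p by (simp add: sim_def)
    qed
    then show ?thesis using A sB unfolding sim_def input_sequel by blast
  qed
qed

end

section \<open>Polynomially many intermediate values\<close>

text \<open>If \<open>W\<close> contains the active objects, then the objects arising in the evaluation of a term
  on values in \<open>W\<close> number at most \<open>card W\<close> to the power given here.\<close>

primrec exp_tm :: "tm \<Rightarrow> nat" where
  "exp_tm (Var v) = 1"
| "exp_tm (App f ts) = prod_list (map exp_tm ts) + card (\<Union> (set (map fv_tm ts))) + 1"
| "exp_tm (Compr t v r g) =
     exp_tm r * exp_tm g * exp_tm t + card (fv_tm r \<union> ((fv_tm t \<union> fv_tm g) - {v})) + 1"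

primrec exp_rule :: "asm_rule \<Rightarrow> nat" where
  "exp_rule Skip = 1"
| "exp_rule (Update f ss t) = prod_list (map exp_tm ss) * exp_tm t"
| "exp_rule (IfElse g R1 R2) = exp_tm g * exp_rule R1 * exp_rule R2"
| "exp_rule (Forall v r R) = exp_tm r * exp_rule R"

lemma finite_fv_tm: "finite (fv_tm t)"
  by (induction t) auto

lemma val_cong: "(\<And>v. v \<in> fv_tm t \<Longrightarrow> e v = e' v) \<Longrightarrow> val A t e = val A t e'"
proof (induction t arbitrary: e e')
  case (App f ts)
  have "map (\<lambda>t. val A t e) ts = map (\<lambda>t. val A t e') ts"
    using App.prems by (intro map_cong refl App.IH) auto
  then show ?case by (simp only: val.simps)
next
  case (Compr t v r g)
  have r: "val A r e = val A r e'" using Compr.prems by (intro Compr.IH(2)) auto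
  have "val A t (e(v := a)) = val A t (e'(v := a))" "val A g (e(v := a)) = val A g (e'(v := a))" for a
    using Compr.prems by (auto intro!: Compr.IH(1,3))
  then show ?case by (simp add: r)
qed simp

lemma TC_map_obj: "z \<in> TC y \<Longrightarrow> map_obj \<pi> z \<in> TC (map_obj \<pi> y)"
proof (induction rule: TC.induct)
  case (TC_elt u z)
  have "map_obj \<pi> z |\<in>| elts (map_obj \<pi> u)" using TC_elt(2) by (simp add: elts_map_obj)
  with TC_elt(3) show ?case by (rule TC.TC_elt)
qed (rule TC_self)

lemma TC_HF: "z \<in> TC y \<Longrightarrow> y \<in> HF X \<Longrightarrow> z \<in> HF X"
  by (induction rule: TC.induct) (auto dest: elts_in_HF)

lemma transitive_active: "transitive (active A)"
  unfolding transitive_def active_def by (auto intro: TC_elt)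

lemma critical_active: "critical A \<subseteq> active A"
  unfolding active_def using TC_self by blast

lemma active_HF: assumes "is_state U D A" shows "active A \<subseteq> base_set A"
proof -
  have "dyn A f xs \<in> base_set A" for f xs
    using assms empty_in_HF unfolding is_state_def base_set_def by metis
  moreover have "x \<in> base_set A" if "dyn A f xs \<noteq> empty_obj" "x \<in> set xs" for f xs x
    using assms that unfolding is_state_def by blast
  ultimately have "critical A \<subseteq> base_set A"
    using empty_in_HF true_in_HF unfolding critical_def base_set_def false_obj_def
    by (auto intro: HF_Atom)
  then show ?thesis unfolding active_def base_set_def using TC_HF by blast
qed

text \<open>Turns a union of two polynomially bounded sets into a larger exponent. The base is at
  least 2 in the applications to sets of objects because 0 and 1 are active.\<close>

lemma pow_sum_le:
  fixes N :: nat assumes "2 \<le> N" shows "N ^ a + N ^ b \<le> N ^ (a + b + 1)"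
proof -
  have "1 \<le> N ^ a" "1 \<le> N ^ b" using assms by simp_all
  then have "N ^ a \<le> N ^ a * N ^ b" "N ^ b \<le> N ^ a * N ^ b" by simp_all
  then have "N ^ a + N ^ b \<le> 2 * (N ^ a * N ^ b)" by linarith
  also have "\<dots> \<le> N * (N ^ a * N ^ b)" using assms by simp
  finally show ?thesis by (simp add: power_add)
qed

section \<open>Closed sets of values of polynomial size\<close>

context coloured_set
begin

lemma symmetric_active: assumes A: "sym_state A" shows "symmetric (active A)"
proof -
  have "map_obj \<pi> x \<in> critical A" if \<pi>: "\<pi> \<in> auts" and x: "x \<in> critical A" for \<pi> x
  proof -
    have d: "dyn A f (map (map_obj \<pi>) xs) = map_obj \<pi> (dyn A f xs)" for f xs
      using A \<pi> by (simp add: sym_state_def)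
    consider a where "x = Atom a" "a \<in> fset (universe (input A))" | "x = false_obj" | "x = true_obj"
      | f xs where "x = dyn A f xs" | f xs where "dyn A f xs \<noteq> empty_obj" "x \<in> set xs"
      using x unfolding critical_def by blast
    then show ?thesis
    proof cases
      case 1
      then show ?thesis using A autsD(4)[OF \<pi>] by (auto simp: critical_def sym_state_def)
    next
      case 4
      then show ?thesis using d[of f xs, symmetric] by (auto simp: critical_def)
    next
      case 5
      have "dyn A f (map (map_obj \<pi>) xs) \<noteq> empty_obj" using 5(1) d by (simp add: map_obj_eq_empty)
      moreover have "map_obj \<pi> x \<in> set (map (map_obj \<pi>) xs)" using 5(2) by simp
      ultimately show ?thesis unfolding critical_def by blast
    qed (auto simp: critical_def)
  qed
  then show ?thesis unfolding symmetric_def active_def using TC_map_obj by blast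
qed

definition closed_over :: "'a state \<Rightarrow> 'a obj set \<Rightarrow> bool" where
  "closed_over A W \<longleftrightarrow> finite W \<and> symmetric W \<and> transitive W \<and> W \<subseteq> HF X \<and> active A \<subseteq> W"

lemma closed_overD:
  assumes "closed_over A W"
  shows "finite W" "symmetric W" "transitive W" "W \<subseteq> HF X" "active A \<subseteq> W"
    "empty_obj \<in> W" "true_obj \<in> W" "dyn A f xs \<in> W" "x \<in> W \<Longrightarrow> fset (elts x) \<subseteq> W"
    "a \<in> fset (universe (input A)) \<Longrightarrow> Atom a \<in> W" "2 \<le> card W"
proof -
  show *: "finite W" "symmetric W" "transitive W" "W \<subseteq> HF X" "active A \<subseteq> W"
    using assms by (auto simp: closed_over_def)
  have "critical A \<subseteq> W" using critical_active *(5) by blast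
  then show "empty_obj \<in> W" "true_obj \<in> W" "dyn A f xs \<in> W"
    "a \<in> fset (universe (input A)) \<Longrightarrow> Atom a \<in> W"
    unfolding critical_def false_obj_def by blast+
  show "x \<in> W \<Longrightarrow> fset (elts x) \<subseteq> W" using *(3) by (auto simp: transitive_def)
  have "empty_obj \<noteq> (true_obj :: 'a obj)" by (simp add: empty_obj_def true_obj_def finsert_not_fempty[symmetric])
  then have "card {empty_obj, true_obj :: 'a obj} = 2" by simp
  moreover have "card {empty_obj, true_obj :: 'a obj} \<le> card W"
    using *(1) \<open>empty_obj \<in> W\<close> \<open>true_obj \<in> W\<close> by (intro card_mono) auto
  ultimately show "2 \<le> card W" by simp
qed

text \<open>A function application may give a value outside \<open>W\<close>, but only one layer
  above it. Adding such values therefore keeps the set transitive.\<close>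

lemma interp_elts:
  assumes W: "closed_over A W" and xs: "set xs \<subseteq> W"
  shows "fset (elts (interp A f xs)) \<subseteq> W"
proof -
  note W' = closed_overD[OF W]
  have e: "elts empty_obj = {||}" "elts false_obj = {||}" "elts true_obj = {|empty_obj|}"
    by (auto simp: empty_obj_def false_obj_def true_obj_def)
  have b: "fset (elts (of_bool_obj b)) \<subseteq> W" for b
    using W'(6) by (auto simp: of_bool_obj_def e)
  have u: "fset (elts (HSet (ffUnion (elts |`| elts x)))) \<subseteq> W" if x: "x \<in> W" for x
  proof
    fix y assume "y \<in> fset (elts (HSet (ffUnion (elts |`| elts x))))"
    then obtain s where "s |\<in>| elts x" "y |\<in>| elts s" using mem_Union_obj[of y x] by auto
    then show "y \<in> W" using W'(9)[of x] W'(9)[of s] x by blast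
  qed
  have t: "fset (elts (interp A TheUniqueS [x])) \<subseteq> W" if x: "x \<in> W" for x
  proof (cases "\<exists>y. elts x = {|y|}")
    case True
    then obtain y where y: "elts x = {|y|}" by blast
    then have "y \<in> W" using W'(9)[OF x] by simp
    then show ?thesis using interp_TheUnique(1)[OF y] W'(9) by simp
  next
    case False
    then show ?thesis using interp_TheUnique(2) e by (metis empty_iff fset_simps(1) subsetI)
  qed
  have at: "fset (elts (HSet (Atom |`| universe (input A)))) \<subseteq> W" using W'(10) by auto
  show ?thesis
    using xs W'(6)
    by (cases "(A, f, xs)" rule: interp.cases)
      (simp_all add: e b u[simplified] t[unfolded interp.simps] at[simplified] W'(9)[OF W'(8)] split del: if_split)
qed

text \<open>There are at most \<open>card W ^ card (fv_tm t)\<close> assignments to the free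
  variables. The values form a symmetric set because evaluation commutes with automorphisms, and
  \<open>el\<close> makes the union with \<open>W1\<close> transitive.\<close>

lemma add_values:
  assumes A: "sym_state A" "is_state U D A"
    and W: "closed_over A W" and W1: "closed_over A W1" "W \<subseteq> W1" "card W1 \<le> card W ^ c"
    and el: "\<And>e. (\<And>v. e v \<in> W) \<Longrightarrow> fset (elts (val A t e)) \<subseteq> W1"
  obtains W' where "closed_over A W'" "W1 \<subseteq> W'" "card W' \<le> card W ^ (c + card (fv_tm t) + 1)"
    "\<And>e. (\<And>v. e v \<in> W) \<Longrightarrow> val A t e \<in> W'"
proof -
  define V where "V = {val A t e | e. \<forall>v. e v \<in> W}"
  have base: "base_set A = HF X" using A(1) by (simp add: base_set_def sym_state_def)
  \<comment> \<open>Variables that are not free receive the default \<open>empty_obj\<close>, so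
    that only finitely many assignments are counted.\<close>
  let ?h = "\<lambda>h. val A t (\<lambda>v. if v \<in> fv_tm t then h v else empty_obj)"
  have sub: "V \<subseteq> ?h ` (fv_tm t \<rightarrow>\<^sub>E W)"
  proof
    fix x assume "x \<in> V"
    then obtain e where e: "x = val A t e" "\<forall>v. e v \<in> W" unfolding V_def by blast
    have "x = ?h (restrict e (fv_tm t))" unfolding e(1) by (rule val_cong) simp
    moreover have "restrict e (fv_tm t) \<in> fv_tm t \<rightarrow>\<^sub>E W" using e(2) by auto
    ultimately show "x \<in> ?h ` (fv_tm t \<rightarrow>\<^sub>E W)" by (rule image_eqI)
  qed
  have finP: "finite (fv_tm t \<rightarrow>\<^sub>E W)"
    using finite_fv_tm closed_overD(1)[OF W] by (intro finite_PiE) auto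
  have finV: "finite V" using sub finP finite_surj by blast
  have "card V \<le> card (fv_tm t \<rightarrow>\<^sub>E W)" using sub finP surj_card_le by blast
  also have "\<dots> = card W ^ card (fv_tm t)" using finite_fv_tm by (simp add: card_PiE)
  finally have cV: "card V \<le> card W ^ card (fv_tm t)" .
  have "card (W1 \<union> V) \<le> card W ^ c + card W ^ card (fv_tm t)"
    using card_Un_le[of W1 V] W1(3) cV by linarith
  also have "\<dots> \<le> card W ^ (c + card (fv_tm t) + 1)"
    using pow_sum_le[OF closed_overD(11)[OF W]] .
  finally have card: "card (W1 \<union> V) \<le> card W ^ (c + card (fv_tm t) + 1)" .
  have "symmetric V"
    unfolding symmetric_def
  proof (intro ballI)
    fix \<pi> x assume \<pi>: "\<pi> \<in> auts" and "x \<in> V"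
    then obtain e where e: "x = val A t e" "\<forall>v. e v \<in> W" unfolding V_def by blast
    have "map_obj \<pi> x = val A t (\<lambda>v. map_obj \<pi> (e v))" unfolding e(1) val_map_obj[OF A(1) \<pi>] ..
    moreover have "\<forall>v. map_obj \<pi> (e v) \<in> W"
      using e(2) \<pi> closed_overD(2)[OF W] by (auto simp: symmetric_def)
    ultimately show "map_obj \<pi> x \<in> V" unfolding V_def by blast
  qed
  moreover have "V \<subseteq> HF X"
    using val_in_base[OF A(2)] closed_overD(4)[OF W] unfolding V_def base by blast
  moreover have "transitive (W1 \<union> V)"
    using el closed_overD(3)[OF W1(1)] unfolding transitive_def V_def by blast
  ultimately have "closed_over A (W1 \<union> V)"
    using W1(1) finV by (auto simp: closed_over_def symmetric_def)
  moreover have "val A t e \<in> W1 \<union> V" if "\<And>v. e v \<in> W" for e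
    using that unfolding V_def by blast
  ultimately show ?thesis using that[of "W1 \<union> V"] card by blast
qed

text \<open>Enlargement of \<open>W\<close> by a polynomial: nested enlargements compose by
  multiplying exponents, provided that what has been achieved persists in larger sets.\<close>

definition bounded :: "'a state \<Rightarrow> 'a obj set \<Rightarrow> nat \<Rightarrow> ('a obj set \<Rightarrow> bool) \<Rightarrow> bool" where
  "bounded A W c P \<longleftrightarrow> (\<exists>W'. closed_over A W' \<and> W \<subseteq> W' \<and> card W' \<le> card W ^ c \<and> P W')"

lemma bounded_then:
  assumes 1: "bounded A W c P"
    and 2: "\<And>W'. closed_over A W' \<Longrightarrow> W \<subseteq> W' \<Longrightarrow> P W' \<Longrightarrow> bounded A W' d Q"
    and mono: "\<And>W' W''. W' \<subseteq> W'' \<Longrightarrow> P W' \<Longrightarrow> P W''"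
  shows "bounded A W (c * d) (\<lambda>W'. P W' \<and> Q W')"
proof -
  obtain W1 where W1: "closed_over A W1" "W \<subseteq> W1" "card W1 \<le> card W ^ c" "P W1"
    using 1 by (auto simp: bounded_def)
  obtain W2 where W2: "closed_over A W2" "W1 \<subseteq> W2" "card W2 \<le> card W1 ^ d" "Q W2"
    using 2[OF W1(1,2,4)] by (auto simp: bounded_def)
  have "card W1 ^ d \<le> (card W ^ c) ^ d" using W1(3) by (rule power_mono) simp
  then have "card W2 \<le> card W ^ (c * d)" using W2(3) by (simp add: power_mult)
  then show ?thesis using W1 W2 mono[OF W2(2) W1(4)] by (auto simp: bounded_def)
qed

lemma bounded_weaken:
  "bounded A W c P \<Longrightarrow> (\<And>W'. closed_over A W' \<Longrightarrow> W \<subseteq> W' \<Longrightarrow> P W' \<Longrightarrow> Q W') \<Longrightarrow> bounded A W c Q"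
  by (auto simp: bounded_def)

lemma bounded_list:
  assumes "\<And>x W. x \<in> set xs \<Longrightarrow> closed_over A W \<Longrightarrow> bounded A W (c x) (\<lambda>W'. \<forall>e. range e \<subseteq> W \<longrightarrow> P W' x e)"
    and mono: "\<And>W' W'' x e. W' \<subseteq> W'' \<Longrightarrow> P W' x e \<Longrightarrow> P W'' x e"
    and W: "closed_over A W"
  shows "bounded A W (prod_list (map c xs)) (\<lambda>W'. \<forall>e. range e \<subseteq> W \<longrightarrow> list_all (\<lambda>x. P W' x e) xs)"
  using assms(1) W
proof (induction xs arbitrary: W)
  case Nil
  then show ?case by (auto simp: bounded_def)
next
  case (Cons x xs)
  have "bounded A W (c x * prod_list (map c xs)) (\<lambda>W'. (\<forall>e. range e \<subseteq> W \<longrightarrow> P W' x e) \<and>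
      (\<forall>e. range e \<subseteq> W \<longrightarrow> list_all (\<lambda>x. P W' x e) xs))"
  proof (rule bounded_then)
    show "bounded A W (c x) (\<lambda>W'. \<forall>e. range e \<subseteq> W \<longrightarrow> P W' x e)" using Cons.prems by simp
    fix W' assume W': "closed_over A W'" "W \<subseteq> W'"
    have "bounded A W' (prod_list (map c xs)) (\<lambda>W''. \<forall>e. range e \<subseteq> W' \<longrightarrow> list_all (\<lambda>x. P W'' x e) xs)"
      using Cons.prems(1) by (intro Cons.IH[OF _ W'(1)]) auto
    then show "bounded A W' (prod_list (map c xs)) (\<lambda>W''. \<forall>e. range e \<subseteq> W \<longrightarrow> list_all (\<lambda>x. P W'' x e) xs)"
      by (rule bounded_weaken) (use W'(2) in blast)
  qed (use mono in blast)
  then show ?case by (simp add: bounded_def) (metis)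
qed

text \<open>\<open>P\<close> stands for the conditions on the proper subterms. They place the
  elements of the new values into the set before the values themselves are added.\<close>

lemma bounded_values:
  assumes A: "sym_state A" "is_state U D A" and W: "closed_over A W"
    and b: "bounded A W c (\<lambda>W'. \<forall>e. range e \<subseteq> W \<longrightarrow> P W' e)"
    and el: "\<And>W' e. closed_over A W' \<Longrightarrow> W \<subseteq> W' \<Longrightarrow> range e \<subseteq> W \<Longrightarrow> P W' e \<Longrightarrow>
      fset (elts (val A t e)) \<subseteq> W'"
    and mono: "\<And>W' W'' e. W' \<subseteq> W'' \<Longrightarrow> P W' e \<Longrightarrow> P W'' e"
  shows "bounded A W (c + card (fv_tm t) + 1) (\<lambda>W'. \<forall>e. range e \<subseteq> W \<longrightarrow> P W' e \<and> val A t e \<in> W')"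
proof -
  obtain W1 where W1: "closed_over A W1" "W \<subseteq> W1" "card W1 \<le> card W ^ c"
    "\<forall>e. range e \<subseteq> W \<longrightarrow> P W1 e"
    using b by (auto simp: bounded_def)
  have "fset (elts (val A t e)) \<subseteq> W1" if "\<And>v. e v \<in> W" for e
    using that el[OF W1(1,2), of e] W1(4) by blast
  then obtain W' where W': "closed_over A W'" "W1 \<subseteq> W'"
    "card W' \<le> card W ^ (c + card (fv_tm t) + 1)" "\<And>e. (\<And>v. e v \<in> W) \<Longrightarrow> val A t e \<in> W'"
    using add_values[OF A W W1(1-3)] by metis
  have "P W' e \<and> val A t e \<in> W'" if "range e \<subseteq> W" for e
  proof -
    have "e v \<in> W" for v using that by auto
    then show ?thesis using mono[OF W'(2)] W1(4) W'(4) that by blast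
  qed
  moreover have "W \<subseteq> W'" using W1(2) W'(2) by simp
  ultimately show ?thesis unfolding bounded_def using W'(1,3) by blast
qed

lemma bounded_tame:
  assumes A: "sym_state A" "is_state U D A"
  shows "closed_over A W \<Longrightarrow> bounded A W (exp_tm t) (\<lambda>W'. \<forall>e. range e \<subseteq> W \<longrightarrow> tame W' A t e)"
proof (induction t arbitrary: W)
  case (Var v)
  then show ?case by (auto simp: bounded_def)
next
  case (App f ts)
  have "bounded A W (prod_list (map exp_tm ts))
      (\<lambda>W'. \<forall>e. range e \<subseteq> W \<longrightarrow> list_all (\<lambda>t. tame W' A t e) ts)"
    using App.IH tame_mono App.prems by (intro bounded_list) auto
  then have "bounded A W (prod_list (map exp_tm ts) + card (fv_tm (App f ts)) + 1)
      (\<lambda>W'. \<forall>e. range e \<subseteq> W \<longrightarrow> list_all (\<lambda>t. tame W' A t e) ts \<and> val A (App f ts) e \<in> W')"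
  proof (rule bounded_values[OF A App.prems])
    fix W' e assume W': "closed_over A W'" "list_all (\<lambda>t. tame W' A t e) ts"
    have "set (map (\<lambda>t. val A t e) ts) \<subseteq> W'" using W'(2) by (auto simp: list_all_iff intro: tame_val)
    then show "fset (elts (val A (App f ts) e)) \<subseteq> W'" using interp_elts[OF W'(1)] by simp
  qed (auto simp: list_all_iff intro: tame_mono)
  then show ?case by simp
next
  case (Compr t v r g)
  let ?P = "\<lambda>W' e. tame W' A r e \<and>
     (\<forall>a\<in>fset (elts (val A r e)). tame W' A g (e(v := a)) \<and> tame W' A t (e(v := a)))"
  have "bounded A W (exp_tm r * (exp_tm g * exp_tm t))
    (\<lambda>W'. (\<forall>e. range e \<subseteq> W \<longrightarrow> tame W' A r e) \<and>
      (\<forall>e. range e \<subseteq> W \<longrightarrow> (\<forall>a\<in>fset (elts (val A r e)). tame W' A g (e(v := a)) \<and> tame W' A t (e(v := a)))))"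
  proof (rule bounded_then[OF Compr.IH(2)[OF Compr.prems]])
    fix W1 assume W1: "closed_over A W1" "W \<subseteq> W1" "\<forall>e. range e \<subseteq> W \<longrightarrow> tame W1 A r e"
    \<comment> \<open>The bound variable takes elements of values of \<open>r\<close>, which lie in
      \<open>W1\<close> by transitivity; so \<open>g\<close> and \<open>t\<close> are treated over
      \<open>W1\<close> instead of \<open>W\<close>.\<close>
    have ext: "range (e(v := a)) \<subseteq> W1" if "range e \<subseteq> W" "a |\<in>| elts (val A r e)" for e a
    proof -
      have "val A r e \<in> W1" using W1(3) that(1) tame_val by blast
      then have "a \<in> W1" using closed_overD(9)[OF W1(1)] that(2) by blast
      then show ?thesis using that(1) W1(2) by auto
    qed
    have "bounded A W1 (exp_tm g * exp_tm t) (\<lambda>W'. (\<forall>e. range e \<subseteq> W1 \<longrightarrow> tame W' A g e) \<and>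
        (\<forall>e. range e \<subseteq> W1 \<longrightarrow> tame W' A t e))"
    proof (rule bounded_then[OF Compr.IH(3)[OF W1(1)]])
      fix W2 assume W2: "closed_over A W2" "W1 \<subseteq> W2"
      show "bounded A W2 (exp_tm t) (\<lambda>W'. \<forall>e. range e \<subseteq> W1 \<longrightarrow> tame W' A t e)"
        using Compr.IH(1)[OF W2(1)] by (rule bounded_weaken) (use W2(2) in blast)
    qed (use tame_mono in blast)
    then show "bounded A W1 (exp_tm g * exp_tm t) (\<lambda>W'. \<forall>e. range e \<subseteq> W \<longrightarrow>
        (\<forall>a\<in>fset (elts (val A r e)). tame W' A g (e(v := a)) \<and> tame W' A t (e(v := a))))"
      by (rule bounded_weaken) (use ext in blast)
  qed (use tame_mono in blast)
  then have "bounded A W (exp_tm r * (exp_tm g * exp_tm t)) (\<lambda>W'. \<forall>e. range e \<subseteq> W \<longrightarrow> ?P W' e)"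
    by (rule bounded_weaken) blast
  then have "bounded A W (exp_tm r * (exp_tm g * exp_tm t) + card (fv_tm (Compr t v r g)) + 1)
      (\<lambda>W'. \<forall>e. range e \<subseteq> W \<longrightarrow> ?P W' e \<and> val A (Compr t v r g) e \<in> W')"
  proof (rule bounded_values[OF A Compr.prems])
    fix W' e assume "closed_over A W'" "?P W' e"
    then show "fset (elts (val A (Compr t v r g) e)) \<subseteq> W'" using tame_val by fastforce
  next
    fix W' W'' e assume "W' \<subseteq> W''" "?P W' e"
    then show "?P W'' e" using tame_mono by blast
  qed
  then show ?case by (simp add: mult.assoc)
qed

lemma bounded_tame_rule:
  assumes A: "sym_state A" "is_state U D A"
  shows "closed_over A W \<Longrightarrow> bounded A W (exp_rule R) (\<lambda>W'. \<forall>e. range e \<subseteq> W \<longrightarrow> tame_rule W' A R e)"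
proof (induction R arbitrary: W)
  case Skip
  then show ?case by (auto simp: bounded_def)
next
  case (Update f ss t)
  have "bounded A W (prod_list (map exp_tm ss) * exp_tm t)
     (\<lambda>W'. (\<forall>e. range e \<subseteq> W \<longrightarrow> list_all (\<lambda>s. tame W' A s e) ss) \<and>
        (\<forall>e. range e \<subseteq> W \<longrightarrow> tame W' A t e))"
  proof (rule bounded_then)
    show "bounded A W (prod_list (map exp_tm ss)) (\<lambda>W'. \<forall>e. range e \<subseteq> W \<longrightarrow> list_all (\<lambda>s. tame W' A s e) ss)"
      using bounded_tame[OF A] tame_mono Update.prems by (intro bounded_list) auto
    fix W' assume W': "closed_over A W'" "W \<subseteq> W'"
    show "bounded A W' (exp_tm t) (\<lambda>W''. \<forall>e. range e \<subseteq> W \<longrightarrow> tame W'' A t e)"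
      using bounded_tame[OF A W'(1)] by (rule bounded_weaken) (use W'(2) in blast)
  qed (auto simp: list_all_iff intro: tame_mono)
  then show ?case by (simp add: bounded_def) metis
next
  case (IfElse g R1 R2)
  have "bounded A W (exp_tm g * (exp_rule R1 * exp_rule R2))
     (\<lambda>W'. (\<forall>e. range e \<subseteq> W \<longrightarrow> tame W' A g e) \<and>
       ((\<forall>e. range e \<subseteq> W \<longrightarrow> tame_rule W' A R1 e) \<and> (\<forall>e. range e \<subseteq> W \<longrightarrow> tame_rule W' A R2 e)))"
  proof (rule bounded_then[OF bounded_tame[OF A IfElse.prems]])
    fix W1 assume W1: "closed_over A W1" "W \<subseteq> W1"
    show "bounded A W1 (exp_rule R1 * exp_rule R2) (\<lambda>W'. (\<forall>e. range e \<subseteq> W \<longrightarrow> tame_rule W' A R1 e) \<and>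
        (\<forall>e. range e \<subseteq> W \<longrightarrow> tame_rule W' A R2 e))"
    proof (rule bounded_then)
      show "bounded A W1 (exp_rule R1) (\<lambda>W'. \<forall>e. range e \<subseteq> W \<longrightarrow> tame_rule W' A R1 e)"
        using IfElse.IH(1)[OF W1(1)] by (rule bounded_weaken) (use W1(2) in blast)
      fix W2 assume W2: "closed_over A W2" "W1 \<subseteq> W2"
      show "bounded A W2 (exp_rule R2) (\<lambda>W'. \<forall>e. range e \<subseteq> W \<longrightarrow> tame_rule W' A R2 e)"
        using IfElse.IH(2)[OF W2(1)] by (rule bounded_weaken) (use W1(2) W2(2) in blast)
    qed (use tame_rule_mono in blast)
  qed (use tame_mono in blast)
  then show ?case by (simp add: bounded_def mult.assoc) metis
next
  case (Forall v r R)
  have "bounded A W (exp_tm r * exp_rule R)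
    (\<lambda>W'. (\<forall>e. range e \<subseteq> W \<longrightarrow> tame W' A r e) \<and>
      (\<forall>e. range e \<subseteq> W \<longrightarrow> (\<forall>a\<in>fset (elts (val A r e)). tame_rule W' A R (e(v := a)))))"
  proof (rule bounded_then[OF bounded_tame[OF A Forall.prems]])
    fix W1 assume W1: "closed_over A W1" "W \<subseteq> W1" "\<forall>e. range e \<subseteq> W \<longrightarrow> tame W1 A r e"
    have ext: "range (e(v := a)) \<subseteq> W1" if "range e \<subseteq> W" "a |\<in>| elts (val A r e)" for e a
    proof -
      have "val A r e \<in> W1" using W1(3) that(1) tame_val by blast
      then have "a \<in> W1" using closed_overD(9)[OF W1(1)] that(2) by blast
      then show ?thesis using that(1) W1(2) by auto
    qed
    show "bounded A W1 (exp_rule R)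
      (\<lambda>W'. \<forall>e. range e \<subseteq> W \<longrightarrow> (\<forall>a\<in>fset (elts (val A r e)). tame_rule W' A R (e(v := a))))"
      using Forall.IH[OF W1(1)] by (rule bounded_weaken) (use ext in blast)
  qed (use tame_mono in blast)
  then show ?case by (simp add: bounded_def) metis
qed

lemma tame_closure:
  assumes A: "sym_state A" "is_state U D A" "finite (active A)"
  obtains W where "finite W" "symmetric W" "transitive W" "W \<subseteq> HF X"
    "card W \<le> card (active A) ^ exp_rule R" "active A \<subseteq> W" "tame_rule W A R (\<lambda>_. empty_obj)"
proof -
  have base: "base_set A = HF X" using A(1) by (simp add: base_set_def sym_state_def)
  have "closed_over A (active A)"
    using A(3) symmetric_active[OF A(1)] transitive_active active_HF[OF A(2)]
    by (auto simp: closed_over_def base)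
  then obtain W where W: "closed_over A W" "card W \<le> card (active A) ^ exp_rule R"
    "\<forall>e. range e \<subseteq> active A \<longrightarrow> tame_rule W A R e"
    using bounded_tame_rule[OF A(1,2)] unfolding bounded_def by blast
  have "range (\<lambda>_. empty_obj) \<subseteq> active A"
    using critical_active[of A] by (auto simp: critical_def false_obj_def)
  then have tame: "tame_rule W A R (\<lambda>_. empty_obj)" using W(3) by (rule_tac W(3)[rule_format])
  show ?thesis by (rule that[OF closed_overD(1-4)[OF W(1)] W(2) closed_overD(5)[OF W(1)] tame])
qed

end

section \<open>The two graphs\<close>

context similar_structures
begin

lemma sym_state_initial: "sym_state (initial_state I)"
  unfolding sym_state_def
proof (intro conjI ballI allI)
  show "fset (universe (input (initial_state I))) = X" using universe(1) by (simp add: initial_state_def)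
  fix \<pi> P as assume \<pi>: "\<pi> \<in> auts"
  have "set (map \<pi> as) \<subseteq> X \<longleftrightarrow> set as \<subseteq> X" using autsD(4)[OF \<pi>] by auto
  moreover have "map col (map \<pi> as) = map col as" using autsD(3)[OF \<pi>] by simp
  moreover have "rels (input (initial_state I)) P = {as. set as \<subseteq> X \<and> map col as \<in> Q P}"
    by (simp add: initial_state_def rels(1))
  ultimately show "map \<pi> as \<in> rels (input (initial_state I)) P \<longleftrightarrow> as \<in> rels (input (initial_state I)) P"
    by (simp only: mem_Collect_eq)
qed (simp add: initial_state_def)

lemma sym_state_run: "sym_state (run_state R I i)"
  by (induction i) (simp_all add: run_state_def sym_state_initial sym_state_sequel)

lemma sim_run:
  assumes "\<And>j. j < i \<Longrightarrow> tame_rule (hsym K) (run_state R I j) R (\<lambda>_. empty_obj)"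
    and need: "K * (need_rule R + max_arity R + 2) \<le> L"
  shows "sim (run_state R I i) (run_state R I' i)"
  using assms(1)
proof (induction i)
  case 0
  have "sym_state (initial_state I)" by (rule sym_state_initial)
  then show ?case
    by (simp add: run_state_def sim_def) (simp add: initial_state_def constants_hsym(1) T_empty)
next
  case (Suc i)
  then have "sim (run_state R I i) (run_state R I' i)" by simp
  from sim_sequel[OF this Suc.prems[of i] need] show ?case by (simp add: run_state_def)
qed

text \<open>A nullary location involves no atoms, so the empty injection applies, and truth values
  are transported to themselves.\<close>

lemma sim_nullary:
  assumes "sim A A'"
  shows "dyn A' f [] = true_obj \<longleftrightarrow> dyn A f [] = true_obj"
proof -
  have A: "sym_state A" "dyn A f [] \<in> hsym K" "T (dyn A f []) {} = dyn A' f []"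
    using assms pinj_empty unfolding sim_def by (metis card.empty empty_iff empty_set empty_subsetI le0 list.simps(8))+
  have "small {}" using pinj_empty by (simp add: small_def)
  moreover have "supports (Domain {}) (dyn A f [])" using dyn_supports[OF A(1)] by simp
  ultimately show ?thesis using T_eq_constants(1)[OF A(2)] A(3) by metis
qed

end

section \<open>Growth estimates and the choice of the input size\<close>

lemma poly_bound:
  "\<exists>d. \<forall>n\<ge>2. poly q (int n) \<le> int (n ^ d)"
proof (induction q rule: pCons_induct)
  case 0
  then show ?case by auto
next
  case (pCons a q)
  then obtain d where d: "\<forall>n\<ge>2. poly q (int n) \<le> int (n ^ d)" by blast
  have "poly (pCons a q) (int n) \<le> int (n ^ (nat \<bar>a\<bar> + (d + 1) + 1))" if n: "2 \<le> n" for n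
  proof -
    \<comment> \<open>The coefficient is absorbed into the exponent; this uses that \<open>n\<close>
      is at least 2.\<close>
    have "nat \<bar>a\<bar> < 2 ^ nat \<bar>a\<bar>" by (rule less_exp)
    also have "\<dots> \<le> n ^ nat \<bar>a\<bar>" using n by (rule power_mono) simp
    finally have "a \<le> int (n ^ nat \<bar>a\<bar>)" by linarith
    moreover have "int n * poly q (int n) \<le> int n * int (n ^ d)"
      using d n by (intro mult_left_mono) auto
    ultimately have "poly (pCons a q) (int n) \<le> int (n ^ nat \<bar>a\<bar> + n ^ (d + 1))" by simp
    also have "\<dots> \<le> int (n ^ (nat \<bar>a\<bar> + (d + 1) + 1))" using pow_sum_le[OF n] by (simp only: of_nat_le_iff)
    finally show ?thesis .
  qed
  then show ?case by blast
qed

lemma exp_beats_linear: "\<exists>j. A * j + B < (2::nat) ^ j"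
proof -
  \<comment> \<open>The witness is \<open>2 * ?i\<close>: the linear function stays below
    \<open>(?i + 1) * (?i + 1)\<close>, and \<open>?i + 1\<close> is at most
    \<open>2 ^ ?i\<close>.\<close>
  let ?i = "2 * A + B"
  have "A * (2 * ?i) + B < (?i + 1) * (?i + 1)" by (simp add: algebra_simps)
  also have "(?i + 1) * (?i + 1) \<le> 2 ^ ?i * 2 ^ ?i"
  proof (rule mult_le_mono)
    show "?i + 1 \<le> 2 ^ ?i" "?i + 1 \<le> 2 ^ ?i" using Suc_leI[OF less_exp[of ?i]] by (simp_all only: Suc_eq_plus1)
  qed
  also have "\<dots> = 2 ^ (2 * ?i)" by (simp add: power_add[symmetric])
  finally show ?thesis by blast
qed

text \<open>With \<open>m = 2 ^ j\<close> the power \<open>(4 * m) ^ d\<close> is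
  \<open>2 ^ ((j + 2) * d)\<close>, so \<open>t\<close> can be linear in \<open>j\<close> and hence
  logarithmic in \<open>m\<close>. The binomial coefficient is at least
  \<open>(m / Suc d) ^ Suc d\<close>, of degree one higher than \<open>(4 * m) ^ d\<close>, and wins
  once \<open>m\<close> exceeds \<open>2 ^ (2 * d) * Suc d ^ Suc d\<close>.\<close>

lemma large_parameter:
  fixes d C E :: nat
  obtains m t where "C \<le> m" "(4 * m) ^ d < 2 ^ t" "E * t < m" "(4 * m) ^ d < m choose Suc d"
proof -
  obtain j where j: "(E * d) * j + (E * (2 * d + 1) + C + 2 ^ (2 * d) * Suc d ^ Suc d) < (2::nat) ^ j"
    using exp_beats_linear by blast
  let ?m = "2 ^ j :: nat" and ?t = "(j + 2) * d + 1"
  have "4 * ?m = 2 ^ (j + 2)" by (simp add: power_add)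
  then have m4: "(4 * ?m) ^ d = 2 ^ ((j + 2) * d)" by (simp only: power_mult)
  have big: "2 ^ (2 * d) * Suc d ^ Suc d < ?m" using j by linarith
  have sd: "Suc d \<le> ?m"
  proof -
    have "Suc d \<le> Suc d ^ Suc d" by (rule self_le_power) auto
    also have "\<dots> \<le> 2 ^ (2 * d) * Suc d ^ Suc d" by simp
    finally show ?thesis using big by linarith
  qed
  have "(4 * ?m) ^ d * Suc d ^ Suc d = ?m ^ d * (2 ^ (2 * d) * Suc d ^ Suc d)"
    by (simp add: power_mult power_mult_distrib)
  also have "\<dots> < ?m ^ d * ?m" using big by simp
  finally have lt: "(4 * ?m) ^ d * Suc d ^ Suc d < ?m ^ Suc d" by (simp add: mult.commute)
  have "real ((4 * ?m) ^ d) * real (Suc d) ^ Suc d < real ?m ^ Suc d"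
    using lt by (metis of_nat_less_iff of_nat_mult of_nat_power)
  then have "real ((4 * ?m) ^ d) < (real ?m / real (Suc d)) ^ Suc d"
    by (simp add: power_divide pos_less_divide_eq del: of_nat_Suc)
  also have "\<dots> \<le> real (?m choose Suc d)" by (rule binomial_ge_n_over_k_pow_k[OF sd])
  finally have "(4 * ?m) ^ d < ?m choose Suc d" by (simp only: of_nat_less_iff)
  moreover have "E * ?t < ?m" using j by (simp add: algebra_simps)
  moreover have "C \<le> ?m" using j by linarith
  moreover have "(4 * ?m) ^ d < 2 ^ ?t" unfolding m4 by simp
  ultimately show ?thesis using that by blast
qed

text \<open>Boys have the colours 0 and 1, girls 2 and 3; a boy and a girl are adjacent iff their
  colours differ by 2.\<close>

definition colour_rel :: "name \<Rightarrow> nat list set" where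
  "colour_rel P = (if P = ''E'' then {[0, 2], [2, 0], [1, 3], [3, 1]}
     else if P = ''Boy'' then {[0], [1]} else if P = ''Girl'' then {[2], [3]} else {})"

definition colour_graph :: "'a set \<Rightarrow> ('a \<Rightarrow> nat) \<Rightarrow> 'a rel_struct" where
  "colour_graph X c = \<lparr>universe = Abs_fset X,
     rels = (\<lambda>P. {as. set as \<subseteq> X \<and> map c as \<in> colour_rel P})\<rparr>"

section \<open>Colour graphs as instances of Bipartite Matching\<close>

lemma universe_colour_graph: "finite X \<Longrightarrow> fset (universe (colour_graph X c)) = X"
  by (simp add: colour_graph_def Abs_fset_inverse)

lemma rels_colour_graph: "rels (colour_graph X c) P = {as. set as \<subseteq> X \<and> map c as \<in> colour_rel P}"
  by (simp add: colour_graph_def)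

lemma edge_colour_graph: "[u, v] \<in> rels (colour_graph X c) ''E'' \<longleftrightarrow>
    u \<in> X \<and> v \<in> X \<and> (c u, c v) \<in> {(0, 2), (2, 0), (1, 3), (3, 1)}"
  by (auto simp: rels_colour_graph colour_rel_def)

lemma boys_colour_graph: "boys (colour_graph X c) = {a \<in> X. c a = 0} \<union> {a \<in> X. c a = 1}"
  by (auto simp: boys_def rels_colour_graph colour_rel_def)

lemma girls_colour_graph: "girls (colour_graph X c) = {a \<in> X. c a = 2} \<union> {a \<in> X. c a = 3}"
  by (auto simp: girls_def rels_colour_graph colour_rel_def)

lemma bip_instance_colour_graph:
  assumes X: "finite X" "\<And>a. a \<in> X \<Longrightarrow> c a < 4"
    and card: "card {a \<in> X. c a = 0} + card {a \<in> X. c a = 1} = card {a \<in> X. c a = 2} + card {a \<in> X. c a = 3}"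
  shows "bip_instance (colour_graph X c)"
  unfolding bip_instance_def
proof (intro conjI)
  show "is_struct bip_voc (colour_graph X c)"
    unfolding is_struct_def universe_colour_graph[OF X(1)]
    by (auto simp: rels_colour_graph colour_rel_def bip_voc_def split: if_splits)
  show "boys (colour_graph X c) \<inter> girls (colour_graph X c) = {}"
    by (auto simp: boys_colour_graph girls_colour_graph)
  have "c a = 0 \<or> c a = 1 \<or> c a = 2 \<or> c a = 3" if "a \<in> X" for a using X(2)[OF that] by linarith
  then show "boys (colour_graph X c) \<union> girls (colour_graph X c) = fset (universe (colour_graph X c))"
    by (auto simp: boys_colour_graph girls_colour_graph universe_colour_graph[OF X(1)])
  have "card (boys (colour_graph X c)) = card {a \<in> X. c a = 0} + card {a \<in> X. c a = 1}"
    unfolding boys_colour_graph using X(1) by (intro card_Un_disjoint) auto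
  moreover have "card (girls (colour_graph X c)) = card {a \<in> X. c a = 2} + card {a \<in> X. c a = 3}"
    unfolding girls_colour_graph using X(1) by (intro card_Un_disjoint) auto
  ultimately show "card (boys (colour_graph X c)) = card (girls (colour_graph X c))" using card by simp
qed (auto simp: edge_colour_graph boys_colour_graph girls_colour_graph)

lemma colour_graph_matching:
  assumes X: "finite X" "\<And>a. a \<in> X \<Longrightarrow> c a < 4"
    and card: "card {a \<in> X. c a = 0} = card {a \<in> X. c a = 2}" "card {a \<in> X. c a = 1} = card {a \<in> X. c a = 3}"
  shows "has_perfect_matching (colour_graph X c)"
proof -
  let ?C = "\<lambda>i. {a \<in> X. c a = i}"
  have "\<exists>h. bij_betw h (?C 0) (?C 2)" "\<exists>h. bij_betw h (?C 1) (?C 3)"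
    using X(1) card by (intro finite_same_card_bij; simp)+
  then obtain h0 h1 where h0: "bij_betw h0 (?C 0) (?C 2)" and h1: "bij_betw h1 (?C 1) (?C 3)" by blast
  define h where "h a = (if c a = 0 then h0 a else h1 a)" for a
  let ?B = "?C 0 \<union> ?C 1" and ?G = "?C 2 \<union> ?C 3"
  have "bij_betw h (?C 0) (?C 2) = bij_betw h0 (?C 0) (?C 2)"
    "bij_betw h (?C 1) (?C 3) = bij_betw h1 (?C 1) (?C 3)"
    by (rule bij_betw_cong; simp add: h_def)+
  then have b: "bij_betw h (?C 0) (?C 2)" "bij_betw h (?C 1) (?C 3)" using h0 h1 by simp_all
  have hb: "bij_betw h ?B ?G" using b by (rule bij_betw_combine) auto
  have hc: "a \<in> ?C 0 \<Longrightarrow> h a \<in> ?C 2" "a \<in> ?C 1 \<Longrightarrow> h a \<in> ?C 3" for a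
    using bij_betwE[OF b(1)] bij_betwE[OF b(2)] by blast+
  define F where "F = (\<lambda>a. {a, h a}) ` ?B"
  have "F \<subseteq> edges (colour_graph X c)"
    unfolding F_def edges_def edge_colour_graph using hc by fastforce
  moreover have "\<exists>!e. e \<in> F \<and> v \<in> e" if v: "v \<in> X" for v
  proof -
    have hG: "h a \<in> ?G" if "a \<in> ?B" for a using hb that by (auto dest: bij_betwE)
    have inj: "h a = h a' \<Longrightarrow> a = a'" if "a \<in> ?B" "a' \<in> ?B" for a a'
      using hb that by (auto simp: bij_betw_def dest: inj_onD)
    have "v \<in> ?B \<or> v \<in> ?G" using X(2)[OF v] v by auto
    then obtain a where a: "a \<in> ?B" "v = a \<or> v = h a"
      using hb unfolding bij_betw_def by blast
    show ?thesis
    proof (rule ex1I[of _ "{a, h a}"])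
      show "{a, h a} \<in> F \<and> v \<in> {a, h a}" using a by (auto simp: F_def)
      fix e assume "e \<in> F \<and> v \<in> e"
      then obtain a' where a': "a' \<in> ?B" "e = {a', h a'}" "v = a' \<or> v = h a'" by (auto simp: F_def)
      have "a = a'"
        using a(2) a'(3) inj[OF a(1) a'(1)] hG[OF a(1)] hG[OF a'(1)] a(1) a'(1) by auto
      then show "e = {a, h a}" using a'(2) by simp
    qed
  qed
  ultimately show ?thesis
    unfolding has_perfect_matching_def universe_colour_graph[OF X(1)]
    by (intro exI[of _ F] conjI ballI)
qed

text \<open>Hall's condition fails for the boys of colour 0, whose neighbours all have colour 2: a
  perfect matching would map them injectively to the girls of that colour.\<close>

lemma colour_graph_no_matching:
  assumes X: "finite X" and card: "card {a \<in> X. c a = 2} < card {a \<in> X. c a = 0}"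
  shows "\<not> has_perfect_matching (colour_graph X c)"
proof
  let ?C = "\<lambda>i. {a \<in> X. c a = i}"
  assume "has_perfect_matching (colour_graph X c)"
  then obtain F where "F \<subseteq> edges (colour_graph X c) \<and> (\<forall>v\<in>X. \<exists>!e. e \<in> F \<and> v \<in> e)"
    unfolding has_perfect_matching_def universe_colour_graph[OF X] ..
  then have F: "F \<subseteq> edges (colour_graph X c)" and cover: "v \<in> X \<Longrightarrow> \<exists>e. e \<in> F \<and> v \<in> e"
    and unique: "v \<in> X \<Longrightarrow> e \<in> F \<and> v \<in> e \<Longrightarrow> e' \<in> F \<and> v \<in> e' \<Longrightarrow> e = e'" for v e e'
    by (simp, meson, metis)
  have "\<exists>b. b \<in> ?C 2 \<and> {a, b} \<in> F" if a: "a \<in> ?C 0" for a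
  proof -
    obtain e where e: "e \<in> F" "a \<in> e" using cover[of a] a by blast
    then obtain u v where "e = {u, v}" "u \<in> X" "v \<in> X" "(c u, c v) \<in> {(0, 2), (2, 0), (1, 3), (3, 1)}"
      using F unfolding edges_def edge_colour_graph by blast
    then show ?thesis using e a by (auto simp: insert_commute)
  qed
  then obtain h where h: "\<And>a. a \<in> ?C 0 \<Longrightarrow> h a \<in> ?C 2 \<and> {a, h a} \<in> F" by metis
  have "inj_on h (?C 0)"
  proof
    fix a a' assume a: "a \<in> ?C 0" "a' \<in> ?C 0" "h a = h a'"
    have "h a \<in> X" "{a, h a} \<in> F \<and> h a \<in> {a, h a}" "{a', h a} \<in> F \<and> h a \<in> {a', h a}"
      using h[OF a(1)] h[OF a(2)] a(3) by auto
    then have "{a, h a} = {a', h a}" by (rule unique)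
    moreover have "a' \<noteq> h a" using h[OF a(1)] a(2) by auto
    ultimately show "a = a'" unfolding doubleton_eq_iff by blast
  qed
  then have "card (?C 0) \<le> card (?C 2)" using h X by (intro card_inj_on_le[of h]) auto
  then show False using card by simp
qed

lemma card_preimage:
  assumes "bij_betw g X {..<n::nat}" "S \<subseteq> {..<n}"
  shows "card {a \<in> X. g a \<in> S} = card S"
proof -
  have "inj_on g {a \<in> X. g a \<in> S}" using assms(1) by (auto simp: bij_betw_def inj_on_def)
  moreover have "g ` {a \<in> X. g a \<in> S} = S"
  proof
    show "S \<subseteq> g ` {a \<in> X. g a \<in> S}"
    proof
      fix k assume k: "k \<in> S"
      then have "k \<in> g ` X" using assms by (auto simp: bij_betw_def)
      then show "k \<in> g ` {a \<in> X. g a \<in> S}" using k by blast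
    qed
  qed auto
  ultimately have "bij_betw g {a \<in> X. g a \<in> S} S" by (simp add: bij_betw_def)
  then show ?thesis by (rule bij_betw_same_card)
qed

lemma unbalanced_colourings:
  assumes "infinite (UNIV :: 'a set)" "1 \<le> m"
  obtains X :: "'a set" and c c' :: "'a \<Rightarrow> nat" where
    "finite X" "card X = 4 * m" "\<And>a. a \<in> X \<Longrightarrow> c a < 4" "\<And>a. a \<in> X \<Longrightarrow> c' a < 4"
    "\<And>i. i < 4 \<Longrightarrow> card {a \<in> X. c a = i} = m"
    "card {a \<in> X. c' a = 0} = m + 1" "card {a \<in> X. c' a = 1} = m - 1"
    "card {a \<in> X. c' a = 2} = m" "card {a \<in> X. c' a = 3} = m"
proof -
  obtain X :: "'a set" where X: "finite X" "card X = 4 * m"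
    using infinite_arbitrarily_large[OF assms(1)] by blast
  obtain g where g: "bij_betw g X {..<4 * m}"
    using X finite_same_card_bij[of X "{..<4 * m}"] by auto
  have gl: "g a < 4 * m" if "a \<in> X" for a using bij_betwE[OF g] that by auto
  define c where "c a = g a div m" for a
  \<comment> \<open>Compared with \<open>c\<close>, only the atom with index \<open>m\<close>
    changes, from colour 1 to colour 0.\<close>
  define c' where "c' a = (if g a \<le> m then 0 else if g a < 2 * m then 1 else g a div m)" for a
  have dm: "k div m = i \<longleftrightarrow> i * m \<le> k \<and> k < (i + 1) * m" for k i
    using assms(2) by (metis Suc_eq_plus1 div_nat_eqI dividend_less_div_times div_times_less_eq_dividend mult.commute not_less zero_less_one le_trans mult_Suc_right add.commute less_eq_Suc_le One_nat_def)
  have c4: "c a < 4" if "a \<in> X" for a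
    unfolding c_def using gl[OF that] assms(2) by (intro div_less_iff_less_mult[THEN iffD2]) auto
  have 1: "card {a \<in> X. c a = i} = m" if "i < 4" for i
  proof -
    have "{a \<in> X. c a = i} = {a \<in> X. g a \<in> {i * m..<(i + 1) * m}}"
      unfolding c_def dm by auto
    moreover have "(i + 1) * m \<le> 4 * m" using that by (intro mult_le_mono1) simp
    then have "{i * m..<(i + 1) * m} \<subseteq> {..<4 * m}"
    proof (intro subsetI)
      fix k assume "k \<in> {i * m..<(i + 1) * m}"
      then have "k < (i + 1) * m" by simp
      then show "k \<in> {..<4 * m}" using \<open>(i + 1) * m \<le> 4 * m\<close> by (simp only: lessThan_iff)
    qed
    then have "card {a \<in> X. g a \<in> {i * m..<(i + 1) * m}} = (i + 1) * m - i * m"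
      using card_preimage[OF g] by (simp only: card_atLeastLessThan)
    ultimately show ?thesis by simp
  qed
  have 2: "{a \<in> X. c' a = 0} = {a \<in> X. g a \<in> {..m}}" "{a \<in> X. c' a = 1} = {a \<in> X. g a \<in> {m<..<2 * m}}"
    "{a \<in> X. c' a = 2} = {a \<in> X. g a \<in> {2 * m..<3 * m}}"
    "{a \<in> X. c' a = 3} = {a \<in> X. g a \<in> {3 * m..<4 * m}}"
    unfolding c'_def using assms(2) by (auto simp: dm)
  have 3: "card {a \<in> X. c' a = 0} = m + 1" "card {a \<in> X. c' a = 1} = m - 1"
    "card {a \<in> X. c' a = 2} = m" "card {a \<in> X. c' a = 3} = m"
    unfolding 2 using assms(2) by (subst card_preimage[OF g]; auto)+
  have "c' a < 4" if "a \<in> X" for a using c4[OF that] by (auto simp: c'_def c_def)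
  then show ?thesis using that[of X c c'] X c4 1 3 by blast
qed

section \<open>The contradiction for a hypothetical program\<close>

theorem theorem11:
  shows "\<not> in_CPTime bip_voc
             (bip_matching_yes :: 'a::infinite rel_struct set) bip_matching_no"
proof
  assume "in_CPTime bip_voc (bip_matching_yes :: 'a rel_struct set) bip_matching_no"
  then obtain P D where P: "is_program bip_voc D (prog P)"
    and acc: "\<And>I. I \<in> (bip_matching_yes :: 'a rel_struct set) \<Longrightarrow> accepts P I"
    and rej: "\<And>I. I \<in> (bip_matching_no :: 'a rel_struct set) \<Longrightarrow> rejects P I"
    unfolding in_CPTime_def is_ptime_program_def by blast
  define R where "R = prog P"
  obtain d0 where d0: "\<And>n. 2 \<le> n \<Longrightarrow> poly (active_bound P) (int n) \<le> int (n ^ d0)"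
    using poly_bound by blast
  define d where "d = d0 * exp_rule R"
  \<comment> \<open>At most \<open>d\<close> atoms from each of the four colour classes; the added 1
    makes \<open>K\<close> positive also when \<open>d\<close> is 0.\<close>
  define K where "K = 4 * d + 1"
  \<comment> \<open>The first summand is what \<open>sim_run\<close> requires for one step, the rest
    is what the locale \<open>transport\<close> requires.\<close>
  define L where "L = K * (need_rule R + max_arity R + 2) + 2 * K + 2"
  \<comment> \<open>The smallest class of the second graph has \<open>m - 1\<close> atoms, whence
    \<open>8 * L + 1\<close>. The remaining bounds are those of \<open>small_supports\<close> for a
    set of at most \<open>(4 * m) ^ d\<close> objects.\<close>
  obtain m t where m: "8 * L + 1 \<le> m" "(4 * m) ^ d < 2 ^ t" "2 * (K + 2) * t < m"
    "(4 * m) ^ d < m choose Suc d"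
    using large_parameter[of "8 * L + 1" d "2 * (K + 2)"] by metis
  have m1: "1 \<le> m" using m(1) by simp
  obtain X :: "'a set" and c c' :: "'a \<Rightarrow> nat" where
    X: "finite X" "card X = 4 * m" and c: "\<And>a. a \<in> X \<Longrightarrow> c a < 4" and c': "\<And>a. a \<in> X \<Longrightarrow> c' a < 4"
    and cc: "\<And>i. i < 4 \<Longrightarrow> card {a \<in> X. c a = i} = m"
    and cc': "card {a \<in> X. c' a = 0} = m + 1" "card {a \<in> X. c' a = 1} = m - 1"
      "card {a \<in> X. c' a = 2} = m" "card {a \<in> X. c' a = 3} = m"
    using unbalanced_colourings[OF infinite_UNIV m1] by blast
  define I I' where "I = colour_graph X c" and "I' = colour_graph X c'"
  have four: "i = 0 \<or> i = 1 \<or> i = 2 \<or> i = 3" if "i < 4" for i :: nat using that by linarith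
  have img: "c ` X = {..<4}"
  proof
    show "{..<4} \<subseteq> c ` X"
    proof
      fix i :: nat assume "i \<in> {..<4}"
      then have "card {a \<in> X. c a = i} \<noteq> 0" using cc m1 by auto
      then have "{a \<in> X. c a = i} \<noteq> {}" using card.empty by metis
      then show "i \<in> c ` X" by auto
    qed
  qed (use c in auto)
  interpret similar_structures X c c' K L I I' colour_rel
  proof
    show "1 \<le> K" "2 * K + 2 \<le> L" by (auto simp: K_def L_def)
    show "8 * L \<le> card {b \<in> X. c b = c a}" if "a \<in> X" for a
      using cc[OF c[OF that]] m(1) by simp
    show "8 * L \<le> card {b \<in> X. c' b = c a}" if "a \<in> X" for a
      using four[OF c[OF that]] cc' m(1) by auto
    show "c' ` X \<subseteq> c ` X" unfolding img using c' by auto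
    show "fset (universe I) = X" "fset (universe I') = X"
      using X(1) by (simp_all add: I_def I'_def universe_colour_graph)
  qed (use X(1) in \<open>auto simp: I_def I'_def rels_colour_graph\<close>)
  have yes: "I \<in> bip_matching_yes"
    unfolding bip_matching_yes_def I_def
    using bip_instance_colour_graph[OF X(1) c] colour_graph_matching[OF X(1) c] cc by simp
  have no: "I' \<in> bip_matching_no"
    unfolding bip_matching_no_def I'_def
    using bip_instance_colour_graph[OF X(1) c'] colour_graph_no_matching[OF X(1), of c'] cc' m1 by simp
  obtain l where l: "admissible P I l" "halted (run_state R I l)"
    "dyn (run_state R I l) Output [] = true_obj"
    using acc[OF yes] unfolding accepts_def ptime_run_length_def R_def by blast
  obtain l' where l': "in_run R I' l'" "halted (run_state R I' l')"
    "dyn (run_state R I' l') Output [] = false_obj"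
    using rej[OF no] unfolding rejects_def ptime_run_length_def admissible_def R_def by blast
  have state: "is_state bip_voc D (run_state R I i)" for i
    using run_is_state[OF _ P] yes bip_matching_struct unfolding R_def by blast
  define S where "S = (\<Union>i\<le>l. active (run_state R I i))"
  have n: "struct_size I = 4 * m" by (simp add: struct_size_def universe(1) X(2))
  have S: "finite S" "card S \<le> (4 * m) ^ d0"
  proof -
    show "finite S" using l(1) by (simp add: admissible_def S_def R_def Let_def)
    have "int (card S) \<le> poly (active_bound P) (int (4 * m))"
      using l(1) unfolding admissible_def Let_def n S_def R_def by blast
    also have "\<dots> \<le> int ((4 * m) ^ d0)" using m1 by (intro d0) simp
    finally show "card S \<le> (4 * m) ^ d0" by (simp only: of_nat_le_iff)
  qed
  have tame: "tame_rule (hsym K) (run_state R I i) R (\<lambda>_. empty_obj)" if i: "i \<le> l" for i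
  proof -
    let ?A = "run_state R I i"
    have aS: "active ?A \<subseteq> S" using i by (auto simp: S_def)
    obtain W where W: "finite W" "symmetric W" "transitive W" "W \<subseteq> HF X"
      "card W \<le> card (active ?A) ^ exp_rule R" "tame_rule W ?A R (\<lambda>_. empty_obj)"
      using tame_closure[OF sym_state_run state finite_subset[OF aS S(1)]] by metis
    have "card (active ?A) \<le> (4 * m) ^ d0" using card_mono[OF S(1) aS] S(2) by linarith
    then have "card (active ?A) ^ exp_rule R \<le> ((4 * m) ^ d0) ^ exp_rule R" by (rule power_mono) simp
    then have cW: "card W \<le> (4 * m) ^ d" using W(5) by (simp add: d_def power_mult)
    have cls: "card (cls a) = m" if "a \<in> X" for a using cc[OF c[OF that]] by (simp add: cls_def)
    have "W \<subseteq> hsym K"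
    proof
      fix x assume x: "x \<in> W"
      show "x \<in> hsym K"
      proof (rule small_supports[OF W(1-4) _ _ _ _ _ x])
        show "card W < 2 ^ t" using cW m(2) by linarith
        show "2 * ((K + 2) * t) < card (cls a)" if "a \<in> X" for a using m(3) cls[OF that] by (simp add: mult.assoc)
        show "card W < card (cls a) choose Suc d" if "a \<in> X" for a using cW m(4) cls[OF that] by simp
        show "card (c ` X) * d \<le> K" by (simp add: img K_def)
        show "1 \<le> K" by (simp add: K_def)
      qed
    qed
    then show ?thesis using tame_rule_mono[OF W(6)] by blast
  qed
  have sim: "sim (run_state R I i) (run_state R I' i)" if "i \<le> l" for i
    using that tame by (intro sim_run) (auto simp: L_def)
  have halt: "halted (run_state R I' i) \<longleftrightarrow> halted (run_state R I i)" if "i \<le> l" for i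
    unfolding halted_def by (rule sim_nullary[OF sim[OF that]])
  \<comment> \<open>A run stops at its first halting state. Similarity up to step \<open>l\<close>
    suffices in both directions, since a shorter second run would halt within this range.\<close>
  have "\<not> l < l'" using l' l(2) halt[of l] by (auto simp: in_run_def)
  moreover have "\<not> l' < l" using l l'(2) halt[of l'] by (auto simp: admissible_def in_run_def R_def)
  ultimately have "l' = l" by simp
  then have "dyn (run_state R I' l) Output [] = true_obj"
    using sim_nullary[OF sim[OF order_refl]] l(3) by simp
  then show False using l'(3) \<open>l' = l\<close>
    by (simp add: true_obj_def false_obj_def empty_obj_def finsert_not_fempty)
qed

end
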